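(* Let $G(t)$ be a solution of cross curvature flow by rotationally symmetric metrics on the solid torus $M=D^2\times S^1$, with boundary conditions and initial metric as in the context, and define $$J=\int_M\Big(\frac P3-(\det P)^{1/3}\Big)\,dV,$$ where $P=g_{ij}P^{ij}$ is the trace of the Einstein tensor of $G(t)$, $\det P$ is the determinant of the Einstein tensor, and $dV$ is the volume form of $G(t)$. Then $$\frac{dJ}{dt}\le 0 .$$
   Context: Setting. On the solid torus $M=D^2\times S^1$ use cylindrical coordinates $(\mu,\lambda,r)\in[0,1)\times[0,1)\times[0,1]$: a point of $D^2$ is $(r\cos 2\pi\mu, r\sin 2\pi\mu)$ and a point of $S^1$ is $(\cos 2\pi\lambda,\sin 2\pi\lambda)$. The core is $\{r=0\}$, the boundary torus is $\{r=1\}$. Consider time-dependent rotationally symmetric diagonal metrics $G=f^2\,d\mu^2+g^2\,d\lambda^2+h^2\,dr^2$ with $f,g,h$ functions of $(r,t)$, smooth across the core ($g,h$ extend to even functions of $r$ positive at $0$, $f$ extends to an odd function with $f_r(0)=2\pi h(0)$). Put $s(r,t)=\int_0^r h(\rho,t)\,d\rho$ (distance from the core), $\partial_s=h^{-1}\partial_r$; $\partial_t$ is taken at fixed $r$. Put $u=\log f$, $v=\log g$, $w=\log h$. The negatives of the principal sectional curvatures of $G$ are $\alpha=\frac{f_sg_s}{fg}=u_sv_s$, $\beta=\frac{g_{ss}}{g}=v_{ss}+v_s^2$, $\gamma=\frac{f_{ss}}{f}=u_{ss}+u_s^2$ (extended continuously to the core). The Einstein tensor is $P_{ab}=R_{ab}-\frac12Rg_{ab}$,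 $P^{ij}=g^{ia}g^{jb}P_{ab}$, where $g_{ij}$ are the components of $G$; $\det P$ is the determinant of the endomorphism $P^i{}_j$. For these metrics its eigenvalues are $\alpha,\beta,\gamma$, so the trace is $P=\alpha+\beta+\gamma$ and $\det P=\alpha\beta\gamma$. Cross curvature flow is $\partial_tG=-2X$, where $X_{ij}=\frac12P^{uv}R_{iuvj}$; for such metrics it is the system $u_t=\alpha\gamma$, $v_t=\alpha\beta$, $w_t=\beta\gamma$. Boundary conditions at $r=1$: $u=\log(f(1,0)(1+4t)^{1/4})$, $v=\log(g(1,0)(1+4t)^{1/4})$, $w=\log((1+4t)^{1/4})$. Standing assumptions on $G_0=G(\cdot,0)$: it is smooth (with a global $C^{2+\theta}$ bound, $\theta\in(0,1)$ fixed), of the form $f^2\,d\mu^2+g^2\,d\lambda^2+h^2\,dr^2$ with $f,g,h$ functions of $r$ ($g,h$ extending to even functions of $r$ positive at $0$, $f$ extending to an odd function with $f_r(0)=2\pi h(0)$), has negative sectional curvatures, $f(1,0)=\ell_1>2\pi$, $h(1,0)=1$, the initial radius $r_0=s(1,0)$ satisfies $1<r_0<\ell_1/2\pi$, $\alpha=\beta=\gamma>0$ at the core, and (as for the metrics used in the Gromov–Thurston $2\pi$-Theorem) near the boundary torus $f=f(1,0)e^{s-r_0}$, $g=g(1,0)e^{s-r_0}$. *)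

theory Defs
  imports "HOL-Analysis.Analysis"
begin

section \<open>Curvature of a metric in local coordinates on a 3-manifold\<close>

text \<open>A metric is given by its matrix of components \<open>G x\<close> at the coordinate point \<open>x\<close>.
  Curvature conventions: \<open>R(\<partial>\<^sub>i, \<partial>\<^sub>j) \<partial>\<^sub>k = R\<^sup>l\<^sub>i\<^sub>j\<^sub>k \<partial>\<^sub>l\<close> and
  \<open>R\<^sub>i\<^sub>j\<^sub>k\<^sub>l = g\<^sub>l\<^sub>m R\<^sup>m\<^sub>i\<^sub>j\<^sub>k\<close>, so that in an orthonormal frame \<open>R\<^sub>i\<^sub>j\<^sub>j\<^sub>i\<close> is the
  sectional curvature.\<close>

type_synonym metric = "real^3 \<Rightarrow> real^3^3"

definition pd :: "3 \<Rightarrow> (real^3 \<Rightarrow> real) \<Rightarrow> real^3 \<Rightarrow> real" where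
  "pd i F x = deriv (\<lambda>z. F (x + z *\<^sub>R axis i 1)) 0"

definition ginv :: "metric \<Rightarrow> real^3 \<Rightarrow> real^3^3" where
  "ginv G x = matrix_inv (G x)"

definition christoffel :: "metric \<Rightarrow> 3 \<Rightarrow> 3 \<Rightarrow> 3 \<Rightarrow> real^3 \<Rightarrow> real" where
  "christoffel G k i j x = 1 / 2 * (\<Sum>l\<in>UNIV. ginv G x $ k $ l *
     (pd i (\<lambda>y. G y $ j $ l) x + pd j (\<lambda>y. G y $ i $ l) x - pd l (\<lambda>y. G y $ i $ j) x))"

text \<open>\<open>riem_up G l i j k\<close> is \<open>R\<^sup>l\<^sub>i\<^sub>j\<^sub>k\<close>.\<close>

definition riem_up :: "metric \<Rightarrow> 3 \<Rightarrow> 3 \<Rightarrow> 3 \<Rightarrow> 3 \<Rightarrow> real^3 \<Rightarrow> real" where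
  "riem_up G l i j k x =
     pd i (christoffel G l j k) x - pd j (christoffel G l i k) x
     + (\<Sum>m\<in>UNIV. christoffel G l i m x * christoffel G m j k x
                   - christoffel G l j m x * christoffel G m i k x)"

definition riem :: "metric \<Rightarrow> 3 \<Rightarrow> 3 \<Rightarrow> 3 \<Rightarrow> 3 \<Rightarrow> real^3 \<Rightarrow> real" where
  "riem G i j k l x = (\<Sum>m\<in>UNIV. G x $ l $ m * riem_up G m i j k x)"

definition ricci :: "metric \<Rightarrow> 3 \<Rightarrow> 3 \<Rightarrow> real^3 \<Rightarrow> real" where
  "ricci G j k x = (\<Sum>i\<in>UNIV. riem_up G i i j k x)"

definition scalar_curv :: "metric \<Rightarrow> real^3 \<Rightarrow> real" where
  "scalar_curv G x = (\<Sum>i\<in>UNIV. \<Sum>j\<in>UNIV. ginv G x $ i $ j * ricci G i j x)"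

definition sec_curv :: "metric \<Rightarrow> real^3 \<Rightarrow> real^3 \<Rightarrow> real^3 \<Rightarrow> real" where
  "sec_curv G x a b =
     (\<Sum>i\<in>UNIV. \<Sum>j\<in>UNIV. \<Sum>k\<in>UNIV. \<Sum>l\<in>UNIV. riem G i j k l x * a$i * b$j * b$k * a$l)
     / ((a \<bullet> (G x *v a)) * (b \<bullet> (G x *v b)) - (a \<bullet> (G x *v b))\<^sup>2)"

definition einstein :: "metric \<Rightarrow> real^3 \<Rightarrow> real^3^3" where
  "einstein G x = (\<chi> a b. ricci G a b x - 1 / 2 * scalar_curv G x * G x $ a $ b)"

definition einstein_up :: "metric \<Rightarrow> real^3 \<Rightarrow> real^3^3" where
  "einstein_up G x = (\<chi> i j. \<Sum>a\<in>UNIV. \<Sum>b\<in>UNIV.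
     ginv G x $ i $ a * ginv G x $ j $ b * einstein G x $ a $ b)"

definition einstein_trace :: "metric \<Rightarrow> real^3 \<Rightarrow> real" where
  "einstein_trace G x = (\<Sum>i\<in>UNIV. \<Sum>j\<in>UNIV. G x $ i $ j * einstein_up G x $ i $ j)"

definition einstein_det :: "metric \<Rightarrow> real^3 \<Rightarrow> real" where
  "einstein_det G x = det (ginv G x ** einstein G x)"

definition cross_curv :: "metric \<Rightarrow> real^3 \<Rightarrow> real^3^3" where
  "cross_curv G x = (\<chi> i j. 1 / 2 *
     (\<Sum>u\<in>UNIV. \<Sum>v\<in>UNIV. einstein_up G x $ u $ v * riem G i u v j x))"


section \<open>Rotationally symmetric metrics on the solid torus\<close>

text \<open>The coordinates are \<open>x$1 = \<mu>\<close>, \<open>x$2 = \<lambda>\<close>, \<open>x$3 = r\<close>. They are singular at the core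
  \<open>r = 0\<close>, which is left out; statements about the core are made through limits.\<close>

definition chart :: "(real^3) set" where
  "chart = {x. x$1 \<in> {0..<1} \<and> x$2 \<in> {0..<1} \<and> x$3 \<in> {0<..1}}"

text \<open>The components \<open>f\<close>, \<open>g\<close>, \<open>h\<close> take the arguments \<open>r\<close> and \<open>t\<close>, in this order.\<close>

definition rot_metric ::
  "(real \<Rightarrow> real \<Rightarrow> real) \<Rightarrow> (real \<Rightarrow> real \<Rightarrow> real) \<Rightarrow> (real \<Rightarrow> real \<Rightarrow> real) \<Rightarrow> real \<Rightarrow> metric" where
  "rot_metric f g h t x = vector
     [vector [(f (x$3) t)\<^sup>2, 0, 0],
      vector [0, (g (x$3) t)\<^sup>2, 0],
      vector [0, 0, (h (x$3) t)\<^sup>2]]"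

definition core_dist :: "(real \<Rightarrow> real \<Rightarrow> real) \<Rightarrow> real \<Rightarrow> real \<Rightarrow> real" where
  "core_dist h r t = integral {0..r} (\<lambda>\<rho>. h \<rho> t)"

text \<open>Negatives of the principal sectional curvatures at radius \<open>r\<close>.\<close>

definition sec_alpha :: "metric \<Rightarrow> real \<Rightarrow> real" where
  "sec_alpha G r = - sec_curv G (vector [0, 0, r]) (axis 1 1) (axis 2 1)"

definition sec_beta :: "metric \<Rightarrow> real \<Rightarrow> real" where
  "sec_beta G r = - sec_curv G (vector [0, 0, r]) (axis 2 1) (axis 3 1)"

definition sec_gamma :: "metric \<Rightarrow> real \<Rightarrow> real" where
  "sec_gamma G r = - sec_curv G (vector [0, 0, r]) (axis 1 1) (axis 3 1)"

text \<open>\<open>C\<^sup>k\<close> functions on an open set of the \<open>(r, t)\<close>-plane.\<close>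

fun Ck_on :: "nat \<Rightarrow> (real \<times> real) set \<Rightarrow> (real \<times> real \<Rightarrow> real) \<Rightarrow> bool" where
  "Ck_on 0 U F = continuous_on U F"
| "Ck_on (Suc k) U F = (\<exists>F1 F2.
     (\<forall>p\<in>U. (F has_derivative (\<lambda>v. F1 p * fst v + F2 p * snd v)) (at p))
     \<and> Ck_on k U F1 \<and> Ck_on k U F2)"

definition smooth_on :: "(real \<times> real) set \<Rightarrow> (real \<times> real \<Rightarrow> real) \<Rightarrow> bool" where
  "smooth_on U F \<longleftrightarrow> (\<forall>k. Ck_on k U F)"

text \<open>A family of metrics over the time interval \<open>[0, T)\<close>, smooth up to the boundary torus
  \<open>r = 1\<close>, up to the initial time, and across the core. Smoothness on the closed strip means having
  a smooth extension to a neighbourhood; \<open>f\<close>, \<open>g\<close>, \<open>h\<close> stand for such extensions. Their values off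
  the strip are otherwise arbitrary, and derivatives of any order on the strip do not depend on
  them.\<close>

definition rot_metric_family ::
  "real \<Rightarrow> (real \<Rightarrow> real \<Rightarrow> real) \<Rightarrow> (real \<Rightarrow> real \<Rightarrow> real) \<Rightarrow> (real \<Rightarrow> real \<Rightarrow> real) \<Rightarrow> bool" where
  "rot_metric_family T f g h \<longleftrightarrow>
     (\<exists>U. open U \<and> {-1..1} \<times> {0..<T} \<subseteq> U \<and> smooth_on U (\<lambda>(r, t). f r t)
        \<and> smooth_on U (\<lambda>(r, t). g r t) \<and> smooth_on U (\<lambda>(r, t). h r t))
     \<and> (\<forall>t\<in>{0..<T}.
          (\<forall>r\<in>{-1..1}. f (- r) t = - f r t \<and> g (- r) t = g r t \<and> h (- r) t = h r t)
        \<and> (\<forall>r\<in>{0<..1}. f r t > 0)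
        \<and> (\<forall>r\<in>{0..1}. g r t > 0 \<and> h r t > 0)
        \<and> deriv (\<lambda>r. f r t) 0 = 2 * pi * h 0 t)"

definition cross_curvature_flow :: "real \<Rightarrow> (real \<Rightarrow> metric) \<Rightarrow> bool" where
  "cross_curvature_flow T G \<longleftrightarrow>
     (\<forall>t\<in>{0..<T}. \<forall>x\<in>chart. \<forall>i j.
        ((\<lambda>\<tau>. G \<tau> x $ i $ j) has_real_derivative (- 2 * cross_curv (G t) x $ i $ j))
          (at t within {0..<T}))"

definition boundary_conditions ::
  "real \<Rightarrow> (real \<Rightarrow> real \<Rightarrow> real) \<Rightarrow> (real \<Rightarrow> real \<Rightarrow> real) \<Rightarrow> (real \<Rightarrow> real \<Rightarrow> real) \<Rightarrow> bool" where
  "boundary_conditions T f g h \<longleftrightarrow>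
     (\<forall>t\<in>{0..<T}.
        ln (f 1 t) = ln (f 1 0 * (1 + 4 * t) powr (1 / 4))
      \<and> ln (g 1 t) = ln (g 1 0 * (1 + 4 * t) powr (1 / 4))
      \<and> ln (h 1 t) = ln ((1 + 4 * t) powr (1 / 4)))"

definition C2_holder_bound :: "real \<Rightarrow> (real \<Rightarrow> real) \<Rightarrow> bool" where
  "C2_holder_bound \<theta> F \<longleftrightarrow>
     (\<exists>C. \<forall>x\<in>{0..1}. \<bar>F x\<bar> \<le> C \<and> \<bar>deriv F x\<bar> \<le> C \<and> \<bar>deriv (deriv F) x\<bar> \<le> C
        \<and> (\<forall>y\<in>{0..1}. \<bar>deriv (deriv F) x - deriv (deriv F) y\<bar> \<le> C * \<bar>x - y\<bar> powr \<theta>))"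

text \<open>Smoothness, parity and positivity of the initial metric are part of
  \<^const>\<open>rot_metric_family\<close>.\<close>

definition initial_conditions ::
  "real \<Rightarrow> (real \<Rightarrow> real \<Rightarrow> real) \<Rightarrow> (real \<Rightarrow> real \<Rightarrow> real) \<Rightarrow> (real \<Rightarrow> real \<Rightarrow> real) \<Rightarrow> bool" where
  "initial_conditions \<theta> f g h \<longleftrightarrow>
     C2_holder_bound \<theta> (\<lambda>r. f r 0) \<and> C2_holder_bound \<theta> (\<lambda>r. g r 0) \<and> C2_holder_bound \<theta> (\<lambda>r. h r 0)
     \<and> (\<forall>x\<in>chart. \<forall>a b. a \<noteq> b \<and> independent {a, b} \<longrightarrow> sec_curv (rot_metric f g h 0) x a b < 0)
     \<and> (\<exists>\<kappa>>0. (sec_alpha (rot_metric f g h 0) \<longlongrightarrow> \<kappa>) (at_right 0)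
            \<and> (sec_beta (rot_metric f g h 0) \<longlongrightarrow> \<kappa>) (at_right 0)
            \<and> (sec_gamma (rot_metric f g h 0) \<longlongrightarrow> \<kappa>) (at_right 0))
     \<and> f 1 0 > 2 * pi \<and> h 1 0 = 1
     \<and> 1 < core_dist h 1 0 \<and> core_dist h 1 0 < f 1 0 / (2 * pi)
     \<and> (\<exists>\<epsilon>>0. \<forall>r\<in>{0..1}. r > 1 - \<epsilon> \<longrightarrow>
            f r 0 = f 1 0 * exp (core_dist h r 0 - core_dist h 1 0)
          \<and> g r 0 = g 1 0 * exp (core_dist h r 0 - core_dist h 1 0))"

text \<open>The volume form is \<open>sqrt (det G) d\<mu> d\<lambda> dr\<close>. The value of the integrand on the core, a null
  set, is immaterial.\<close>

definition J_integral :: "metric \<Rightarrow> real" where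
  "J_integral G =
     (LINT y:{0..<1} \<times> {0..<1} \<times> {0..1}|lborel. (case y of (m, l, r) \<Rightarrow>
        let x = vector [m, l, r] in
        (einstein_trace G x / 3 - root 3 (einstein_det G x)) * sqrt (det (G x))))"

end

theory Submission
  imports Defs
begin

text \<open>Write \<open>a = u\<^sub>s\<close>, \<open>b = v\<^sub>s\<close>, so that \<open>\<alpha> = a b\<close>, \<open>\<beta> = b\<^sub>s + b\<^sup>2\<close>, \<open>\<gamma> = a\<^sub>s + a\<^sup>2\<close> and
  \<open>\<alpha>\<^sub>s = b (\<gamma> - \<alpha>) + a (\<beta> - \<alpha>)\<close>. Along the flow
  \<open>\<gamma>\<^sub>t = \<alpha> \<gamma>\<^sub>s\<^sub>s + (3 b \<gamma> + a \<beta> - 2 b \<alpha>) \<gamma>\<^sub>s + (2 b\<^sup>2 (\<alpha> - \<gamma>) - 2 \<alpha> \<beta>) \<gamma>\<close>, and symmetrically for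
  \<open>\<beta>\<close>, so the minimum principle keeps the curvatures negative: on the boundary torus flow and boundary
  conditions force \<open>\<alpha> = \<beta> = \<gamma> = (1 + 4 t)\<^sup>-\<^sup>1\<^sup>/\<^sup>2\<close>. With \<open>c = (\<alpha> \<beta> \<gamma>)\<^sup>1\<^sup>/\<^sup>3\<close> and
  \<open>S = \<alpha> \<beta> + \<beta> \<gamma> + \<gamma> \<alpha>\<close>, the time derivative of the integrand of \<open>J\<close> is the divergence of a flux plus
  \<open>\<alpha> \<beta> \<gamma> - c S / 3 - 2/9 c \<alpha> (m\<^sup>2 + n\<^sup>2 - m n)\<close>, where \<open>m = (\<gamma> - \<alpha>) / a + \<gamma>\<^sub>s / \<gamma>\<close> and
  \<open>n = (\<beta> - \<alpha>) / b + \<beta>\<^sub>s / \<beta>\<close>. The second part is nonpositive by the inequality of arithmetic and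
  geometric means. The flux vanishes on the core, and on the boundary torus the contributions of
  the trace and of the determinant cancel since \<open>\<alpha> = \<beta> = \<gamma>\<close> there.\<close>

section \<open>Smooth functions of two variables\<close>

text \<open>The obstacle is the core. There \<open>f = 0\<close>, so \<open>a\<close> has a pole of
  the form \<open>1 / (h r)\<close>, and the evolution equations are derived only for
  \<open>0 < r < 1\<close>, \<open>0 < t < T\<close>, whereas the minimum principle and the flux
  need control up to \<open>r = 0\<close>. Hadamard's trick resolves this: \<open>f / r\<close>,
  \<open>f_rr / r\<close>, \<open>g_r / r\<close>, \<open>h_r / r\<close> are written as averages of
  a derivative along the segment from the core, hence are smooth across it, and so are the
  curvatures built from them. These are even in \<open>r\<close>, so their
  \<open>r\<close>-derivatives vanish at \<open>r = 0\<close> and a minimum on the core can be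
  treated like an interior one. Positivity of the curvatures enters twice: it keeps the cube root
  away from its singularity at 0, and it gives the signs in the dissipation inequality. The minimum
  principle uses no parabolic equation for \<alpha>; the first-order relation for
  \<open>\<alpha>_s\<close> replaces it. Since the evolution equations are used at positive times
  only, the sign of \<open>dJ/dt\<close> at \<open>t = 0\<close> is obtained as a limit.\<close>

lemma Ck_on_SucI:
  assumes "\<And>p. p \<in> U \<Longrightarrow> (F has_derivative (\<lambda>v. A p * fst v + B p * snd v)) (at p)"
    "Ck_on k U A" "Ck_on k U B"
  shows "Ck_on (Suc k) U F"
  unfolding Ck_on.simps
  by (rule exI[of _ A], rule exI[of _ B]) (intro conjI ballI assms)

lemma Ck_on_SucE:
  assumes "Ck_on (Suc k) U F"
  obtains A B where
    "\<forall>p\<in>U. (F has_derivative (\<lambda>v. A p * fst v + B p * snd v)) (at p)"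
    "Ck_on k U A" "Ck_on k U B"
  using assms unfolding Ck_on.simps by (elim exE conjE)

lemma Ck_on_subset: "Ck_on k U F \<Longrightarrow> V \<subseteq> U \<Longrightarrow> Ck_on k V F"
proof (induction k arbitrary: F)
  case 0
  then show ?case by (auto intro: continuous_on_subset)
next
  case (Suc k)
  obtain A B where F: "\<forall>p\<in>U. (F has_derivative (\<lambda>v. A p * fst v + B p * snd v)) (at p)"
    "Ck_on k U A" "Ck_on k U B" using Ck_on_SucE[OF Suc.prems(1)] .
  show ?case
    by (rule Ck_on_SucI[OF F(1)[rule_format] Suc.IH[OF F(2)] Suc.IH[OF F(3)]]) (use Suc.prems(2) in auto)
qed

lemma Ck_on_continuous:
  assumes "Ck_on k U F"
  shows "continuous_on U F"
proof (cases k)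
  case (Suc l)
  with assms obtain A B
    where "\<forall>p\<in>U. (F has_derivative (\<lambda>v. A p * fst v + B p * snd v)) (at p)"
    using Ck_on_SucE by blast
  then show ?thesis
    by (meson continuous_at_imp_continuous_on has_derivative_continuous)
qed (use assms in simp)

lemma Ck_on_Suc_imp: "Ck_on (Suc k) U F \<Longrightarrow> Ck_on k U F"
proof (induction k arbitrary: F)
  case 0
  then show ?case using Ck_on_continuous[OF 0] by simp
next
  case (Suc k)
  obtain A B where F: "\<forall>p\<in>U. (F has_derivative (\<lambda>v. A p * fst v + B p * snd v)) (at p)"
    "Ck_on (Suc k) U A" "Ck_on (Suc k) U B" using Ck_on_SucE[OF Suc.prems] .
  show ?case
    by (rule Ck_on_SucI[OF F(1)[rule_format] Suc.IH[OF F(2)] Suc.IH[OF F(3)]])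
qed

lemma Ck_on_cong:
  assumes "open U" "\<And>p. p \<in> U \<Longrightarrow> F p = G p"
  shows "Ck_on k U F \<Longrightarrow> Ck_on k U G"
proof (induction k)
  case 0
  then show ?case using assms(2) by (simp cong: continuous_on_cong)
next
  case (Suc k)
  from Suc.prems show ?case
  proof (rule Ck_on_SucE)
    fix A B
    assume *: "\<forall>p\<in>U. (F has_derivative (\<lambda>v. A p * fst v + B p * snd v)) (at p)"
      "Ck_on k U A" "Ck_on k U B"
    show ?thesis
      by (rule Ck_on_SucI[OF has_derivative_transform_within_open[OF *(1)[rule_format] assms(1)] *(2,3)])
         (simp_all add: assms(2))
  qed
qed

lemma Ck_on_const: "Ck_on k U (\<lambda>_. c)"
proof (induction k arbitrary: c)
  case (Suc k)
  show ?case by (rule Ck_on_SucI[where A="\<lambda>_. 0" and B="\<lambda>_. 0"]) (simp_all add: Suc)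
qed simp

lemma Ck_on_fst: "Ck_on k U fst"
proof (cases k)
  case (Suc k)
  show ?thesis unfolding Suc
    by (rule Ck_on_SucI[where A="\<lambda>_. 1" and B="\<lambda>_. 0"])
       (auto intro: Ck_on_const has_derivative_fst)
qed (auto intro: continuous_intros)

lemma Ck_on_add: "Ck_on k U F \<Longrightarrow> Ck_on k U G \<Longrightarrow> Ck_on k U (\<lambda>p. F p + G p)"
proof (induction k arbitrary: F G)
  case 0
  then show ?case by (auto intro: continuous_intros)
next
  case (Suc k)
  obtain A B where F: "\<forall>p\<in>U. (F has_derivative (\<lambda>v. A p * fst v + B p * snd v)) (at p)"
    "Ck_on k U A" "Ck_on k U B" using Ck_on_SucE[OF Suc.prems(1)] .
  obtain A' B' where G: "\<forall>p\<in>U. (G has_derivative (\<lambda>v. A' p * fst v + B' p * snd v)) (at p)"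
    "Ck_on k U A'" "Ck_on k U B'" using Ck_on_SucE[OF Suc.prems(2)] .
  show ?case
  proof (rule Ck_on_SucI)
    fix p assume "p \<in> U"
    show "((\<lambda>p. F p + G p) has_derivative (\<lambda>v. (A p + A' p) * fst v + (B p + B' p) * snd v)) (at p)"
      by (rule has_derivative_eq_rhs[OF has_derivative_add[OF F(1)[rule_format] G(1)[rule_format]]])
         (simp_all add: \<open>p \<in> U\<close> algebra_simps)
  qed (intro Suc.IH F G)+
qed

lemma Ck_on_mult: "Ck_on k U F \<Longrightarrow> Ck_on k U G \<Longrightarrow> Ck_on k U (\<lambda>p. F p * G p)"
proof (induction k arbitrary: F G)
  case 0
  then show ?case by (auto intro: continuous_intros)
next
  case (Suc k)
  obtain A B where F: "\<forall>p\<in>U. (F has_derivative (\<lambda>v. A p * fst v + B p * snd v)) (at p)"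
    "Ck_on k U A" "Ck_on k U B" using Ck_on_SucE[OF Suc.prems(1)] .
  obtain A' B' where G: "\<forall>p\<in>U. (G has_derivative (\<lambda>v. A' p * fst v + B' p * snd v)) (at p)"
    "Ck_on k U A'" "Ck_on k U B'" using Ck_on_SucE[OF Suc.prems(2)] .
  show ?case
  proof (rule Ck_on_SucI)
    fix p assume "p \<in> U"
    show "((\<lambda>p. F p * G p) has_derivative
        (\<lambda>v. (A p * G p + F p * A' p) * fst v + (B p * G p + F p * B' p) * snd v)) (at p)"
      by (rule has_derivative_eq_rhs[OF has_derivative_mult[OF F(1)[rule_format] G(1)[rule_format]]])
         (simp_all add: \<open>p \<in> U\<close> algebra_simps)
  qed (intro Ck_on_add Suc.IH F G Ck_on_Suc_imp[OF Suc.prems(1)] Ck_on_Suc_imp[OF Suc.prems(2)])+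
qed

lemma Ck_on_inverse:
  assumes nz: "\<And>p. p \<in> U \<Longrightarrow> F p \<noteq> 0"
  shows "Ck_on k U F \<Longrightarrow> Ck_on k U (\<lambda>p. inverse (F p))"
proof (induction k)
  case 0
  then show ?case using nz by (auto intro: continuous_intros)
next
  case (Suc k)
  obtain A B where F: "\<forall>p\<in>U. (F has_derivative (\<lambda>v. A p * fst v + B p * snd v)) (at p)"
    "Ck_on k U A" "Ck_on k U B" using Ck_on_SucE[OF Suc.prems] .
  show ?case
  proof (rule Ck_on_SucI)
    fix p assume p: "p \<in> U"
    show "((\<lambda>p. inverse (F p)) has_derivative
        (\<lambda>v. (- 1 * (inverse (F p) * inverse (F p)) * A p) * fst v
           + (- 1 * (inverse (F p) * inverse (F p)) * B p) * snd v)) (at p)"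
      by (rule has_derivative_eq_rhs[OF Deriv.has_derivative_inverse[OF nz[OF p] F(1)[rule_format, OF p]]])
         (simp add: algebra_simps)
  qed (intro Ck_on_mult Ck_on_const F Suc.IH[OF Ck_on_Suc_imp[OF Suc.prems]])+
qed

section \<open>Partial derivatives and their symmetry\<close>

definition dr :: "(real \<times> real \<Rightarrow> real) \<Rightarrow> real \<times> real \<Rightarrow> real" where
  "dr F p = deriv (\<lambda>x. F (x, snd p)) (fst p)"

definition dt :: "(real \<times> real \<Rightarrow> real) \<Rightarrow> real \<times> real \<Rightarrow> real" where
  "dt F p = deriv (\<lambda>t. F (fst p, t)) (snd p)"

lemma partials_of_has_derivative:
  assumes "(F has_derivative (\<lambda>v. A * fst v + B * snd v)) (at (x, t))"
  shows "((\<lambda>x. F (x, t)) has_real_derivative A) (at x)" "((\<lambda>t. F (x, t)) has_real_derivative B) (at t)"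
proof -
  have "((\<lambda>x. F (x, t)) has_derivative (\<lambda>v. A * fst (v, 0::real) + B * snd (v, 0::real))) (at x)"
    by (rule has_derivative_compose[where f="\<lambda>x. (x, t)", OF _ assms])
       (auto intro!: derivative_eq_intros)
  then show "((\<lambda>x. F (x, t)) has_real_derivative A) (at x)"
    by (simp add: has_field_derivative_def)
  have "((\<lambda>t. F (x, t)) has_derivative (\<lambda>v. A * fst (0::real, v) + B * snd (0::real, v))) (at t)"
    by (rule has_derivative_compose[where f="\<lambda>t. (x, t)", OF _ assms])
       (auto intro!: derivative_eq_intros)
  then show "((\<lambda>t. F (x, t)) has_real_derivative B) (at t)"
    by (simp add: has_field_derivative_def)
qed

lemma dr_dt_of_has_derivative:
  assumes "(F has_derivative (\<lambda>v. A * fst v + B * snd v)) (at p)"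
  shows "dr F p = A" "dt F p = B"
  using partials_of_has_derivative[of F A B "fst p" "snd p"] assms
  by (auto simp: dr_def dt_def DERIV_imp_deriv)

context
  fixes U :: "(real \<times> real) set" and F :: "real \<times> real \<Rightarrow> real"
  assumes U: "open U" and F: "smooth_on U F"
begin

lemma smooth_on_has_derivative:
  assumes "p \<in> U"
  shows "(F has_derivative (\<lambda>v. dr F p * fst v + dt F p * snd v)) (at p)"
proof -
  have "Ck_on (Suc 0) U F" using F smooth_on_def by blast
  then obtain A B where "(F has_derivative (\<lambda>v. A p * fst v + B p * snd v)) (at p)"
    using assms Ck_on_SucE by metis
  with dr_dt_of_has_derivative[OF this] show ?thesis by simp
qed

lemma smooth_on_DERIV_dr:
  "(x, t) \<in> U \<Longrightarrow> ((\<lambda>x. F (x, t)) has_real_derivative dr F (x, t)) (at x)"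
  and smooth_on_DERIV_dt:
  "(x, t) \<in> U \<Longrightarrow> ((\<lambda>t. F (x, t)) has_real_derivative dt F (x, t)) (at t)"
  using partials_of_has_derivative[OF smooth_on_has_derivative] by blast+

text \<open>In \<open>Ck_on\<close> the partial derivatives are quantified afresh for every order.
  Uniqueness of derivatives identifies all these witnesses on \<open>U\<close> with
  \<open>dr F\<close> and \<open>dt F\<close>, which therefore serve for all orders at once.\<close>

lemma smooth_on_dr: "smooth_on U (dr F)" and smooth_on_dt: "smooth_on U (dt F)"
proof -
  have "Ck_on k U (dr F) \<and> Ck_on k U (dt F)" for k
  proof -
    have "Ck_on (Suc k) U F" using F smooth_on_def by blast
    then obtain A B where AB: "Ck_on k U A" "Ck_on k U B"
      and "\<forall>p\<in>U. (F has_derivative (\<lambda>v. A p * fst v + B p * snd v)) (at p)"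
      using Ck_on_SucE by metis
    then have "\<And>p. p \<in> U \<Longrightarrow> A p = dr F p \<and> B p = dt F p"
      using dr_dt_of_has_derivative by metis
    then show ?thesis using AB Ck_on_cong[OF U] by metis
  qed
  then show "smooth_on U (dr F)" "smooth_on U (dt F)" by (auto simp: smooth_on_def)
qed

lemma smooth_on_continuous: "continuous_on U F"
  using F Ck_on_continuous smooth_on_def by blast

end

lemma smooth_on_subset: "smooth_on U F \<Longrightarrow> V \<subseteq> U \<Longrightarrow> smooth_on V F"
  by (auto simp: smooth_on_def intro: Ck_on_subset)

lemma smooth_on_const: "smooth_on U (\<lambda>_. c)"
  and smooth_on_fst: "smooth_on U fst"
  and smooth_on_add: "smooth_on U F \<Longrightarrow> smooth_on U G \<Longrightarrow> smooth_on U (\<lambda>p. F p + G p)"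
  and smooth_on_mult: "smooth_on U F \<Longrightarrow> smooth_on U G \<Longrightarrow> smooth_on U (\<lambda>p. F p * G p)"
  and smooth_on_inverse:
    "smooth_on U F \<Longrightarrow> (\<And>p. p \<in> U \<Longrightarrow> F p \<noteq> 0) \<Longrightarrow> smooth_on U (\<lambda>p. inverse (F p))"
  by (auto simp: smooth_on_def intro: Ck_on_const Ck_on_fst Ck_on_add Ck_on_mult Ck_on_inverse)

lemma smooth_on_diff:
  assumes "smooth_on U F" "smooth_on U G" shows "smooth_on U (\<lambda>p. F p - G p)"
  using smooth_on_add[OF assms(1) smooth_on_mult[OF smooth_on_const[of U "-1"] assms(2)]] by simp

lemma smooth_on_divide:
  "smooth_on U F \<Longrightarrow> smooth_on U G \<Longrightarrow> (\<And>p. p \<in> U \<Longrightarrow> G p \<noteq> 0) \<Longrightarrow> smooth_on U (\<lambda>p. F p / G p)"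
  using smooth_on_mult[OF _ smooth_on_inverse] by (simp add: divide_inverse)

lemma smooth_on_power: "smooth_on U F \<Longrightarrow> smooth_on U (\<lambda>p. F p ^ n)"
  by (induction n) (auto intro: smooth_on_const smooth_on_mult)

lemmas smooth_on_intros = smooth_on_const smooth_on_fst smooth_on_add smooth_on_mult
  smooth_on_diff smooth_on_divide smooth_on_power

text \<open>Two applications of the mean value theorem, first in \<open>x\<close> to the increment
  of \<open>F\<close> in \<open>t\<close>, then in \<open>t\<close> to \<open>Fr\<close>. The second
  difference is symmetric in the two variables, so the same lemma with the roles exchanged yields
  the other mixed partial.\<close>

lemma mixed_difference_quotient:
  fixes F :: "real \<times> real \<Rightarrow> real"
  assumes "e > 0" and sub: "{x..x+e} \<times> {t..t+e} \<subseteq> U"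
    and Fr: "\<And>x t. (x, t) \<in> U \<Longrightarrow> ((\<lambda>x. F (x, t)) has_real_derivative Fr (x, t)) (at x)"
    and Frt: "\<And>x t. (x, t) \<in> U \<Longrightarrow> ((\<lambda>t. Fr (x, t)) has_real_derivative Frt (x, t)) (at t)"
  obtains q where "q \<in> {x..x+e} \<times> {t..t+e}"
    "F (x+e, t+e) - F (x+e, t) - F (x, t+e) + F (x, t) = e^2 * Frt q"
proof -
  have "\<exists>y>x. y < x + e \<and> (F (x+e, t+e) - F (x+e, t)) - (F (x, t+e) - F (x, t))
      = (x + e - x) * (Fr (y, t+e) - Fr (y, t))"
    using \<open>e > 0\<close> sub
    by (intro MVT2) (auto intro!: DERIV_diff Fr)
  then obtain y where y: "x < y" "y < x + e" 
    "(F (x+e, t+e) - F (x+e, t)) - (F (x, t+e) - F (x, t)) = e * (Fr (y, t+e) - Fr (y, t))" by auto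
  have "\<exists>s>t. s < t + e \<and> Fr (y, t+e) - Fr (y, t) = (t + e - t) * Frt (y, s)"
    using \<open>e > 0\<close> sub y
    by (intro MVT2) (auto intro!: Frt)
  then obtain s where "t < s" "s < t + e" "Fr (y, t+e) - Fr (y, t) = e * Frt (y, s)" by auto
  with y show thesis by (intro that[of "(y, s)"]) (auto simp: power2_eq_square)
qed

lemma mixed_partials_commute:
  assumes U: "open U" and F: "smooth_on U F" and p: "p \<in> U"
  shows "dt (dr F) p = dr (dt F) p"
proof (rule ccontr)
  assume "dt (dr F) p \<noteq> dr (dt F) p"
  define d where "d = dt (dr F) p - dr (dt F) p"
  have d: "d \<noteq> 0" using \<open>dt (dr F) p \<noteq> dr (dt F) p\<close> by (simp add: d_def)
  obtain x t where xt: "p = (x, t)" by (cases p)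
  have sm: "smooth_on U (dt (dr F))" "smooth_on U (dr (dt F))"
    using U F smooth_on_dr smooth_on_dt by blast+
  have c: "isCont (dt (dr F)) p" "isCont (dr (dt F)) p"
    using smooth_on_continuous[OF U] sm U p continuous_on_eq_continuous_at by blast+
  obtain e1 where e1: "e1 > 0" "\<And>q. dist q p < e1 \<Longrightarrow> dist (dt (dr F) q) (dt (dr F) p) < \<bar>d\<bar>/2"
    using c(1) d unfolding continuous_at_eps_delta by (metis half_gt_zero zero_less_abs_iff)
  obtain e2 where e2: "e2 > 0" "\<And>q. dist q p < e2 \<Longrightarrow> dist (dr (dt F) q) (dr (dt F) p) < \<bar>d\<bar>/2"
    using c(2) d unfolding continuous_at_eps_delta by (metis half_gt_zero zero_less_abs_iff)
  obtain e3 where e3: "e3 > 0" "ball p e3 \<subseteq> U" using U p open_contains_ball by blast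
  \<comment> \<open>Points of the square with side \<open>e\<close> lie within \<open>2 e\<close> of
    its corner \<open>p\<close>; dividing by 3 leaves room for a strict bound.\<close>
  define e where "e = min e1 (min e2 e3) / 3"
  have e: "e > 0" using e1 e2 e3 by (simp add: e_def)
  have close: "dist q p < min e1 (min e2 e3)" if q: "q \<in> {x..x+e} \<times> {t..t+e}" for q
  proof -
    have "dist q p \<le> dist (fst q) x + dist (snd q) t"
      using sqrt_sum_squares_le_sum_abs[of "dist (fst q) x" "dist (snd q) t"]
      by (cases q) (simp add: xt dist_Pair_Pair)
    also have "\<dots> \<le> e + e" using q by (cases q) (auto simp: dist_real_def)
    also have "\<dots> < min e1 (min e2 e3)" using e unfolding e_def by linarith
    finally show ?thesis .
  qed
  have sub: "{x..x+e} \<times> {t..t+e} \<subseteq> U" using close e3 by (force simp: dist_commute)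
  \<comment> \<open>The opposite order of differentiation comes from the same lemma applied to
    \<open>F \<circ> prod.swap\<close> on the reflected domain.\<close>
  have sw: "prod.swap ` U \<supseteq> {t..t+e} \<times> {x..x+e}" using sub by force
  obtain q1 where q1: "q1 \<in> {x..x+e} \<times> {t..t+e}"
    "F (x+e, t+e) - F (x+e, t) - F (x, t+e) + F (x, t) = e^2 * dt (dr F) q1"
    using mixed_difference_quotient[OF e sub, of F "dr F" "dt (dr F)"]
      smooth_on_DERIV_dr[OF U F] smooth_on_DERIV_dt[OF U smooth_on_dr[OF U F]] by metis
  obtain q2 where q2: "q2 \<in> {t..t+e} \<times> {x..x+e}"
    "F (x+e, t+e) - F (x, t+e) - F (x+e, t) + F (x, t) = e^2 * dr (dt F) (prod.swap q2)"
    using mixed_difference_quotient[OF e sw, of "F \<circ> prod.swap" "dt F \<circ> prod.swap" "dr (dt F) \<circ> prod.swap"]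
      smooth_on_DERIV_dt[OF U F] smooth_on_DERIV_dr[OF U smooth_on_dt[OF U F]]
    by (auto simp: o_def)
  have "e^2 * dt (dr F) q1 = e^2 * dr (dt F) (prod.swap q2)" using q1(2) q2(2) by linarith
  then have "dt (dr F) q1 = dr (dt F) (prod.swap q2)" using e by simp
  moreover have "dist (dt (dr F) q1) (dt (dr F) p) < \<bar>d\<bar>/2" using e1 close[OF q1(1)] by simp
  moreover have "dist (dr (dt F) (prod.swap q2)) (dr (dt F) p) < \<bar>d\<bar>/2"
    using e2 close[of "prod.swap q2"] q2 by force
  ultimately show False unfolding d_def dist_real_def by (smt (verit) field_sum_of_halves)
qed

section \<open>Division by \<open>r\<close> across the core\<close>

definition radially_closed :: "(real \<times> real) set \<Rightarrow> bool" where
  "radially_closed U \<longleftrightarrow> (\<forall>x t. \<forall>\<theta>\<in>{0..1}. (x, t) \<in> U \<longrightarrow> (\<theta> * x, t) \<in> U)"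

lemma radially_closedD:
  "radially_closed U \<Longrightarrow> p \<in> U \<Longrightarrow> \<theta> \<in> {0..1} \<Longrightarrow> (\<theta> * fst p, snd p) \<in> U"
  by (cases p) (simp add: radially_closed_def)

lemma continuous_on_radial:
  assumes rad: "radially_closed U" and F: "continuous_on U F" and V: "V \<subseteq> U"
  shows "continuous_on (V \<times> {0..1}) (\<lambda>(p, \<theta>). \<theta> ^ n * F (\<theta> * fst p, snd p))"
proof -
  have "continuous_on (V \<times> {0..1}) (\<lambda>z. F (snd z * fst (fst z), snd (fst z)))"
  proof (rule continuous_on_compose2[OF F])
    show "(\<lambda>z. (snd z * fst (fst z), snd (fst z))) ` (V \<times> {0..1}) \<subseteq> U"
      using V radially_closedD[OF rad] by auto
  qed (intro continuous_intros)
  then show ?thesis unfolding split_beta by (intro continuous_on_mult continuous_intros)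
qed

text \<open>Each \<open>r\<close>-derivative under the integral brings out a factor \<theta>. The
  weight \<open>\<theta> ^ n\<close> with arbitrary \<open>n\<close> is what makes the induction on
  \<open>k\<close> close.\<close>

lemma Ck_on_radial_average:
  assumes U: "open U" and rad: "radially_closed U"
  shows "Ck_on k U F \<Longrightarrow> Ck_on k U (\<lambda>p. integral {0..1} (\<lambda>\<theta>. \<theta> ^ n * F (\<theta> * fst p, snd p)))"
proof (induction k arbitrary: F n)
  case 0
  from continuous_on_radial[OF rad _ order_refl, of F n]
  have "continuous_on (U \<times> cbox 0 1) (\<lambda>(p, \<theta>). \<theta> ^ n * F (\<theta> * fst p, snd p))"
    using 0 by simp
  then show ?case
    using integral_continuous_on_param[of U 0 "1::real"] by simp
next
  case (Suc k)
  obtain A B where D: "\<forall>p\<in>U. (F has_derivative (\<lambda>v. A p * fst v + B p * snd v)) (at p)"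
    and AB: "Ck_on k U A" "Ck_on k U B"
    using Ck_on_SucE[OF Suc.prems] .
  define I where "I = (\<lambda>n F (p :: real \<times> real). integral {0..1} (\<lambda>\<theta>::real. \<theta> ^ n * F (\<theta> * fst p, snd p) :: real))"
  have cont: "continuous_on (V \<times> cbox 0 1) (\<lambda>(p, \<theta>). \<theta> ^ m * G (\<theta> * fst p, snd p))"
    if "Ck_on l U G" "V \<subseteq> U" for G V m l
    using continuous_on_radial[OF rad Ck_on_continuous[OF that(1)] that(2), of m] by simp
  have int: "(\<lambda>\<theta>. \<theta> ^ m * G (\<theta> * fst p, snd p)) integrable_on {0..1}"
    if "Ck_on l U G" "p \<in> U" for G p m l
  proof -
    have "continuous_on {0..1} (\<lambda>\<theta>. case (p, \<theta>) of (p, \<theta>) \<Rightarrow> \<theta> ^ m * G (\<theta> * fst p, snd p))"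
      by (rule continuous_on_compose2[OF cont[OF that(1), of "{p}"]])
         (use that(2) in \<open>auto intro: continuous_intros\<close>)
    then have "continuous_on {0..1} (\<lambda>\<theta>. \<theta> ^ m * G (\<theta> * fst p, snd p))" by simp
    then show ?thesis by (rule integrable_continuous_interval)
  qed
  have "(I n F has_derivative (\<lambda>v. I (Suc n) A p * fst v + I n B p * snd v)) (at p)"
    if p: "p \<in> U" for p
  proof -
    obtain e where e: "e > 0" "ball p e \<subseteq> U" using U p open_contains_ball by blast
    \<comment> \<open>\<open>leibniz_rule\<close> wants the derivative as a bounded linear map that
      depends continuously on the parameters, so the two partials are packed into one
      functional.\<close>
    define L where "L = (\<lambda>a b. a *\<^sub>R fst_blinfun + b *\<^sub>R snd_blinfun :: (real \<times> real) \<Rightarrow>\<^sub>L real)"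
    have L: "blinfun_apply (L a b) = (\<lambda>v. a * fst v + b * snd v)" for a b
      by (auto simp: L_def blinfun.add_left blinfun.scaleR_left fun_eq_iff)
    define M where "M = (\<lambda>q \<theta>. L (\<theta> ^ Suc n * A (\<theta> * fst q, snd q)) (\<theta> ^ n * B (\<theta> * fst q, snd q)))"
    have "((\<lambda>q. integral (cbox 0 1) (\<lambda>\<theta>::real. \<theta> ^ n * F (\<theta> * fst q, snd q)))
       has_derivative blinfun_apply (integral (cbox 0 1) (M p))) (at p within ball p e)"
    proof (rule leibniz_rule)
      show "convex (ball p e)" "p \<in> ball p e" using e by auto
      show "(\<lambda>\<theta>::real. \<theta> ^ n * F (\<theta> * fst q, snd q)) integrable_on cbox 0 1" if "q \<in> ball p e" for q
        using int[OF Suc.prems, of q n] that e by auto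
      show "continuous_on (ball p e \<times> cbox 0 1) (\<lambda>(q, \<theta>). M q \<theta>)"
        using continuous_on_add[OF
            continuous_on_scaleR[OF cont[OF AB(1) e(2), of "Suc n"] continuous_on_const[of _ fst_blinfun]]
            continuous_on_scaleR[OF cont[OF AB(2) e(2), of n] continuous_on_const[of _ snd_blinfun]]]
        by (simp only: M_def L_def case_prod_beta' split_beta)
      show "((\<lambda>q. \<theta> ^ n * F (\<theta> * fst q, snd q)) has_derivative blinfun_apply (M q \<theta>)) (at q within ball p e)"
        if q: "q \<in> ball p e" "\<theta> \<in> cbox 0 1" for q \<theta>
      proof -
        let ?s = "\<lambda>q. (\<theta> * fst q, snd q)"
        have "?s q \<in> U" using q e(2) radially_closedD[OF rad, of q \<theta>] by auto
        from D[rule_format, OF this] have "((\<lambda>q. F (?s q)) has_derivative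
            (\<lambda>v. A (?s q) * fst (?s v) + B (?s q) * snd (?s v))) (at q within ball p e)"
          by (rule has_derivative_compose[where f="?s", rotated])
             (auto intro!: derivative_eq_intros)
        then have "((\<lambda>q. \<theta> ^ n * F (?s q)) has_derivative
            (\<lambda>v. \<theta> ^ n * (A (?s q) * fst (?s v) + B (?s q) * snd (?s v)))) (at q within ball p e)"
          by (rule has_derivative_mult_right)
        then show ?thesis by (simp add: M_def L algebra_simps)
      qed
    qed
    moreover have "integral (cbox 0 1) (M p) = L (I (Suc n) A p) (I n B p)"
      unfolding M_def L_def I_def cbox_interval
      by (intro integral_unique has_integral_add has_integral_scaleR_left integrable_integral
          int[OF AB(1) p, of "Suc n"] int[OF AB(2) p, of n])
    ultimately show ?thesis
      using e at_within_open[of p "ball p e"] by (simp add: L I_def)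
  qed
  moreover have "Ck_on k U (I (Suc n) A)" "Ck_on k U (I n B)"
    using Suc.IH AB unfolding I_def by blast+
  ultimately have "Ck_on (Suc k) U (I n F)" by (rule Ck_on_SucI)
  then show ?case by (simp only: I_def)
qed

text \<open>Hadamard's quotient: \<open>(F (r, t) - F (0, t)) / r\<close> off the core and its limit
  \<open>dr F (0, t)\<close> on it, in a form that is visibly smooth.\<close>

definition radial_quotient :: "(real \<times> real \<Rightarrow> real) \<Rightarrow> real \<times> real \<Rightarrow> real" where
  "radial_quotient F p = integral {0..1} (\<lambda>\<theta>. dr F (\<theta> * fst p, snd p))"

lemma smooth_on_radial_quotient:
  assumes "open U" "radially_closed U" "smooth_on U F"
  shows "smooth_on U (radial_quotient F)"
  using Ck_on_radial_average[OF assms(1,2), of _ "dr F" 0] smooth_on_dr[OF assms(1,3)]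
  by (simp add: smooth_on_def radial_quotient_def[abs_def])

lemma radial_quotient_mult:
  assumes "open U" "radially_closed U" "smooth_on U F" "(x, t) \<in> U"
  shows "x * radial_quotient F (x, t) = F (x, t) - F (0, t)"
proof -
  have "((\<lambda>\<theta>. x * dr F (\<theta> * x, t)) has_integral F (1 * x, t) - F (0 * x, t)) {0..1}"
  proof (intro fundamental_theorem_of_calculus)
    fix \<theta> :: real assume "\<theta> \<in> {0..1}"
    then have "(\<theta> * x, t) \<in> U" using radially_closedD[OF assms(2,4)] by simp
    from smooth_on_DERIV_dr[OF assms(1,3) this]
    have "((\<lambda>\<theta>. F (\<theta> * x, t)) has_real_derivative dr F (\<theta> * x, t) * x) (at \<theta> within {0..1})"
      by (rule DERIV_chain2[where g="\<lambda>\<theta>. \<theta> * x"]) (auto intro!: derivative_eq_intros)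
    then show "((\<lambda>\<theta>. F (\<theta> * x, t)) has_vector_derivative x * dr F (\<theta> * x, t)) (at \<theta> within {0..1})"
      by (simp add: has_real_derivative_iff_has_vector_derivative mult.commute)
  qed auto
  then show ?thesis by (simp add: radial_quotient_def integral_unique flip: integral_mult_right)
qed

lemma radial_quotient_core: "radial_quotient F (0, t) = dr F (0, t)"
  by (simp add: radial_quotient_def)

lemma radial_quotient_even:
  assumes "\<And>\<theta>. \<theta> \<in> {0..1} \<Longrightarrow> dr F (- \<theta> * x, t) = dr F (\<theta> * x, t)"
  shows "radial_quotient F (- x, t) = radial_quotient F (x, t)"
  unfolding radial_quotient_def by (rule integral_cong) (use assms in auto)

text \<open>The set is the largest radially closed subset of \<open>U\<close>. Its openness is the
  tube lemma for the compact interval of scaling factors \<theta>.\<close>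

lemma open_radial_core:
  assumes "open U"
  shows "open {p. \<forall>\<theta>\<in>{0..1}. (\<theta> * fst p, snd p) \<in> (U :: (real \<times> real) set)}" (is "open ?S")
proof (subst open_subopen, intro ballI)
  fix p assume p: "p \<in> ?S"
  define W where "W = {q :: (real \<times> real) \<times> real. (snd q * fst (fst q), snd (fst q)) \<in> U}"
  have "open W" unfolding W_def
    by (intro open_vimage[OF assms, unfolded vimage_def] continuous_intros)
  moreover have "{p} \<times> {0..1} \<subseteq> W" using p by (auto simp: W_def)
  ultimately obtain X where "p \<in> X" "open X" "X \<times> {0..1} \<subseteq> W"
    using Elementary_Topology.tube_lemma[of "{0..1::real}" W p] by auto
  then show "\<exists>T. open T \<and> p \<in> T \<and> T \<subseteq> ?S" by (intro exI[of _ X]) (auto simp: W_def)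
qed

section \<open>Curvature of diagonal metrics\<close>

definition diag3 :: "(3 \<Rightarrow> real) \<Rightarrow> real^3^3" where
  "diag3 e = (\<chi> i j. if i = j then e i else 0)"

lemma diag3_nth [simp]: "diag3 e $ i $ j = (if i = j then e i else 0)"
  by (simp add: diag3_def)

lemma rot_metric_diag3:
  "rot_metric f g h t x
     = diag3 (\<lambda>i. if i = 1 then (f (x$3) t)\<^sup>2 else if i = 2 then (g (x$3) t)\<^sup>2 else (h (x$3) t)\<^sup>2)"
  unfolding rot_metric_def diag3_def vec_eq_iff forall_3 by simp

lemma matrix_inv_diag3:
  assumes "\<And>i. e i \<noteq> 0"
  shows "matrix_inv (diag3 e) = diag3 (\<lambda>i. 1 / e i)"
proof -
  let ?B = "diag3 (\<lambda>i. 1 / e i)" and ?A = "diag3 e"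
  have B: "?A ** ?B = mat 1" "?B ** ?A = mat 1"
    using assms by (auto simp: matrix_matrix_mult_def mat_def vec_eq_iff if_distrib[of "\<lambda>a. a * _"] cong: if_cong)
  then have "?A ** matrix_inv ?A = mat 1 \<and> matrix_inv ?A ** ?A = mat 1"
    unfolding matrix_inv_def by (rule someI[where x="?B", OF conjI])
  then have "matrix_inv ?A ** (?A ** ?B) = ?B"
    by (simp add: matrix_mul_assoc)
  then show ?thesis by (simp add: B)
qed

lemma det_diag3: "det (diag3 e) = e 1 * e 2 * e 3"
  by (simp add: det_3)

text \<open>Separates the contractions from the differentiation: \<open>e i\<close> are the diagonal
  metric components and \<open>K i j\<close> is the sectional curvature of the coordinate plane
  \<open>i, j\<close>.\<close>

locale diagonal_curvature =
  fixes G :: metric and x :: "real^3" and e :: "3 \<Rightarrow> real" and K :: "3 \<Rightarrow> 3 \<Rightarrow> real"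
  assumes G: "G x = diag3 e"
    and pos: "\<And>i. e i > 0"
    and Ksym: "\<And>i j. K i j = K j i"
    and riem_up: "\<And>l i j k. riem_up G l i j k x =
      (if i = j then 0 else if l = i \<and> k = j then K i j * e j
       else if l = j \<and> k = i then - K i j * e i else 0)"
begin

lemma nz: "e i \<noteq> 0" using pos[of i] by simp

lemma ginv: "ginv G x = diag3 (\<lambda>i. 1 / e i)"
  unfolding ginv_def G using nz by (rule matrix_inv_diag3)

lemma riem: "riem G i j k l x =
    (if i = j then 0 else if l = i \<and> k = j then K i j * e i * e j
     else if l = j \<and> k = i then - K i j * e i * e j else 0)"
proof -
  have "riem G i j k l x = e l * riem_up G l i j k x"
    by (simp add: riem_def G if_distrib[of "\<lambda>a. a * _"] cong: if_cong)
  then show ?thesis by (auto simp: riem_up)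
qed

lemma ricci: "ricci G j k x = (if j = k then (\<Sum>i\<in>UNIV - {j}. K i j) * e j else 0)"
proof (cases "j = k")
  case True
  have "ricci G j j x = (\<Sum>i\<in>UNIV - {j}. K i j * e j)"
    unfolding ricci_def by (subst sum.mono_neutral_cong_right[of UNIV "UNIV - {j}"]) (auto simp: riem_up)
  then show ?thesis using True by (simp add: sum_distrib_right)
qed (auto simp: ricci_def riem_up intro!: sum.neutral)

lemma scalar_curv: "scalar_curv G x = 2 * (K 1 2 + K 1 3 + K 2 3)"
proof -
  have "scalar_curv G x = (\<Sum>j\<in>UNIV. \<Sum>i\<in>UNIV - {j}. K i j)"
    using nz by (simp add: scalar_curv_def ginv ricci if_distrib[of "\<lambda>a. a * _"] cong: if_cong)
  also have "\<dots> = (\<Sum>j\<in>UNIV. \<Sum>i\<in>UNIV. if i = j then 0 else K i j)"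
    by (intro sum.cong refl sum.mono_neutral_cong_left) auto
  finally show ?thesis
    using Ksym[of 2 1] Ksym[of 3 1] Ksym[of 3 2] by (simp add: sum_3)
qed

text \<open>Eigenvalues of the Einstein tensor: in each direction, minus the sectional curvature of
  the complementary coordinate plane.\<close>

definition P :: "3 \<Rightarrow> real" where
  "P i = (if i = 1 then - K 2 3 else if i = 2 then - K 1 3 else - K 1 2)"

lemma einstein: "einstein G x = diag3 (\<lambda>i. P i * e i)"
proof -
  have sum: "(\<Sum>i\<in>UNIV - {j}. K i j) = (\<Sum>i\<in>UNIV. if i = j then 0 else K i j)" for j
    by (intro sum.mono_neutral_cong_left) auto
  have *: "(\<Sum>i\<in>UNIV - {j}. K i j) - (K 1 2 + K 1 3 + K 2 3) = P j" for j
    unfolding sum using exhaust_3[of j] Ksym[of 2 1] Ksym[of 3 1] Ksym[of 3 2]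
    by (auto simp: P_def sum_3)
  then have "(\<Sum>i\<in>UNIV - {j}. K i j) * e j - 1 / 2 * (2 * (K 1 2 + K 1 3 + K 2 3)) * e j = P j * e j" for j
  proof -
    have "(\<Sum>i\<in>UNIV - {j}. K i j) * e j - 1 / 2 * (2 * (K 1 2 + K 1 3 + K 2 3)) * e j
        = ((\<Sum>i\<in>UNIV - {j}. K i j) - (K 1 2 + K 1 3 + K 2 3)) * e j"
      by (simp add: left_diff_distrib)
    also have "\<dots> = P j * e j" by (simp only: *)
    finally show ?thesis .
  qed
  then show ?thesis
    unfolding einstein_def ricci scalar_curv G vec_eq_iff by (simp del: mult_cancel_right)
qed

lemma einstein_up: "einstein_up G x = diag3 (\<lambda>i. P i / e i)"
  using nz by (auto simp: einstein_up_def einstein ginv vec_eq_iff if_distrib[of "\<lambda>a. a * _"]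
      if_distrib[of "\<lambda>a. _ * a"] cong: if_cong)

lemma einstein_trace: "einstein_trace G x = - (K 1 2 + K 1 3 + K 2 3)"
proof -
  have "einstein_trace G x = (\<Sum>i\<in>UNIV. P i)"
    using nz by (simp add: einstein_trace_def einstein_up G if_distrib[of "\<lambda>a. a * _"] cong: if_cong)
  then show ?thesis by (simp add: sum_3 P_def)
qed

lemma einstein_det: "einstein_det G x = - (K 1 2 * K 1 3 * K 2 3)"
proof -
  have "ginv G x ** einstein G x = diag3 P"
    using nz by (auto simp: ginv einstein matrix_matrix_mult_def vec_eq_iff
        if_distrib[of "\<lambda>a. a * _"] cong: if_cong)
  then show ?thesis by (simp add: einstein_det_def det_diag3 P_def)
qed

lemma cross_curv:
  "cross_curv G x $ 1 $ 1 = - (K 1 2 * K 1 3) * e 1"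
  "cross_curv G x $ 2 $ 2 = - (K 1 2 * K 2 3) * e 2"
  "cross_curv G x $ 3 $ 3 = - (K 1 3 * K 2 3) * e 3"
  using nz[of 1] nz[of 2] nz[of 3] Ksym[of 2 1] Ksym[of 3 1] Ksym[of 3 2]
  by (simp_all add: cross_curv_def einstein_up riem sum_3 P_def)

lemma sec_curv_axis:
  assumes "i \<noteq> j"
  shows "sec_curv G x (axis i 1) (axis j 1) = K i j"
proof -
  have "(\<Sum>p\<in>UNIV. \<Sum>q\<in>UNIV. \<Sum>r\<in>UNIV. \<Sum>s\<in>UNIV.
      riem G p q r s x * axis i 1 $ p * axis j 1 $ q * axis j 1 $ r * axis i 1 $ s) = riem G i j j i x"
    by (simp add: axis_def if_distrib[of "\<lambda>a. _ * a"] cong: if_cong)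
  moreover have "axis k 1 \<bullet> (G x *v axis l 1) = (if k = l then e k else 0)" for k l
    by (simp add: G inner_axis' matrix_vector_mult_basis column_def)
  ultimately show ?thesis
    using assms nz by (simp add: sec_curv_def riem)
qed

end

section \<open>Curvature of a rotationally symmetric metric\<close>

lemma pd_radial:
  assumes "\<And>y. y$3 \<in> S \<Longrightarrow> F y = \<phi> (y$3)" "open S" "x$3 \<in> S"
  shows "pd i F x = (if i = 3 then deriv \<phi> (x$3) else 0)"
proof -
  have "\<forall>\<^sub>F z in nhds (0::real). x$3 + z * (axis i 1)$3 \<in> S"
    by (rule eventually_compose_filterlim[OF eventually_nhds_in_open[OF assms(2,3)]])
       (auto intro!: tendsto_eq_intros filterlim_ident)
  then have "\<forall>\<^sub>F z in nhds (0::real). F (x + z *\<^sub>R axis i 1) = \<phi> (x$3 + z * (axis i 1)$3)"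
    by eventually_elim (simp add: assms(1))
  then have "pd i F x = deriv (\<lambda>z. \<phi> (x$3 + z * (axis i 1)$3)) 0"
    unfolding pd_def by (rule deriv_cong_ev) simp
  also have "\<dots> = (if i = 3 then deriv \<phi> (x$3) else 0)"
    using deriv_shift_0[of \<phi> "x$3"] by (simp add: axis_def o_def)
  finally show ?thesis .
qed

locale radial_jet =
  fixes f g h :: "real \<Rightarrow> real \<Rightarrow> real" and t :: real and S :: "real set"
    and f1 g1 h1 :: "real \<Rightarrow> real" and r f2 g2 :: real
  assumes S: "open S" "r \<in> S"
    and nonzero: "\<And>\<rho>. \<rho> \<in> S \<Longrightarrow> f \<rho> t \<noteq> 0 \<and> g \<rho> t \<noteq> 0 \<and> h \<rho> t \<noteq> 0"
    and f1: "\<And>\<rho>. \<rho> \<in> S \<Longrightarrow> ((\<lambda>\<rho>. f \<rho> t) has_real_derivative f1 \<rho>) (at \<rho>)"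
    and g1: "\<And>\<rho>. \<rho> \<in> S \<Longrightarrow> ((\<lambda>\<rho>. g \<rho> t) has_real_derivative g1 \<rho>) (at \<rho>)"
    and h1: "\<And>\<rho>. \<rho> \<in> S \<Longrightarrow> ((\<lambda>\<rho>. h \<rho> t) has_real_derivative h1 \<rho>) (at \<rho>)"
    and f2: "(f1 has_real_derivative f2) (at r)"
    and g2: "(g1 has_real_derivative g2) (at r)"
begin

definition "e \<rho> i = (if i = (1::3) then (f \<rho> t)\<^sup>2 else if i = 2 then (g \<rho> t)\<^sup>2 else (h \<rho> t)\<^sup>2)"
definition "e1 \<rho> i = (if i = (1::3) then 2 * f \<rho> t * f1 \<rho> else if i = 2 then 2 * g \<rho> t * g1 \<rho> else 2 * h \<rho> t * h1 \<rho>)"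

definition Chr :: "3 \<Rightarrow> 3 \<Rightarrow> 3 \<Rightarrow> real \<Rightarrow> real" where
  "Chr k i j \<rho> =
     (if k = 1 then (if i = 1 \<and> j = 3 \<or> i = 3 \<and> j = 1 then f1 \<rho> / f \<rho> t else 0)
      else if k = 2 then (if i = 2 \<and> j = 3 \<or> i = 3 \<and> j = 2 then g1 \<rho> / g \<rho> t else 0)
      else if i = 1 \<and> j = 1 then - f \<rho> t * f1 \<rho> / (h \<rho> t)\<^sup>2
      else if i = 2 \<and> j = 2 then - g \<rho> t * g1 \<rho> / (h \<rho> t)\<^sup>2
      else if i = 3 \<and> j = 3 then h1 \<rho> / h \<rho> t else 0)"

lemma metric: "rot_metric f g h t x = diag3 (e (x$3))"
  by (simp add: rot_metric_diag3 e_def[abs_def])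

lemma christoffel:
  assumes "y$3 \<in> S"
  shows "christoffel (rot_metric f g h t) k i j y = Chr k i j (y$3)"
proof -
  have nz: "e (y$3) i \<noteq> 0" for i using nonzero[OF assms] by (simp add: e_def)
  have e1: "((\<lambda>\<rho>. e \<rho> i) has_real_derivative e1 (y$3) i) (at (y$3))" for i
    using f1[OF assms] g1[OF assms] h1[OF assms]
    by (auto simp: e_def e1_def intro!: derivative_eq_intros)
  have pd: "pd l (\<lambda>y. rot_metric f g h t y $ i $ j) y
      = (if l = 3 \<and> i = j then e1 (y$3) i else 0)" for l i j
  proof (cases "i = j")
    case True
    show ?thesis
      using pd_radial[OF _ S(1) assms, of "\<lambda>y. rot_metric f g h t y $ i $ j" "\<lambda>\<rho>. e \<rho> i"]
        DERIV_imp_deriv[OF e1] True by (simp add: metric)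
  next
    case False
    then show ?thesis
      using pd_radial[OF _ S(1) assms, of "\<lambda>y. rot_metric f g h t y $ i $ j" "\<lambda>\<rho>. 0"]
      by (simp add: metric)
  qed
  have "christoffel (rot_metric f g h t) k i j y = 1 / 2 * (1 / e (y$3) k *
     ((if i = 3 \<and> j = k then e1 (y$3) j else 0) + (if j = 3 \<and> i = k then e1 (y$3) i else 0)
       - (if k = 3 \<and> i = j then e1 (y$3) i else 0)))"
    unfolding christoffel_def ginv_def metric matrix_inv_diag3[OF nz] pd[unfolded metric]
    by (simp add: if_distrib[of "\<lambda>a. a * _"] cong: if_cong)
  then show ?thesis
    using exhaust_3[of k] exhaust_3[of i] exhaust_3[of j] nonzero[OF assms]
    by (elim disjE; simp add: Chr_def e_def e1_def power2_eq_square)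
qed

definition "alpha = f1 r * g1 r / (f r t * g r t * (h r t)\<^sup>2)"
definition "beta = (g2 / h r t - g1 r * h1 r / (h r t)\<^sup>2) / (h r t * g r t)"
definition "gamma = (f2 / h r t - f1 r * h1 r / (h r t)\<^sup>2) / (h r t * f r t)"

definition "K i j = (if i \<noteq> (3::3) \<and> j \<noteq> (3::3) then - alpha
  else if i = 1 \<or> j = 1 then - gamma else - beta)"

lemma riem_up:
  assumes x: "x$3 = r"
  shows "riem_up (rot_metric f g h t) l i j k x =
      (if i = j then 0 else if l = i \<and> k = j then K i j * e r j
       else if l = j \<and> k = i then - K i j * e r i else 0)"
proof -
  note nz = nonzero[OF S(2)] note fgh = f1[OF S(2)] g1[OF S(2)] h1[OF S(2)]
  define DChr where "DChr k i j =
     (if k = (1::3) then (if i = 1 \<and> j = 3 \<or> i = 3 \<and> j = 1 then f2 / f r t - (f1 r)\<^sup>2 / (f r t)\<^sup>2 else 0)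
      else if k = 2 then (if i = 2 \<and> j = 3 \<or> i = 3 \<and> j = 2 then g2 / g r t - (g1 r)\<^sup>2 / (g r t)\<^sup>2 else 0)
      else if i = (1::3) \<and> j = (1::3)
        then - (f1 r)\<^sup>2 / (h r t)\<^sup>2 - f r t * f2 / (h r t)\<^sup>2 + 2 * f r t * f1 r * h1 r / (h r t)^3
      else if i = 2 \<and> j = 2
        then - (g1 r)\<^sup>2 / (h r t)\<^sup>2 - g r t * g2 / (h r t)\<^sup>2 + 2 * g r t * g1 r * h1 r / (h r t)^3
      else 0)" for k i j
  \<comment> \<open>The excluded symbol is the only one whose derivative would involve
    \<open>h_rr\<close>. It occurs only in components with \<open>i = j = 3\<close>, where the two
    derivative terms cancel.\<close>
  have D: "deriv (Chr k i j) r = DChr k i j" if "\<not> (k = 3 \<and> i = 3 \<and> j = 3)" for k i j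
  proof -
    have 1: "deriv (\<lambda>\<rho>. f1 \<rho> / f \<rho> t) r = f2 / f r t - (f1 r)\<^sup>2 / (f r t)\<^sup>2"
      by (rule DERIV_imp_deriv, (rule derivative_eq_intros fgh f2 refl | simp add: nz)+,
          simp add: nz field_simps power2_eq_square)
    have 2: "deriv (\<lambda>\<rho>. g1 \<rho> / g \<rho> t) r = g2 / g r t - (g1 r)\<^sup>2 / (g r t)\<^sup>2"
      by (rule DERIV_imp_deriv, (rule derivative_eq_intros fgh g2 refl | simp add: nz)+,
          simp add: nz field_simps power2_eq_square)
    have 3: "deriv (\<lambda>\<rho>. - f \<rho> t * f1 \<rho> / (h \<rho> t)\<^sup>2) r =
        - (f1 r)\<^sup>2 / (h r t)\<^sup>2 - f r t * f2 / (h r t)\<^sup>2 + 2 * f r t * f1 r * h1 r / (h r t)^3"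
      by (rule DERIV_imp_deriv, (rule derivative_eq_intros fgh f2 refl | simp add: nz)+,
          simp add: nz field_simps power2_eq_square power3_eq_cube power4_eq_xxxx)
    have 4: "deriv (\<lambda>\<rho>. - g \<rho> t * g1 \<rho> / (h \<rho> t)\<^sup>2) r =
        - (g1 r)\<^sup>2 / (h r t)\<^sup>2 - g r t * g2 / (h r t)\<^sup>2 + 2 * g r t * g1 r * h1 r / (h r t)^3"
      by (rule DERIV_imp_deriv, (rule derivative_eq_intros fgh g2 refl | simp add: nz)+,
          simp add: nz field_simps power2_eq_square power3_eq_cube power4_eq_xxxx)
    have C: "Chr k i j =
     (if k = 1 then (if i = 1 \<and> j = 3 \<or> i = 3 \<and> j = 1 then (\<lambda>\<rho>. f1 \<rho> / f \<rho> t) else (\<lambda>_. 0))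
      else if k = 2 then (if i = 2 \<and> j = 3 \<or> i = 3 \<and> j = 2 then (\<lambda>\<rho>. g1 \<rho> / g \<rho> t) else (\<lambda>_. 0))
      else if i = 1 \<and> j = 1 then (\<lambda>\<rho>. - f \<rho> t * f1 \<rho> / (h \<rho> t)\<^sup>2)
      else if i = 2 \<and> j = 2 then (\<lambda>\<rho>. - g \<rho> t * g1 \<rho> / (h \<rho> t)\<^sup>2) else (\<lambda>_. 0))"
      using that exhaust_3[of k] exhaust_3[of i] exhaust_3[of j] by (auto simp: Chr_def fun_eq_iff)
    show ?thesis unfolding C DChr_def by (simp only: if_distrib[of "\<lambda>\<phi>. deriv \<phi> r"] 1 2 3 4 deriv_const)
  qed
  have pd: "pd i (christoffel (rot_metric f g h t) l j k) x = (if i = 3 then deriv (Chr l j k) r else 0)"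
    for i l j k
    using pd_radial[of S "christoffel (rot_metric f g h t) l j k" "Chr l j k" x i] christoffel S x by simp
  have chr: "christoffel (rot_metric f g h t) l j k x = Chr l j k r" for l j k
    using christoffel[of x] S x by simp
  show ?thesis
  proof (cases "i = j")
    case False
    then have "riem_up (rot_metric f g h t) l i j k x
        = (if i = 3 then DChr l j k else 0) - (if j = 3 then DChr l i k else 0)
          + (\<Sum>m\<in>UNIV. Chr l i m r * Chr m j k r - Chr l j m r * Chr m i k r)"
      unfolding riem_up_def pd chr by (auto simp: D)
    moreover have "\<dots> = (if l = i \<and> k = j then K i j * e r j
       else if l = j \<and> k = i then - K i j * e r i else 0)"
      using False exhaust_3[of l] exhaust_3[of i] exhaust_3[of j] exhaust_3[of k] nz
      by (elim disjE; simp add: sum_3 DChr_def Chr_def K_def e_def alpha_def beta_def gamma_def)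
         (simp_all add: field_simps power2_eq_square power3_eq_cube)
    ultimately show ?thesis using False by simp
  qed (simp add: riem_up_def pd)
qed

lemma curvature:
  assumes x: "x$3 = r"
  shows "diagonal_curvature (rot_metric f g h t) x (e r) K"
proof
  show "e r i > 0" for i using nonzero[OF S(2)] by (simp add: e_def)
  show "K i j = K j i" for i j by (auto simp: K_def)
qed (simp_all add: metric riem_up x)

end

section \<open>Evolution equations\<close>

text \<open>The source of the evolution equations: \<open>F_r\<close> and \<open>F_t\<close> are
  known in closed form, and equating their cross derivatives gives a new relation. Taking
  \<open>F = f\<close> yields \<open>a_t\<close>, and then \<open>F = a\<close> yields
  \<open>\<gamma>_t\<close>.\<close>

lemma mixed_partials_relation:
  assumes W: "open W" "smooth_on W F" "(x, t) \<in> W"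
    and r: "\<And>p. p \<in> W \<Longrightarrow> dr F p = Fr p" and t: "\<And>p. p \<in> W \<Longrightarrow> dt F p = Ft p"
    and X: "((\<lambda>t. Fr (x, t)) has_real_derivative X) (at t)"
    and Y: "((\<lambda>x. Ft (x, t)) has_real_derivative Y) (at x)"
  shows "X = Y"
proof -
  have *: "((\<lambda>t. dr F (x, t)) has_real_derivative dt (dr F) (x, t)) (at t)"
    "((\<lambda>x. dt F (x, t)) has_real_derivative dr (dt F) (x, t)) (at x)"
    using smooth_on_DERIV_dt[OF W(1) smooth_on_dr[OF W(1,2)] W(3)]
      smooth_on_DERIV_dr[OF W(1) smooth_on_dt[OF W(1,2)] W(3)] .
  have "open ((\<lambda>t. (x, t)) -` W)" "open ((\<lambda>x. (x, t)) -` W)"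
    by (intro open_vimage[OF W(1)] continuous_intros)+
  then have "((\<lambda>t. Fr (x, t)) has_real_derivative dt (dr F) (x, t)) (at t)"
    "((\<lambda>x. Ft (x, t)) has_real_derivative dr (dt F) (x, t)) (at x)"
    using has_field_derivative_transform_within_open[OF *(1), of "(\<lambda>t. (x, t)) -` W" "\<lambda>t. Fr (x, t)"]
      has_field_derivative_transform_within_open[OF *(2), of "(\<lambda>x. (x, t)) -` W" "\<lambda>x. Ft (x, t)"] r t W(3)
    by auto
  then show ?thesis
    using DERIV_unique X Y mixed_partials_commute[OF W] by metis
qed

text \<open>With \<open>c^3 = A B C\<close>, dividing by \<open>c\<close> leaves
  \<open>3 c^2 \<le> A B + B C + C A\<close>, the arithmetic-geometric mean inequality for three
  products whose own product is \<open>c^6\<close>. Cube roots reduce it to the factorization of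
  \<open>p^3 + q^3 + s^3 - 3 p q s\<close>.\<close>

lemma arith_geo_mean3_pairs:
  fixes A B C :: real
  assumes "A > 0" "B > 0" "C > 0"
  shows "A * B * C \<le> root 3 (A * B * C) * (A * B + B * C + C * A) / 3"
proof -
  define u v w where "u = root 3 A" "v = root 3 B" "w = root 3 C"
  have pos: "u > 0" "v > 0" "w > 0" using assms by (auto simp: u_v_w_def)
  have ABC: "A = u ^ 3" "B = v ^ 3" "C = w ^ 3" using assms by (auto simp: u_v_w_def)
  have c: "root 3 (A * B * C) = u * v * w" by (simp add: real_root_mult u_v_w_def)
  define p q s where "p = u * v" "q = v * w" "s = w * u"
  have pqs: "p > 0" "q > 0" "s > 0" using pos by (auto simp: p_q_s_def)
  have "p^3 + q^3 + s^3 - 3 * p * q * s = (p + q + s) * ((p - q)^2 + (q - s)^2 + (s - p)^2) / 2"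
    by (simp add: field_simps power2_eq_square power3_eq_cube)
  also have "\<dots> \<ge> 0" using pqs by simp
  finally have "3 * p * q * s \<le> p^3 + q^3 + s^3" by simp
  then have "3 * (u * v * w)^2 \<le> A * B + B * C + C * A"
    by (simp add: p_q_s_def ABC power_mult_distrib power2_eq_square power3_eq_cube algebra_simps)
  then have "u * v * w * (3 * (u * v * w)^2) \<le> u * v * w * (A * B + B * C + C * A)"
    using pos by (intro mult_left_mono) auto
  then show ?thesis unfolding c by (simp add: ABC power_mult_distrib power2_eq_square power3_eq_cube algebra_simps)
qed

text \<open>\<open>a\<close> and \<open>b\<close> are the logarithmic arclength derivatives of \<open>f\<close> and \<open>g\<close>;
  \<open>A\<close>, \<open>B\<close>, \<open>C\<close> are the negatives of the sectional curvatures.\<close>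

locale cross_flow_region =
  fixes W :: "(real \<times> real) set" and f g h a b A B C :: "real \<times> real \<Rightarrow> real"
  assumes W: "open W"
    and smooth: "smooth_on W f" "smooth_on W g" "smooth_on W h" "smooth_on W a" "smooth_on W b"
      "smooth_on W A" "smooth_on W B" "smooth_on W C"
    and pos: "\<And>p. p \<in> W \<Longrightarrow> f p > 0 \<and> g p > 0 \<and> h p > 0"
    and dr: "\<And>p. p \<in> W \<Longrightarrow> dr f p = a p * f p * h p" "\<And>p. p \<in> W \<Longrightarrow> dr g p = b p * g p * h p"
      "\<And>p. p \<in> W \<Longrightarrow> dr a p = h p * (C p - (a p)\<^sup>2)" "\<And>p. p \<in> W \<Longrightarrow> dr b p = h p * (B p - (b p)\<^sup>2)"
    and A: "\<And>p. p \<in> W \<Longrightarrow> A p = a p * b p"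
    and dt: "\<And>p. p \<in> W \<Longrightarrow> dt f p = A p * C p * f p" "\<And>p. p \<in> W \<Longrightarrow> dt g p = A p * B p * g p"
      "\<And>p. p \<in> W \<Longrightarrow> dt h p = B p * C p * h p"
begin

text \<open>The system is symmetric under exchanging the two torus directions, so every formula for
  \<open>a\<close> and \<open>C\<close> also gives the one for \<open>b\<close> and
  \<open>B\<close>.\<close>

lemma swap: "cross_flow_region W g f h b a A C B"
  by unfold_locales (use W smooth pos dr A dt in \<open>auto simp: mult.commute\<close>)

text \<open>The arclength derivatives \<open>\<beta>_s\<close> and, below,
  \<open>\<gamma>_s\<close>.\<close>

definition y where "y p = dr B p / h p"
definition z where "z p = dr C p / h p"

lemma h_nz: "p \<in> W \<Longrightarrow> h p \<noteq> 0"
  using pos[of p] by auto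

lemma smooth_yz: "smooth_on W y" "smooth_on W z"
  unfolding y_def[abs_def] z_def[abs_def]
  using smooth_on_divide[OF smooth_on_dr[OF W] smooth(3) h_nz] smooth by blast+

lemma dr_BC: "p \<in> W \<Longrightarrow> dr B p = h p * y p" "p \<in> W \<Longrightarrow> dr C p = h p * z p"
  using h_nz by (auto simp: y_def z_def)

lemma DERIV_W_eq:
  assumes "(x, t) \<in> W" "\<And>p. p \<in> W \<Longrightarrow> F p = G p"
  shows "((\<lambda>x. F (x, t)) has_real_derivative D) (at x) \<longleftrightarrow> ((\<lambda>x. G (x, t)) has_real_derivative D) (at x)"
    "((\<lambda>t. F (x, t)) has_real_derivative D) (at t) \<longleftrightarrow> ((\<lambda>t. G (x, t)) has_real_derivative D) (at t)"
proof -
  have o: "open ((\<lambda>t. (x, t)) -` W)" "open ((\<lambda>x. (x, t)) -` W)"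
    by (intro open_vimage[OF W] continuous_intros)+
  have "\<forall>\<^sub>F s in nhds x. (s, t) \<in> W" "\<forall>\<^sub>F s in nhds t. (x, s) \<in> W"
    using eventually_nhds_in_open[OF o(2), of x] eventually_nhds_in_open[OF o(1), of t] assms(1) by auto
  then have "\<forall>\<^sub>F s in nhds x. F (s, t) = G (s, t)" "\<forall>\<^sub>F s in nhds t. F (x, s) = G (x, s)"
    by (auto elim!: eventually_mono simp: assms(2))
  then show "((\<lambda>x. F (x, t)) has_real_derivative D) (at x) \<longleftrightarrow> ((\<lambda>x. G (x, t)) has_real_derivative D) (at x)"
    "((\<lambda>t. F (x, t)) has_real_derivative D) (at t) \<longleftrightarrow> ((\<lambda>t. G (x, t)) has_real_derivative D) (at t)"
    by (simp_all add: DERIV_cong_ev[OF refl _ refl])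
qed

context
  fixes x t assumes p: "(x, t) \<in> W"
begin

lemma DERIV_dr:
  "((\<lambda>x. f (x, t)) has_real_derivative a (x, t) * f (x, t) * h (x, t)) (at x)"
  "((\<lambda>x. g (x, t)) has_real_derivative b (x, t) * g (x, t) * h (x, t)) (at x)"
  "((\<lambda>x. h (x, t)) has_real_derivative dr h (x, t)) (at x)"
  "((\<lambda>x. a (x, t)) has_real_derivative h (x, t) * (C (x, t) - (a (x, t))\<^sup>2)) (at x)"
  "((\<lambda>x. b (x, t)) has_real_derivative h (x, t) * (B (x, t) - (b (x, t))\<^sup>2)) (at x)"
  "((\<lambda>x. B (x, t)) has_real_derivative h (x, t) * y (x, t)) (at x)"
  "((\<lambda>x. C (x, t)) has_real_derivative h (x, t) * z (x, t)) (at x)"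
  "((\<lambda>x. y (x, t)) has_real_derivative dr y (x, t)) (at x)"
  "((\<lambda>x. z (x, t)) has_real_derivative dr z (x, t)) (at x)"
  using smooth_on_DERIV_dr[OF W _ p] smooth smooth_yz dr[OF p] dr_BC[OF p] by metis+

lemma DERIV_dt:
  "((\<lambda>t. f (x, t)) has_real_derivative A (x, t) * C (x, t) * f (x, t)) (at t)"
  "((\<lambda>t. g (x, t)) has_real_derivative A (x, t) * B (x, t) * g (x, t)) (at t)"
  "((\<lambda>t. h (x, t)) has_real_derivative B (x, t) * C (x, t) * h (x, t)) (at t)"
  "((\<lambda>t. a (x, t)) has_real_derivative dt a (x, t)) (at t)"
  "((\<lambda>t. b (x, t)) has_real_derivative dt b (x, t)) (at t)"
  "((\<lambda>t. A (x, t)) has_real_derivative dt A (x, t)) (at t)"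
  "((\<lambda>t. B (x, t)) has_real_derivative dt B (x, t)) (at t)"
  "((\<lambda>t. C (x, t)) has_real_derivative dt C (x, t)) (at t)"
  using smooth_on_DERIV_dt[OF W _ p] smooth dt[OF p] by metis+

lemma DERIV_dr_A:
  "((\<lambda>x. A (x, t)) has_real_derivative h (x, t) * (b (x, t) * (C (x, t) - A (x, t)) + a (x, t) * (B (x, t) - A (x, t)))) (at x)"
  by (subst DERIV_W_eq(1)[where F=A and G="\<lambda>p. a p * b p", OF p A])
     (assumption, (rule derivative_eq_intros DERIV_dr refl)+, simp add: A[OF p] algebra_simps power2_eq_square)

text \<open>This is \<open>a_t = (\<alpha> \<gamma>)_s - \<beta> \<gamma> a\<close>. The last term
  is the commutator of the time derivative with the arclength derivative, as
  \<open>h_t = \<beta> \<gamma> h\<close>.\<close>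

lemma dt_a: "dt a (x, t) = A (x, t) * z (x, t) + b (x, t) * (C (x, t))\<^sup>2 - (a (x, t) + b (x, t)) * A (x, t) * C (x, t)"
proof -
  let ?f = "f (x, t)" and ?h = "h (x, t)" and ?a = "a (x, t)" and ?b = "b (x, t)" and ?A = "A (x, t)"
    and ?B = "B (x, t)" and ?C = "C (x, t)" and ?z = "z (x, t)"
  have "(dt a (x, t) * ?f + ?a * (?A * ?C * ?f)) * ?h + ?a * ?f * (?B * ?C * ?h)
      = (?h * (?b * (?C - ?A) + ?a * (?B - ?A)) * ?C + ?A * (?h * ?z)) * ?f + ?A * ?C * (?a * ?f * ?h)"
    by (rule mixed_partials_relation[OF W smooth(1) p dr(1) dt(1)])
       (rule derivative_eq_intros DERIV_dr DERIV_dt DERIV_dr_A refl | assumption | simp add: algebra_simps)+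
  then have "?f * ?h * (dt a (x, t) + ?a * ?B * ?C) = ?f * ?h * ((?b * (?C - ?A) + ?a * (?B - ?A)) * ?C + ?A * ?z)"
    by (simp add: algebra_simps)
  moreover have "?f * ?h \<noteq> 0" using pos[OF p] by simp
  ultimately have "dt a (x, t) + ?a * ?B * ?C = (?b * (?C - ?A) + ?a * (?B - ?A)) * ?C + ?A * ?z"
    using mult_left_cancel by blast
  then show ?thesis by (simp add: algebra_simps power2_eq_square)
qed

end

lemma dt_b: "(x, t) \<in> W \<Longrightarrow> dt b (x, t) = A (x, t) * y (x, t) + a (x, t) * (B (x, t))\<^sup>2 - (a (x, t) + b (x, t)) * A (x, t) * B (x, t)"
  using cross_flow_region.dt_a[OF swap, of x t] cross_flow_region.z_def[OF swap, of "(x, t)"]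
  by (simp add: y_def algebra_simps)

text \<open>Differentiating \<open>\<gamma> = a_s + a^2\<close> in time gives
  \<open>\<gamma>_t = (a_t)_s - \<beta> \<gamma> a_s + 2 a a_t\<close>. The stated coefficients
  appear after eliminating \<open>a b\<close> in favour of \<alpha>.\<close>

lemma dt_C:
  assumes p: "(x, t) \<in> W"
  shows "dt C (x, t) = A (x, t) * dr z (x, t) / h (x, t)
    + (3 * b (x, t) * C (x, t) + a (x, t) * B (x, t) - 2 * b (x, t) * A (x, t)) * z (x, t)
    + (2 * (b (x, t))\<^sup>2 * (A (x, t) - C (x, t)) - 2 * A (x, t) * B (x, t)) * C (x, t)"
proof -
  let ?f = "f (x, t)" and ?h = "h (x, t)" and ?a = "a (x, t)" and ?b = "b (x, t)" and ?A = "A (x, t)"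
    and ?B = "B (x, t)" and ?C = "C (x, t)" and ?z = "z (x, t)" and ?zr = "dr z (x, t)"
  note D = DERIV_dr[OF p] DERIV_dt[OF p] DERIV_dr_A[OF p]
  have h: "?h \<noteq> 0" using h_nz[OF p] .
  have "?B * ?C * ?h * (?C - ?a\<^sup>2) + ?h * (dt C (x, t) - 2 * ?a * dt a (x, t))
      = ?h * (?b * (?C - ?A) + ?a * (?B - ?A)) * ?z + ?A * ?zr
        + (?h * (?B - ?b\<^sup>2) * ?C\<^sup>2 + ?b * (2 * ?C * (?h * ?z)))
        - ((?h * (?C - ?a\<^sup>2) + ?h * (?B - ?b\<^sup>2)) * ?A * ?C
            + (?a + ?b) * (?h * (?b * (?C - ?A) + ?a * (?B - ?A))) * ?C + (?a + ?b) * ?A * (?h * ?z))"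
  proof (rule mixed_partials_relation[OF W smooth(4) p dr(3), where Ft = "\<lambda>p. A p * z p + b p * (C p)\<^sup>2 - (a p + b p) * A p * C p"])
    show "dt a q = A q * z q + b q * (C q)\<^sup>2 - (a q + b q) * A q * C q" if "q \<in> W" for q
      using dt_a[of "fst q" "snd q"] that by simp
  qed (rule derivative_eq_intros D refl | assumption | simp add: algebra_simps power2_eq_square)+
  then have "?h * dt C (x, t) = ?A * ?zr + ?h * ((3 * ?b * ?C + ?a * ?B - 2 * ?b * ?A) * ?z
      + (2 * ?b\<^sup>2 * (?A - ?C) - 2 * ?A * ?B) * ?C)"
    using A[OF p] dt_a[OF p] by algebra
  then show ?thesis using h by (simp add: field_simps)
qed

end

section \<open>Dissipation\<close>

lemma DERIV_root3_prod:
  fixes A B C :: "real \<Rightarrow> real"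
  assumes pos: "A x > 0" "B x > 0" "C x > 0"
    and D: "(A has_real_derivative A') (at x)" "(B has_real_derivative B') (at x)"
      "(C has_real_derivative C') (at x)"
  shows "((\<lambda>x. root 3 (A x * B x * C x)) has_real_derivative
    root 3 (A x * B x * C x) / 3 * (A' / A x + B' / B x + C' / C x)) (at x)"
proof -
  define c where "c = root 3 (A x * B x * C x)"
  have c: "c > 0" "c ^ 3 = A x * B x * C x" using pos by (auto simp: c_def)
  have "((\<lambda>x. root 3 (A x * B x * C x)) has_real_derivative
    inverse (real 3 * c ^ (3 - Suc 0)) * (A' * B x * C x + A x * B' * C x + A x * B x * C')) (at x)"
    unfolding c_def using pos
    by (intro DERIV_chain2[OF DERIV_real_root])
       (auto intro!: derivative_eq_intros D simp: algebra_simps)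
  moreover have "inverse (real 3 * c ^ (3 - Suc 0)) * (A' * B x * C x + A x * B' * C x + A x * B x * C')
      = c / 3 * (A' / A x + B' / B x + C' / C x)"
  proof -
    have "A' * B x * C x + A x * B' * C x + A x * B x * C' = A x * B x * C x * (A' / A x + B' / B x + C' / C x)"
      using pos by (simp add: field_simps)
    also have "\<dots> = c ^ 3 * (A' / A x + B' / B x + C' / C x)" by (simp only: c(2))
    finally show ?thesis
      using c(1) by (simp add: field_simps power2_eq_square power3_eq_cube)
  qed
  ultimately show ?thesis by (simp only: c_def)
qed

text \<open>The first three lines are \<open>\<alpha>_t\<close>, \<open>\<beta>_t\<close>,
  \<open>\<gamma>_t\<close>, and \<open>(A + B + C) * S\<close> comes from the growth rate
  \<open>S\<close> of the volume density \<open>f g h\<close>. On the right,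
  \<open>(a + b) E + E_s\<close> equals \<open>(f g E)_s / (f g)\<close>, a divergence;
  \<open>3 \<alpha> \<beta> \<gamma>\<close> is left over.\<close>

lemma trace_evolution_identity:
  fixes a b A B C y z ys zs :: real
  assumes A: "A = a * b"
  defines "As \<equiv> b * (C - A) + a * (B - A)" and "S \<equiv> A * B + B * C + C * A"
  shows "((A * z + b * C\<^sup>2 - (a + b) * A * C) * b + a * (A * y + a * B\<^sup>2 - (a + b) * A * B))
    + (A * ys + (3 * a * B + b * C - 2 * a * A) * y + (2 * a\<^sup>2 * (A - B) - 2 * A * C) * B)
    + (A * zs + (3 * b * C + a * B - 2 * b * A) * z + (2 * b\<^sup>2 * (A - C) - 2 * A * B) * C)
    + (A + B + C) * S
    = 3 * (A * B * C) + (a + b) * (A * (y + z) + b * C * (C - A) + a * B * (B - A))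
      + (As * (y + z) + A * (ys + zs)
        + (B - b\<^sup>2) * C * (C - A) + b * (z * (C - A) + C * (z - As))
        + (C - a\<^sup>2) * B * (B - A) + a * (y * (B - A) + B * (y - As)))"
  unfolding As_def S_def A by (simp add: algebra_simps power2_eq_square)

text \<open>The substitution \<open>C = a (b + p)\<close>, \<open>B = b (a + q)\<close>, \<open>y = B Y\<close>, \<open>z = C Z\<close> clears all denominators.\<close>

lemma log_det_evolution_identity:
  fixes a b A B C y z ys zs :: real
  assumes A: "A = a * b" and nz: "a \<noteq> 0" "b \<noteq> 0" "B \<noteq> 0" "C \<noteq> 0"
  defines "As \<equiv> b * (C - A) + a * (B - A)" and "S \<equiv> A * B + B * C + C * A"
    and "m \<equiv> (C - A) / a + z / C" and "n \<equiv> (B - A) / b + y / B"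
  defines "Q \<equiv> As + A * y / B + A * z / C"
  shows "((A * z + b * C\<^sup>2 - (a + b) * A * C) * b + a * (A * y + a * B\<^sup>2 - (a + b) * A * B)) / A
    + (A * ys + (3 * a * B + b * C - 2 * a * A) * y + (2 * a\<^sup>2 * (A - B) - 2 * A * C) * B) / B
    + (A * zs + (3 * b * C + a * B - 2 * b * A) * z + (2 * b\<^sup>2 * (A - C) - 2 * A * B) * C) / C
    + 3 * S
    = (a + b) * Q + Q * (As / A + y / B + z / C) / 3
      + ((B - b\<^sup>2) * (C - A) + b * (z - As) + (C - a\<^sup>2) * (B - A) + a * (y - As)
        + (As * y + A * ys) / B - A * y * y / B\<^sup>2 + (As * z + A * zs) / C - A * z * z / C\<^sup>2)
      + S + 2 / 3 * A * (m\<^sup>2 + n\<^sup>2 - m * n)"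
proof -
  define p q Y Z ys' zs' where "p = (C - A) / a" "q = (B - A) / b" "Y = y / B" "Z = z / C"
    "ys' = ys / B" "zs' = zs / C"
  note defs = p_q_Y_Z_ys'_zs'_def
  have C: "C = a * (b + p)" and B: "B = b * (a + q)" using nz by (simp_all add: defs A field_simps)
  have yz: "y = B * Y" "z = C * Z" "ys = B * ys'" "zs = C * zs'" using nz by (simp_all add: defs)
  have As: "As = A * (p + q)" unfolding As_def B C A by (simp add: algebra_simps)
  have nz': "A \<noteq> 0" using nz A by simp
  have mn: "m = p + Z" "n = q + Y" by (simp_all add: m_def n_def defs)
  have Q: "Q = A * (p + q + Y + Z)" unfolding Q_def As yz using nz by (simp add: algebra_simps)
  have At: "((A * z + b * C\<^sup>2 - (a + b) * A * C) * b + a * (A * y + a * B\<^sup>2 - (a + b) * A * B)) / A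
      = b * z + b * C * (b + p) - (a + b) * b * C + a * y + a * B * (a + q) - (a + b) * a * B"
  proof -
    have "(A * z + b * C\<^sup>2 - (a + b) * A * C) * b + a * (A * y + a * B\<^sup>2 - (a + b) * A * B)
        = A * (b * z + b * C * (b + p) - (a + b) * b * C + a * y + a * B * (a + q) - (a + b) * a * B)"
      unfolding B C A by (simp add: algebra_simps power2_eq_square)
    then show ?thesis using nz' by simp
  qed
  have Bt: "(A * ys + (3 * a * B + b * C - 2 * a * A) * y + (2 * a\<^sup>2 * (A - B) - 2 * A * C) * B) / B
      = A * ys' + (3 * a * B + b * C - 2 * a * A) * Y + 2 * a\<^sup>2 * (A - B) - 2 * A * C"
    unfolding yz using nz by (simp add: field_simps)
  have Ct: "(A * zs + (3 * b * C + a * B - 2 * b * A) * z + (2 * b\<^sup>2 * (A - C) - 2 * A * B) * C) / C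
      = A * zs' + (3 * b * C + a * B - 2 * b * A) * Z + 2 * b\<^sup>2 * (A - C) - 2 * A * B"
    unfolding yz using nz by (simp add: field_simps)
  have L: "As / A + y / B + z / C = p + q + Y + Z"
    unfolding As yz using nz nz' by simp
  have q1: "(As * y + A * ys) / B - A * y * y / B\<^sup>2 + (As * z + A * zs) / C - A * z * z / C\<^sup>2
      = As * Y + A * ys' - A * Y * Y + As * Z + A * zs' - A * Z * Z"
    unfolding yz using nz by (simp add: field_simps power2_eq_square)
  \<comment> \<open>In the goal the four terms are appended to a longer left-nested sum, so the left
    side of \<open>q1\<close> is not a subterm there; the arbitrary head \<open>u\<close> makes the
    rewrite match.\<close>
  have r: "u + (As * y + A * ys) / B - A * y * y / B\<^sup>2 + (As * z + A * zs) / C - A * z * z / C\<^sup>2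
      = u + (As * Y + A * ys' - A * Y * Y + As * Z + A * zs' - A * Z * Z)" for u
    using q1 by linarith
  show ?thesis
    unfolding At Bt Ct L r mn Q unfolding As yz(1,2) S_def unfolding B C A
    by (simp add: field_simps power2_eq_square)
qed

context cross_flow_region
begin

definition c where "c p = root 3 (A p * B p * C p)"
definition J where "J p = ((A p + B p + C p) / 3 - c p) * (f p * g p * h p)"
text \<open>For positive curvatures this is
  \<open>\<alpha> (log (\<alpha> \<beta> \<gamma>))_s\<close>, so that
  \<open>c Q = 3 \<alpha> c_s\<close>.\<close>

definition Q where "Q p = b p * (C p - A p) + a p * (B p - A p) + A p * y p / B p + A p * z p / C p"
text \<open>Three times the flux for the integrand of \<open>J\<close>; the factor 3 avoids the
  thirds coming from \<open>P / 3\<close> and from the cube root.\<close>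

definition Theta where
  "Theta p = f p * g p * (A p * (y p + z p) + b p * C p * (C p - A p) + a p * B p * (B p - A p))
    - f p * g p * c p * Q p"

lemma J_dissipation:
  assumes p: "(x, t) \<in> W" and K: "A (x, t) > 0" "B (x, t) > 0" "C (x, t) > 0"
  obtains Jt Tr where "((\<lambda>t. J (x, t)) has_real_derivative Jt) (at t)"
    "((\<lambda>x. Theta (x, t)) has_real_derivative Tr) (at x)" "Jt \<le> Tr / 3"
proof -
  let ?f = "f (x, t)" and ?g = "g (x, t)" and ?h = "h (x, t)" and ?a = "a (x, t)" and ?b = "b (x, t)"
    and ?A = "A (x, t)" and ?B = "B (x, t)" and ?C = "C (x, t)" and ?y = "y (x, t)" and ?z = "z (x, t)"
    and ?c = "c (x, t)" and ?Q = "Q (x, t)"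
  define ys zs where "ys = dr y (x, t) / ?h" and "zs = dr z (x, t) / ?h"
  have h: "?h > 0" "?f > 0" "?g > 0" using pos[OF p] by auto
  have yzr: "dr y (x, t) = ?h * ys" "dr z (x, t) = ?h * zs" using h by (auto simp: ys_def zs_def)
  have c: "?c > 0" using K by (simp add: c_def)
  have nz: "?a \<noteq> 0" "?b \<noteq> 0" using K(1) A[OF p] by auto
  define As where "As = ?b * (?C - ?A) + ?a * (?B - ?A)"
  define S where "S = ?A * ?B + ?B * ?C + ?C * ?A"
  define At where "At = (?A * ?z + ?b * ?C\<^sup>2 - (?a + ?b) * ?A * ?C) * ?b + ?a * (?A * ?y + ?a * ?B\<^sup>2 - (?a + ?b) * ?A * ?B)"
  define Bt where "Bt = ?A * ys + (3 * ?a * ?B + ?b * ?C - 2 * ?a * ?A) * ?y + (2 * ?a\<^sup>2 * (?A - ?B) - 2 * ?A * ?C) * ?B"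
  define Ct where "Ct = ?A * zs + (3 * ?b * ?C + ?a * ?B - 2 * ?b * ?A) * ?z + (2 * ?b\<^sup>2 * (?A - ?C) - 2 * ?A * ?B) * ?C"
  have dtA: "((\<lambda>t. A (x, t)) has_real_derivative At) (at t)"
    by (subst DERIV_W_eq(2)[where F=A and G="\<lambda>p. a p * b p", OF p A])
       (assumption, (rule derivative_eq_intros DERIV_dt[OF p] refl)+, simp add: dt_a[OF p] dt_b[OF p] At_def)
  have dtC: "((\<lambda>t. C (x, t)) has_real_derivative Ct) (at t)"
    using DERIV_dt(8)[OF p] unfolding dt_C[OF p] Ct_def zs_def by simp
  have "dt B (x, t) = Bt"
    using cross_flow_region.dt_C[OF swap p]
    unfolding cross_flow_region.z_def[OF swap, abs_def] Bt_def ys_def y_def[abs_def]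
    by (simp add: algebra_simps)
  then have dtB: "((\<lambda>t. B (x, t)) has_real_derivative Bt) (at t)"
    using DERIV_dt(7)[OF p] by simp
  have dtc: "((\<lambda>t. c (x, t)) has_real_derivative ?c / 3 * (At / ?A + Bt / ?B + Ct / ?C)) (at t)"
    unfolding c_def by (intro DERIV_root3_prod K dtA dtB dtC)
  have drA: "((\<lambda>x. A (x, t)) has_real_derivative ?h * As) (at x)"
    using DERIV_dr_A[OF p] by (simp add: As_def)
  have drc: "((\<lambda>x. c (x, t)) has_real_derivative ?h * (?c / 3 * (As / ?A + ?y / ?B + ?z / ?C))) (at x)"
  proof -
    have "((\<lambda>x. c (x, t)) has_real_derivative ?c / 3 * (?h * As / ?A + ?h * ?y / ?B + ?h * ?z / ?C)) (at x)"
      unfolding c_def by (intro DERIV_root3_prod K drA DERIV_dr[OF p])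
    then show ?thesis by (simp add: algebra_simps)
  qed
  define Qs where "Qs = (?B - ?b\<^sup>2) * (?C - ?A) + ?b * (?z - As) + (?C - ?a\<^sup>2) * (?B - ?A) + ?a * (?y - As)
        + (As * ?y + ?A * ys) / ?B - ?A * ?y * ?y / ?B\<^sup>2 + (As * ?z + ?A * zs) / ?C - ?A * ?z * ?z / ?C\<^sup>2"
  note D = DERIV_dr[OF p, unfolded yzr]
  have drQ: "((\<lambda>x. Q (x, t)) has_real_derivative ?h * Qs) (at x)"
    unfolding Q_def Qs_def
    by (rule derivative_eq_intros drA D refl | use K in simp)+
       (use K in \<open>simp add: field_simps power2_eq_square\<close>)
  define E1 where "E1 = (\<lambda>p. A p * (y p + z p) + b p * C p * (C p - A p) + a p * B p * (B p - A p))"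
  define E1s where "E1s = As * (?y + ?z) + ?A * (ys + zs)
        + (?B - ?b\<^sup>2) * ?C * (?C - ?A) + ?b * (?z * (?C - ?A) + ?C * (?z - As))
        + (?C - ?a\<^sup>2) * ?B * (?B - ?A) + ?a * (?y * (?B - ?A) + ?B * (?y - As))"
  have drE1: "((\<lambda>x. E1 (x, t)) has_real_derivative ?h * E1s) (at x)"
    unfolding E1_def E1s_def
    by (rule derivative_eq_intros drA D refl)+ (simp add: algebra_simps)
  have Theta_E1: "Theta q = f q * g q * E1 q - f q * g q * c q * Q q" for q
    by (simp add: Theta_def E1_def)
  \<comment> \<open>\<open>f g h R\<close> is the \<open>r\<close>-derivative of
    \<open>Theta\<close>, because \<open>(f g)_s = (a + b) f g\<close> and \<open>c_s / c\<close> is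
    one third of the logarithmic derivative of the determinant.\<close>
  define R where "R = (?a + ?b) * E1 (x, t) + E1s
      - ?c * ((?a + ?b) * ?Q + ?Q * (As / ?A + ?y / ?B + ?z / ?C) / 3 + Qs)"
  have Tr: "((\<lambda>x. Theta (x, t)) has_real_derivative ?f * ?g * ?h * R) (at x)"
    unfolding Theta_E1 R_def
    by (rule derivative_eq_intros drE1 drQ drc D refl)+ (simp add: algebra_simps)
  define M where "M = ((?C - ?A) / ?a + ?z / ?C)\<^sup>2 + ((?B - ?A) / ?b + ?y / ?B)\<^sup>2
      - ((?C - ?A) / ?a + ?z / ?C) * ((?B - ?A) / ?b + ?y / ?B)"
  have tr: "At + Bt + Ct + (?A + ?B + ?C) * S = 3 * (?A * ?B * ?C) + (?a + ?b) * E1 (x, t) + E1s"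
    unfolding At_def Bt_def Ct_def E1_def E1s_def S_def As_def
    by (rule trace_evolution_identity[OF A[OF p]])
  have ld: "At / ?A + Bt / ?B + Ct / ?C + 3 * S
     = (?a + ?b) * ?Q + ?Q * (As / ?A + ?y / ?B + ?z / ?C) / 3 + Qs + S + 2 / 3 * ?A * M"
    unfolding At_def Bt_def Ct_def Qs_def S_def As_def M_def Q_def
    by (rule log_det_evolution_identity[OF A[OF p] nz]) (use K in auto)
  \<comment> \<open>The time derivative of \<open>J\<close> divided by \<open>f g h\<close>. The
    volume growth \<open>S\<close> is distributed so that the left sides of \<open>tr\<close> and
    \<open>ld\<close> occur literally, weighted by \<open>1 / 3\<close> and
    \<open>- c / 3\<close>.\<close>
  define N where "N = (At + Bt + Ct) / 3 + (?A + ?B + ?C) * S / 3 - ?c / 3 * (At / ?A + Bt / ?B + Ct / ?C + 3 * S)"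
  have Jt: "((\<lambda>t. J (x, t)) has_real_derivative ?f * ?g * ?h * N) (at t)"
    unfolding J_def N_def S_def
    by (rule DERIV_cdivide derivative_eq_intros dtA dtB dtC dtc DERIV_dt[OF p] refl)+
       (simp add: algebra_simps add_divide_distrib)
  have "N = R / 3 + (?A * ?B * ?C - ?c * S / 3) - 2 / 9 * ?c * ?A * M"
  proof -
    have "N = (At + Bt + Ct + (?A + ?B + ?C) * S) / 3 - ?c / 3 * (At / ?A + Bt / ?B + Ct / ?C + 3 * S)"
      by (simp add: N_def add_divide_distrib)
    then show ?thesis unfolding tr ld R_def
      by (simp add: algebra_simps add_divide_distrib diff_divide_distrib)
  qed
  moreover have "?A * ?B * ?C \<le> ?c * S / 3"
    using arith_geo_mean3_pairs[OF K] by (simp add: c_def S_def)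
  moreover have "M \<ge> 0"
  proof -
    have "4 * (u\<^sup>2 + v\<^sup>2 - u * v) = (2 * u - v)\<^sup>2 + 3 * v\<^sup>2" for u v :: real
      by (simp add: power2_eq_square algebra_simps)
    then have "u\<^sup>2 + v\<^sup>2 - u * v \<ge> 0" for u v :: real
      by (smt (verit) zero_le_power2)
    then show ?thesis unfolding M_def .
  qed
  then have "2 / 9 * ?c * ?A * M \<ge> 0" using c K by simp
  ultimately have "N \<le> R / 3" by linarith
  then have "?f * ?g * ?h * N \<le> (?f * ?g * ?h * R) / 3"
    using mult_left_mono[of N "R / 3" "?f * ?g * ?h"] h by simp
  then show thesis using that Jt Tr by blast
qed

end

section \<open>Metrics smooth across the core\<close>

text \<open>The flow equation is one-sided at \<open>t = 0\<close>. Uniqueness still holds since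
  every point of the interval is a limit point of it; this lets the flow equation be compared with
  the full derivatives of the smooth extensions.\<close>

lemma real_derivative_within_Ico_unique:
  fixes t T :: real
  assumes "t \<in> {0..<T}" "(f has_real_derivative A) (at t within {0..<T})"
    "(f has_real_derivative B) (at t within {0..<T})"
  shows "A = B"
proof -
  have "t islimpt {0..<T}"
  proof (rule connected_imp_perfect)
    have "infinite {0..<T}" using assms(1) by (simp add: infinite_Ico)
    then show "{0..<T} \<noteq> {x}" for x by (metis finite.emptyI finite.insertI)
  qed (use assms(1) in auto)
  then have "at t within {0..<T} \<noteq> bot" by (simp add: trivial_limit_within)
  then show ?thesis
    using assms vector_derivative_unique_within unfolding has_real_derivative_iff_has_vector_derivative by blast
qed

text \<open>Used with \<sigma> equal to 1 or -1, so differentiation exchanges even and odd. The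
  interval is open because the symmetry is assumed on the strip only, and differentiating it needs a
  neighbourhood.\<close>

lemma dr_parity:
  assumes "open U" "smooth_on U F" and U: "{-1..1} \<times> {t} \<subseteq> U"
    and F: "\<And>x. x \<in> {-1<..<1} \<Longrightarrow> F (- x, t) = \<sigma> * F (x, t)" and x: "x \<in> {-1<..<1}"
  shows "dr F (- x, t) = - \<sigma> * dr F (x, t)"
proof -
  have xU: "(x, t) \<in> U" "(- x, t) \<in> U" using U x by auto
  have "((\<lambda>x. F (- x, t)) has_real_derivative dr F (- x, t) * (- 1)) (at x)"
    by (rule DERIV_chain2[where g=uminus, OF smooth_on_DERIV_dr[OF assms(1,2) xU(2)]])
       (auto intro!: derivative_eq_intros)
  moreover have "((\<lambda>x. F (- x, t)) has_real_derivative \<sigma> * dr F (x, t)) (at x)"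
    by (rule has_field_derivative_transform_within_open[OF DERIV_cmult[OF smooth_on_DERIV_dr[OF assms(1,2) xU(1)]]
          open_greaterThanLessThan x]) (simp add: F)
  ultimately show ?thesis using DERIV_unique by fastforce
qed

locale rotational_family =
  fixes U :: "(real \<times> real) set" and T :: real and f g h :: "real \<Rightarrow> real \<Rightarrow> real"
  assumes T: "0 < T" and U: "open U" "{-1..1} \<times> {0..<T} \<subseteq> U"
    and smooth_fgh: "smooth_on U (\<lambda>(r, t). f r t)" "smooth_on U (\<lambda>(r, t). g r t)" "smooth_on U (\<lambda>(r, t). h r t)"
    and parity: "\<And>r t. r \<in> {-1..1} \<Longrightarrow> t \<in> {0..<T} \<Longrightarrow> f (- r) t = - f r t"
      "\<And>r t. r \<in> {-1..1} \<Longrightarrow> t \<in> {0..<T} \<Longrightarrow> g (- r) t = g r t"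
      "\<And>r t. r \<in> {-1..1} \<Longrightarrow> t \<in> {0..<T} \<Longrightarrow> h (- r) t = h r t"
    and f_pos: "\<And>r t. r \<in> {0<..1} \<Longrightarrow> t \<in> {0..<T} \<Longrightarrow> f r t > 0"
    and gh_pos: "\<And>r t. r \<in> {0..1} \<Longrightarrow> t \<in> {0..<T} \<Longrightarrow> g r t > 0"
      "\<And>r t. r \<in> {0..1} \<Longrightarrow> t \<in> {0..<T} \<Longrightarrow> h r t > 0"
    and core: "\<And>t. t \<in> {0..<T} \<Longrightarrow> deriv (\<lambda>r. f r t) 0 = 2 * pi * h 0 t"
begin

definition ff :: "real \<times> real \<Rightarrow> real" where "ff p = f (fst p) (snd p)"
definition gg :: "real \<times> real \<Rightarrow> real" where "gg p = g (fst p) (snd p)"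
definition hh :: "real \<times> real \<Rightarrow> real" where "hh p = h (fst p) (snd p)"

text \<open>The domain is shrunk so that all segments towards the core stay inside it, as the radial
  quotients require.\<close>

definition S where "S = {p. \<forall>\<theta>\<in>{0..1}. (\<theta> * fst p, snd p) \<in> U}"

lemma S: "open S" "radially_closed S" "S \<subseteq> U" "{-1..1} \<times> {0..<T} \<subseteq> S"
proof -
  show "open S" unfolding S_def by (rule open_radial_core[OF U(1)])
  show "S \<subseteq> U"
  proof
    fix p assume "p \<in> S"
    then have "(1 * fst p, snd p) \<in> U" unfolding S_def by fastforce
    then show "p \<in> U" by simp
  qed
  have "(\<theta>' * (\<theta> * x), t) \<in> U" if "(x, t) \<in> S" "\<theta> \<in> {0..1}" "\<theta>' \<in> {0..1}" for x t \<theta> \<theta>'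
  proof -
    have "\<theta>' * \<theta> \<in> {0..1}" using that by (auto intro: mult_le_one)
    then have "((\<theta>' * \<theta>) * fst (x, t), snd (x, t)) \<in> U" using that(1) unfolding S_def by blast
    then show ?thesis by (simp add: mult.assoc)
  qed
  then show "radially_closed S" unfolding radially_closed_def by (auto simp: S_def)
  show "{-1..1} \<times> {0..<T} \<subseteq> S"
  proof
    fix p :: "real \<times> real" assume p: "p \<in> {-1..1} \<times> {0..<T}"
    have "(\<theta> * fst p, snd p) \<in> {-1..1} \<times> {0..<T}" if "\<theta> \<in> {0..1}" for \<theta>
    proof -
      have "\<bar>\<theta> * fst p\<bar> \<le> 1" using p that by (auto simp: abs_mult intro!: mult_le_one)
      then show ?thesis using p by (cases p) auto
    qed
    then show "p \<in> S" using U(2) unfolding S_def by blast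
  qed
qed

lemma smooth_S: "smooth_on S ff" "smooth_on S gg" "smooth_on S hh"
proof -
  have "ff = (\<lambda>(r, t). f r t)" "gg = (\<lambda>(r, t). g r t)" "hh = (\<lambda>(r, t). h r t)"
    by (auto simp: ff_def gg_def hh_def)
  then show "smooth_on S ff" "smooth_on S gg" "smooth_on S hh"
    using smooth_fgh smooth_on_subset S(3) by metis+
qed

text \<open>On the strip these are \<open>f / r\<close>, \<open>f_rr / r\<close>,
  \<open>g_r / r\<close> and \<open>h_r / r\<close>, continued across the core: by parity all four
  numerators vanish at \<open>r = 0\<close>.\<close>

definition "F = radial_quotient ff"
definition "F2 = radial_quotient (dr (dr ff))"
definition "G1 = radial_quotient (dr gg)"
definition "H1 = radial_quotient (dr hh)"

lemmas smooth_dr_S = smooth_on_dr[OF S(1)]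

lemma smooth_quotients: "smooth_on S F" "smooth_on S F2" "smooth_on S G1" "smooth_on S H1"
  unfolding F_def F2_def G1_def H1_def
  by (intro smooth_on_radial_quotient S smooth_dr_S smooth_S)+

lemma dr_parities:
  assumes "t \<in> {0..<T}" "x \<in> {-1<..<1}"
  shows "dr ff (- x, t) = dr ff (x, t)" "dr gg (- x, t) = - dr gg (x, t)" "dr hh (- x, t) = - dr hh (x, t)"
    "dr (dr ff) (- x, t) = - dr (dr ff) (x, t)" "dr (dr gg) (- x, t) = dr (dr gg) (x, t)"
    "dr (dr hh) (- x, t) = dr (dr hh) (x, t)" "dr (dr (dr ff)) (- x, t) = dr (dr (dr ff)) (x, t)"
proof -
  have s: "{-1..1} \<times> {t} \<subseteq> S" using S(4) assms(1) by auto
  note P = dr_parity[OF S(1) _ s]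
  have f1: "dr ff (- x, t) = dr ff (x, t)" if "x \<in> {-1<..<1}" for x
    using P[OF smooth_S(1), of "-1" x] parity(1) assms(1) that by (simp add: ff_def)
  have g1: "dr gg (- x, t) = - dr gg (x, t)" if "x \<in> {-1<..<1}" for x
    using P[OF smooth_S(2), of 1 x] parity(2) assms(1) that by (simp add: gg_def)
  have h1: "dr hh (- x, t) = - dr hh (x, t)" if "x \<in> {-1<..<1}" for x
    using P[OF smooth_S(3), of 1 x] parity(3) assms(1) that by (simp add: hh_def)
  have f2: "dr (dr ff) (- x, t) = - dr (dr ff) (x, t)" if "x \<in> {-1<..<1}" for x
    using P[OF smooth_dr_S[OF smooth_S(1)], of 1 x] f1 that by simp
  have g2: "dr (dr gg) (- x, t) = dr (dr gg) (x, t)" if "x \<in> {-1<..<1}" for x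
    using P[OF smooth_dr_S[OF smooth_S(2)], of "-1" x] g1 that by simp
  have h2: "dr (dr hh) (- x, t) = dr (dr hh) (x, t)" if "x \<in> {-1<..<1}" for x
    using P[OF smooth_dr_S[OF smooth_S(3)], of "-1" x] h1 that by simp
  have f3: "dr (dr (dr ff)) (- x, t) = dr (dr (dr ff)) (x, t)" if "x \<in> {-1<..<1}" for x
    using P[OF smooth_dr_S[OF smooth_dr_S[OF smooth_S(1)]], of "-1" x] f2 that by simp
  show "dr ff (- x, t) = dr ff (x, t)" "dr gg (- x, t) = - dr gg (x, t)" "dr hh (- x, t) = - dr hh (x, t)"
    "dr (dr ff) (- x, t) = - dr (dr ff) (x, t)" "dr (dr gg) (- x, t) = dr (dr gg) (x, t)"
    "dr (dr hh) (- x, t) = dr (dr hh) (x, t)" "dr (dr (dr ff)) (- x, t) = dr (dr (dr ff)) (x, t)"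
    using f1 g1 h1 f2 g2 h2 f3 assms(2) by blast+
qed

lemma core_values:
  assumes "t \<in> {0..<T}"
  shows "ff (0, t) = 0" "dr gg (0, t) = 0" "dr hh (0, t) = 0" "dr (dr ff) (0, t) = 0"
  using parity(1)[of 0 t] dr_parities[of t 0] assms by (auto simp: ff_def)

lemma quotient_mult:
  assumes "(x, t) \<in> S" "t \<in> {0..<T}"
  shows "ff (x, t) = x * F (x, t)" "dr gg (x, t) = x * G1 (x, t)" "dr hh (x, t) = x * H1 (x, t)"
    "dr (dr ff) (x, t) = x * F2 (x, t)"
  using radial_quotient_mult[OF S(1,2) _ assms(1)] smooth_S smooth_dr_S core_values[OF assms(2)]
  by (simp_all add: F_def F2_def G1_def H1_def)

text \<open>A neighbourhood of the strip on which the denominators of the regularized curvatures are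
  positive. \<open>F\<close> stands in for \<open>f\<close>, which vanishes on the core; there
  \<open>F = f_r = 2 pi h > 0\<close> by the smoothness condition.\<close>

definition V where "V = {p \<in> S. F p > 0 \<and> gg p > 0 \<and> hh p > 0}"

lemma V: "open V" "V \<subseteq> S" "{-1..1} \<times> {0..<T} \<subseteq> V"
proof -
  have "V = (S \<inter> F -` {0<..}) \<inter> (S \<inter> gg -` {0<..}) \<inter> (S \<inter> hh -` {0<..})" by (auto simp: V_def)
  moreover have "open (S \<inter> \<phi> -` {0<..})" if "smooth_on S \<phi>" for \<phi> :: "real \<times> real \<Rightarrow> real"
    using continuous_open_preimage[OF smooth_on_continuous[OF S(1) that] S(1) open_greaterThan] .
  ultimately show "open V" using smooth_quotients(1) smooth_S(2,3) open_Int by metis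
  show "V \<subseteq> S" by (auto simp: V_def)
  show "{-1..1} \<times> {0..<T} \<subseteq> V"
  proof clarify
    fix x t :: real assume xt: "x \<in> {-1..1}" "t \<in> {0..<T}"
    have S': "(x, t) \<in> S" using S(4) xt by auto
    have gh: "gg (x, t) > 0" "hh (x, t) > 0"
      using gh_pos[of x t] gh_pos[of "- x" t] parity(2,3)[of x t] xt
      by (cases "x < 0"; simp add: gg_def hh_def)+
    have "F (x, t) > 0"
    proof (cases "x = 0")
      case True
      have "F (0, t) = deriv (\<lambda>r. f r t) 0"
        unfolding F_def radial_quotient_core by (simp add: dr_def ff_def)
      then show ?thesis using True core[OF xt(2)] gh_pos(2)[of 0 t] xt by simp
    next
      case False
      have "x * ff (x, t) > 0"
        using f_pos[of x t] f_pos[of "- x" t] parity(1)[of x t] xt False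
        by (cases "x < 0"; simp add: ff_def mult_neg_neg)
      then show ?thesis using quotient_mult(1)[OF S' xt(2)] False
        by (simp add: zero_less_mult_iff) (auto simp: mult_less_0_iff zero_less_mult_iff)
    qed
    then show "(x, t) \<in> V" using gh S' by (simp add: V_def)
  qed
qed

lemma V_pos: "p \<in> V \<Longrightarrow> F p > 0" "p \<in> V \<Longrightarrow> gg p > 0" "p \<in> V \<Longrightarrow> hh p > 0"
  by (auto simp: V_def)

lemma V_nz: "p \<in> V \<Longrightarrow> F p \<noteq> 0" "p \<in> V \<Longrightarrow> gg p \<noteq> 0" "p \<in> V \<Longrightarrow> hh p \<noteq> 0"
  by (auto simp: V_def)

lemma smooth_V: "smooth_on V ff" "smooth_on V gg" "smooth_on V hh" "smooth_on V F" "smooth_on V F2"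
  "smooth_on V G1" "smooth_on V H1"
  using smooth_S smooth_quotients smooth_on_subset[OF _ V(2)] by blast+

lemmas smooth_dr_V = smooth_on_dr[OF V(1)]

text \<open>The curvatures, written so that they are smooth across the core.\<close>

definition al where "al p = dr ff p * G1 p / (F p * gg p * (hh p)\<^sup>2)"
definition be where "be p = (dr (dr gg) p / hh p - dr gg p * dr hh p / (hh p)\<^sup>2) / (hh p * gg p)"
definition ga where "ga p = (F2 p / hh p - dr ff p * H1 p / (hh p)\<^sup>2) / (hh p * F p)"

lemma smooth_curv: "smooth_on V al" "smooth_on V be" "smooth_on V ga"
  unfolding al_def[abs_def] be_def[abs_def] ga_def[abs_def]
  by (rule smooth_on_divide smooth_on_mult smooth_on_diff smooth_on_power smooth_V smooth_dr_V
      | simp add: V_nz)+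

text \<open>Both sides equal \<open>g_rr / (g h^2)\<close>. Geometrically, rotation about the core
  makes the angular and the radial direction interchangeable there.\<close>

lemma core_al_be: "t \<in> {0..<T} \<Longrightarrow> al (0, t) = be (0, t)"
  using subsetD[OF V(3), of "(0, t)"] V_nz[of "(0, t)"] core_values[of t]
  by (auto simp: al_def be_def F_def G1_def radial_quotient_core power2_eq_square)

lemma even_quotients:
  assumes "t \<in> {0..<T}" "x \<in> {-1<..<1}"
  shows "F (- x, t) = F (x, t)" "F2 (- x, t) = F2 (x, t)" "G1 (- x, t) = G1 (x, t)" "H1 (- x, t) = H1 (x, t)"
proof -
  have \<theta>: "\<theta> * x \<in> {-1<..<1}" if "\<theta> \<in> {0..1}" for \<theta>
  proof -
    have "\<bar>\<theta> * x\<bar> \<le> 1 * \<bar>x\<bar>" unfolding abs_mult using that by (intro mult_right_mono) auto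
    then show ?thesis using assms(2) by (auto simp: abs_if split: if_splits)
  qed
  show "F (- x, t) = F (x, t)" "F2 (- x, t) = F2 (x, t)" "G1 (- x, t) = G1 (x, t)" "H1 (- x, t) = H1 (x, t)"
    unfolding F_def F2_def G1_def H1_def
    using dr_parities[OF assms(1) \<theta>] by (intro radial_quotient_even; simp)+
qed

lemma even_curv:
  assumes "t \<in> {0..<T}" "x \<in> {-1<..<1}"
  shows "al (- x, t) = al (x, t)" "be (- x, t) = be (x, t)" "ga (- x, t) = ga (x, t)"
  using dr_parities[OF assms] even_quotients[OF assms] parity(2,3)[of x t] assms
  by (simp_all add: al_def be_def ga_def gg_def hh_def)

lemma dr_curv_core:
  assumes "t \<in> {0..<T}"
  shows "dr al (0, t) = 0" "dr be (0, t) = 0" "dr ga (0, t) = 0"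
proof -
  have s: "{-1..1} \<times> {t} \<subseteq> V" using V(3) assms by auto
  show "dr al (0, t) = 0" "dr be (0, t) = 0" "dr ga (0, t) = 0"
    using dr_parity[OF V(1) smooth_curv(1) s, of 1 0] dr_parity[OF V(1) smooth_curv(2) s, of 1 0]
      dr_parity[OF V(1) smooth_curv(3) s, of 1 0] even_curv[OF assms] by auto
qed

definition a where "a p = dr ff p / (ff p * hh p)"
definition b where "b p = dr gg p / (gg p * hh p)"

lemma smooth_b: "smooth_on V b"
  unfolding b_def[abs_def] by (intro smooth_on_divide smooth_on_mult smooth_V smooth_dr_V) (simp add: V_nz)

context
  fixes x t :: real
  assumes p: "(x, t) \<in> V" and x: "x > 0" and t: "t \<in> {0..<T}"
begin

lemma ff_pos: "ff (x, t) > 0"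
  using quotient_mult(1)[OF _ t] V_pos(1)[OF p] x p V(2) by auto

lemma curv_eq:
  "al (x, t) = dr ff (x, t) * dr gg (x, t) / (ff (x, t) * gg (x, t) * (hh (x, t))\<^sup>2)"
  "ga (x, t) = (dr (dr ff) (x, t) / hh (x, t) - dr ff (x, t) * dr hh (x, t) / (hh (x, t))\<^sup>2) / (hh (x, t) * ff (x, t))"
  using quotient_mult[OF _ t, of x] V_nz[OF p] x p V(2)
  by (auto simp: al_def ga_def field_simps)

lemma al_eq: "al (x, t) = a (x, t) * b (x, t)"
  by (simp add: curv_eq a_def b_def power2_eq_square)

lemma DERIV_a: "((\<lambda>x. a (x, t)) has_real_derivative hh (x, t) * (ga (x, t) - (a (x, t))\<^sup>2)) (at x)"
  unfolding a_def
  by (rule derivative_eq_intros smooth_on_DERIV_dr[OF V(1) _ p] smooth_V smooth_dr_V refl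
      | use ff_pos V_nz[OF p] in simp)+
    (use ff_pos V_nz[OF p] in \<open>simp add: curv_eq field_simps power2_eq_square\<close>)

lemma DERIV_b: "((\<lambda>x. b (x, t)) has_real_derivative hh (x, t) * (be (x, t) - (b (x, t))\<^sup>2)) (at x)"
  unfolding b_def
  by (rule derivative_eq_intros smooth_on_DERIV_dr[OF V(1) _ p] smooth_V smooth_dr_V refl
      | use V_nz[OF p] in simp)+
    (use V_nz[OF p] in \<open>simp add: be_def field_simps power2_eq_square\<close>)

end

text \<open>Derived from the geometry alone, without the flow, because the formula is also needed at
  \<open>r = 1\<close>, which lies outside the open region where the evolution equations are
  derived.\<close>

lemma dr_al:
  assumes p: "(x, t) \<in> V" and x: "x > 0" and t: "t \<in> {0..<T}"
  shows "dr al (x, t) = hh (x, t) * (b (x, t) * (ga (x, t) - al (x, t)) + a (x, t) * (be (x, t) - al (x, t)))"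
proof -
  have "((\<lambda>x. a (x, t) * b (x, t)) has_real_derivative dr al (x, t)) (at x)"
  proof (rule has_field_derivative_transform_within_open[OF smooth_on_DERIV_dr[OF V(1) smooth_curv(1) p]])
    show "open ((\<lambda>x. (x, t)) -` V \<inter> {0<..})"
      by (intro open_Int open_vimage[OF V(1)] continuous_intros)
  qed (use p x al_eq[OF _ _ t] in auto)
  moreover have "((\<lambda>x. a (x, t) * b (x, t)) has_real_derivative
      hh (x, t) * (b (x, t) * (ga (x, t) - al (x, t)) + a (x, t) * (be (x, t) - al (x, t)))) (at x)"
    by (rule derivative_eq_intros DERIV_a[OF assms] DERIV_b[OF assms] refl)+
       (simp add: al_eq[OF assms] algebra_simps power2_eq_square)
  ultimately show ?thesis by (rule DERIV_unique)
qed

lemma strip_in_V: "r \<in> {0..1} \<Longrightarrow> t \<in> {0..<T} \<Longrightarrow> (r, t) \<in> V"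
  using V(3) by auto

lemma curvature:
  assumes r: "r \<in> {0<..1}" and t: "t \<in> {0..<T}" and x: "x$3 = r"
  shows "cross_curv (rot_metric f g h t) x $ 1 $ 1 = - (al (r, t) * ga (r, t)) * (ff (r, t))\<^sup>2"
    "cross_curv (rot_metric f g h t) x $ 2 $ 2 = - (al (r, t) * be (r, t)) * (gg (r, t))\<^sup>2"
    "cross_curv (rot_metric f g h t) x $ 3 $ 3 = - (be (r, t) * ga (r, t)) * (hh (r, t))\<^sup>2"
    "einstein_trace (rot_metric f g h t) x = al (r, t) + be (r, t) + ga (r, t)"
    "einstein_det (rot_metric f g h t) x = al (r, t) * be (r, t) * ga (r, t)"
    "sec_curv (rot_metric f g h t) x (axis 1 1) (axis 2 1) = - al (r, t)"
    "sec_curv (rot_metric f g h t) x (axis 2 1) (axis 3 1) = - be (r, t)"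
    "sec_curv (rot_metric f g h t) x (axis 1 1) (axis 3 1) = - ga (r, t)"
proof -
  \<comment> \<open>Radii beyond 1 inside \<open>V\<close> are kept, so \<open>r = 1\<close> is an
    interior point and the coordinate derivatives on the boundary torus are two-sided.\<close>
  let ?R = "(\<lambda>x. (x, t)) -` V \<inter> {0<..}"
  have p: "(r, t) \<in> V" using strip_in_V r t by auto
  interpret radial_jet f g h t ?R "\<lambda>\<rho>. dr ff (\<rho>, t)" "\<lambda>\<rho>. dr gg (\<rho>, t)" "\<lambda>\<rho>. dr hh (\<rho>, t)"
    r "dr (dr ff) (r, t)" "dr (dr gg) (r, t)"
  proof
    show "open ?R" by (intro open_Int open_vimage[OF V(1)] continuous_intros)
    show "r \<in> ?R" using p r by simp
    fix \<rho> assume "\<rho> \<in> ?R"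
    then have \<rho>: "(\<rho>, t) \<in> V" "\<rho> > 0" by auto
    show "f \<rho> t \<noteq> 0 \<and> g \<rho> t \<noteq> 0 \<and> h \<rho> t \<noteq> 0"
      using ff_pos[OF \<rho> t] V_nz[OF \<rho>(1)] by (simp add: ff_def gg_def hh_def)
    show "((\<lambda>\<rho>. f \<rho> t) has_real_derivative dr ff (\<rho>, t)) (at \<rho>)"
      "((\<lambda>\<rho>. g \<rho> t) has_real_derivative dr gg (\<rho>, t)) (at \<rho>)"
      "((\<lambda>\<rho>. h \<rho> t) has_real_derivative dr hh (\<rho>, t)) (at \<rho>)"
      using smooth_on_DERIV_dr[OF V(1) _ \<rho>(1)] smooth_V(1-3) by (force simp: ff_def gg_def hh_def)+
  next
    show "((\<lambda>\<rho>. dr ff (\<rho>, t)) has_real_derivative dr (dr ff) (r, t)) (at r)"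
      "((\<lambda>\<rho>. dr gg (\<rho>, t)) has_real_derivative dr (dr gg) (r, t)) (at r)"
      using smooth_on_DERIV_dr[OF V(1) smooth_dr_V p] smooth_V by blast+
  qed
  interpret diagonal_curvature "rot_metric f g h t" x "e r" K by (rule curvature[OF x])
  have r0: "r > 0" using r by simp
  have abc: "alpha = al (r, t)" "beta = be (r, t)" "gamma = ga (r, t)"
    using curv_eq[OF p r0 t]
    by (simp_all add: alpha_def beta_def gamma_def be_def) (simp_all add: ff_def gg_def hh_def)
  have e: "e r 1 = (ff (r, t))\<^sup>2" "e r 2 = (gg (r, t))\<^sup>2" "e r 3 = (hh (r, t))\<^sup>2"
    by (simp_all add: e_def ff_def gg_def hh_def)
  have K: "K 1 2 = - al (r, t)" "K 1 3 = - ga (r, t)" "K 2 3 = - be (r, t)"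
    by (simp_all add: K_def abc)
  show "cross_curv (rot_metric f g h t) x $ 1 $ 1 = - (al (r, t) * ga (r, t)) * (ff (r, t))\<^sup>2"
    "cross_curv (rot_metric f g h t) x $ 2 $ 2 = - (al (r, t) * be (r, t)) * (gg (r, t))\<^sup>2"
    "cross_curv (rot_metric f g h t) x $ 3 $ 3 = - (be (r, t) * ga (r, t)) * (hh (r, t))\<^sup>2"
    "einstein_trace (rot_metric f g h t) x = al (r, t) + be (r, t) + ga (r, t)"
    "einstein_det (rot_metric f g h t) x = al (r, t) * be (r, t) * ga (r, t)"
    "sec_curv (rot_metric f g h t) x (axis 1 1) (axis 2 1) = - al (r, t)"
    "sec_curv (rot_metric f g h t) x (axis 2 1) (axis 3 1) = - be (r, t)"
    "sec_curv (rot_metric f g h t) x (axis 1 1) (axis 3 1) = - ga (r, t)"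
    unfolding cross_curv einstein_trace einstein_det e
    by (simp_all add: K sec_curv_axis)
qed

end

section \<open>Minimum principle\<close>

text \<open>Comparison with points on the right only, so that a minimum located at the core
  \<open>r = 0\<close> is covered as well.\<close>

lemma second_derivative_right_min:
  fixes F :: "real \<Rightarrow> real"
  assumes "d > 0" and F: "\<And>y. y \<in> {x..<x+d} \<Longrightarrow> (F has_real_derivative F' y) (at y)"
    and "F' x = 0" and F2: "(F' has_real_derivative F2) (at x)"
    and min: "\<And>y. y \<in> {x..<x+d} \<Longrightarrow> F x \<le> F y"
  shows "F2 \<ge> 0"
proof (rule ccontr)
  assume "\<not> F2 \<ge> 0"
  then obtain e where e: "e > 0" "\<And>k. k > 0 \<Longrightarrow> k < e \<Longrightarrow> F' (x + k) < 0"
    using DERIV_neg_dec_right[OF F2] \<open>F' x = 0\<close> by auto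
  define k where "k = min d e / 2"
  have k: "k > 0" "k < d" "k < e" using e \<open>d > 0\<close> by (auto simp: k_def min_def)
  have "\<exists>y>x. y < x + k \<and> F (x + k) - F x = (x + k - x) * F' y"
    using k F by (intro MVT2) auto
  then obtain y where y: "x < y" "y < x + k" "F (x + k) - F x = k * F' y" by auto
  have "F' y < 0" using e(2)[of "y - x"] y k by simp
  then have "F (x + k) < F x" using y mult_pos_neg[OF k(1), of "F' y"] by simp
  then show False using min[of "x + k"] k by simp
qed

context rotational_family
begin

lemma tendsto_core:
  assumes "smooth_on V \<phi>" "t \<in> {0..<T}"
  shows "((\<lambda>\<rho>. \<phi> (\<rho>, t)) \<longlongrightarrow> \<phi> (0, t)) (at_right 0)"
proof -
  have "(0, t) \<in> V" using strip_in_V assms(2) by simp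
  then have "isCont (\<lambda>\<rho>. \<phi> (\<rho>, t)) 0"
    by (intro DERIV_isCont[OF smooth_on_DERIV_dr[OF V(1) assms(1)]])
  then have "((\<lambda>\<rho>. \<phi> (\<rho>, t)) \<longlongrightarrow> \<phi> (0, t)) (at 0)" by (rule isContD)
  then show ?thesis by (rule filterlim_at_split[THEN iffD1, THEN conjunct2])
qed

text \<open>The drift coefficient of the evolution equations has a pole on the core, of the form
  \<open>c\<^sub>2 / r\<close>; there the drift term tends to \<open>c\<^sub>2\<close> times the second derivative.\<close>

lemma dt_at_spatial_min:
  assumes t: "t \<in> {0..<T}" and r: "r \<in> {0..<1}" and \<phi>: "smooth_on V \<phi>"
    and c: "smooth_on V c1" "smooth_on V c2"
    and q: "q = (\<lambda>p. dr \<phi> p / hh p)"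
    and evol: "\<And>\<rho>. \<rho> \<in> {0<..<1} \<Longrightarrow> dt \<phi> (\<rho>, t) = al (\<rho>, t) * dr q (\<rho>, t) / hh (\<rho>, t)
        + (c1 (\<rho>, t) + c2 (\<rho>, t) / \<rho>) * q (\<rho>, t) + k \<rho> * \<phi> (\<rho>, t)"
    and k: "\<And>\<rho>. \<rho> \<in> {0<..<1} \<Longrightarrow> k \<rho> \<ge> - K"
    and al: "al (r, t) \<ge> 0" and c2: "c2 (0, t) \<ge> 0" and core: "dr \<phi> (0, t) = 0"
    and pos: "\<phi> (r, t) > 0" and min: "\<And>\<rho>. \<rho> \<in> {0..1} \<Longrightarrow> \<phi> (r, t) \<le> \<phi> (\<rho>, t)"
  shows "dt \<phi> (r, t) \<ge> - K * \<phi> (r, t)"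
proof -
  have p: "(r, t) \<in> V" using strip_in_V t r by auto
  have sq: "smooth_on V q" unfolding q
    by (intro smooth_on_divide smooth_dr_V smooth_V \<phi>) (rule V_nz)
  have dr0: "dr \<phi> (r, t) = 0"
  proof (cases "r = 0")
    case False
    have "dist r y < min r (1 - r) \<Longrightarrow> y \<in> {0..1}" for y by (auto simp: dist_real_def)
    then show ?thesis
      using r False min
      by (intro DERIV_local_min[OF smooth_on_DERIV_dr[OF V(1) \<phi> p], of "min r (1 - r)"])
         (auto simp: dist_real_def)
  qed (use core in simp)
  have "dr (dr \<phi>) (r, t) \<ge> 0"
    by (rule second_derivative_right_min[of "1 - r" r "\<lambda>x. \<phi> (x, t)" "\<lambda>x. dr \<phi> (x, t)"])
       (use r dr0 min strip_in_V[OF _ t] in \<open>auto intro!: smooth_on_DERIV_dr[OF V(1)] \<phi> smooth_dr_V\<close>)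
  \<comment> \<open>At a critical point the term containing \<open>h_r\<close> drops out, since it
    carries the factor \<open>dr \<phi> = 0\<close>.\<close>
  moreover have "((\<lambda>x. q (x, t)) has_real_derivative dr (dr \<phi>) (r, t) / hh (r, t)) (at r)"
    unfolding q
    by (rule derivative_eq_intros smooth_on_DERIV_dr[OF V(1) _ p] \<phi> smooth_dr_V smooth_V refl
        | use V_nz[OF p] in simp)+
       (use V_nz[OF p] dr0 in \<open>simp add: field_simps\<close>)
  then have "dr q (r, t) = dr (dr \<phi>) (r, t) / hh (r, t)"
    by (simp add: dr_def DERIV_imp_deriv)
  ultimately have drq: "dr q (r, t) \<ge> 0" using V_pos(3)[OF p] by simp
  have q0: "q (r, t) = 0" using dr0 by (simp add: q)
  show ?thesis
  proof (cases "r = 0")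
    case False
    have "dt \<phi> (r, t) = al (r, t) * dr q (r, t) / hh (r, t) + k r * \<phi> (r, t)"
      using evol[of r] False r q0 by simp
    moreover have "al (r, t) * dr q (r, t) / hh (r, t) \<ge> 0" using al drq V_pos(3)[OF p] by simp
    moreover have "k r * \<phi> (r, t) \<ge> - K * \<phi> (r, t)" using k[of r] False r pos by (intro mult_right_mono) auto
    ultimately show ?thesis by linarith
  next
    case True
    \<comment> \<open>The evolution equation with everything but the reaction moved to one side: it
      equals \<open>(k \<rho> + K) \<phi>\<close>, hence is nonnegative near the core. Its limit
      exists because \<open>q\<close> vanishes at 0, which makes \<open>q / \<rho>\<close> a
      difference quotient.\<close>
    let ?E = "\<lambda>\<rho>. dt \<phi> (\<rho>, t) - al (\<rho>, t) * dr q (\<rho>, t) / hh (\<rho>, t) - c1 (\<rho>, t) * q (\<rho>, t)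
      - c2 (\<rho>, t) * (q (\<rho>, t) / \<rho>) + K * \<phi> (\<rho>, t)"
    have p0: "(0, t) \<in> V" using p True by simp
    have "((\<lambda>\<rho>. q (\<rho>, t) / \<rho>) \<longlongrightarrow> dr q (0, t)) (at 0)"
      using smooth_on_DERIV_dr[OF V(1) sq p0] q0 True unfolding DERIV_def by simp
    then have "((\<lambda>\<rho>. q (\<rho>, t) / \<rho>) \<longlongrightarrow> dr q (0, t)) (at_right 0)"
      by (rule filterlim_at_split[THEN iffD1, THEN conjunct2])
    then have "(?E \<longlongrightarrow> dt \<phi> (0, t) - al (0, t) * dr q (0, t) / hh (0, t) - c1 (0, t) * q (0, t)
      - c2 (0, t) * dr q (0, t) + K * \<phi> (0, t)) (at_right 0)"
      using V_nz(3)[OF p0]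
      by (intro tendsto_intros tendsto_core[OF _ t] smooth_on_dt[OF V(1)] smooth_dr_V \<phi> sq c smooth_curv smooth_V)
    moreover have "\<forall>\<^sub>F \<rho> in at_right 0. 0 \<le> ?E \<rho>"
    proof -
      have "\<forall>\<^sub>F \<rho> in at_right (0::real). \<rho> \<in> {0<..<1}"
        by (rule eventually_at_right_real) simp
      then show ?thesis
      proof eventually_elim
        case (elim \<rho>)
        have "\<phi> (\<rho>, t) > 0" using pos min[of \<rho>] elim by force
        then have "(k \<rho> + K) * \<phi> (\<rho>, t) \<ge> 0" using k[OF elim] by simp
        moreover have "?E \<rho> = (k \<rho> + K) * \<phi> (\<rho>, t)"
          unfolding evol[OF elim] by (simp add: algebra_simps)
        ultimately show ?case by (simp only:)
      qed
    qed
    ultimately have "0 \<le> dt \<phi> (0, t) - al (0, t) * dr q (0, t) / hh (0, t) - c1 (0, t) * q (0, t)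
      - c2 (0, t) * dr q (0, t) + K * \<phi> (0, t)"
      by (rule tendsto_lowerbound) simp
    moreover have "al (0, t) * dr q (0, t) / hh (0, t) \<ge> 0" "c2 (0, t) * dr q (0, t) \<ge> 0"
      using al drq V_pos(3)[OF p] c2 True by auto
    ultimately show ?thesis using q0 True by simp
  qed
qed

lemma bounded_strip:
  assumes "smooth_on V \<phi>" "t2 \<in> {0..<T}"
  shows "\<exists>M\<ge>0. \<forall>r\<in>{0..1}. \<forall>t\<in>{0..t2}. \<bar>\<phi> (r, t)\<bar> \<le> M"
proof -
  have "{0..1} \<times> {0..t2} \<subseteq> V" using V(3) assms(2) by force
  then have "compact (\<phi> ` ({0..1} \<times> {0..t2}))"
    using continuous_on_subset[OF smooth_on_continuous[OF V(1) assms(1)]]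
    by (intro compact_continuous_image compact_Times) auto
  then obtain M where "\<forall>x\<in>\<phi> ` ({0..1} \<times> {0..t2}). norm x \<le> M"
    using compact_imp_bounded bounded_iff by blast
  then show ?thesis by (intro exI[of _ "max M 0"]) force
qed

text \<open>\<open>\<alpha> - \<beta>\<close> vanishes to second order on the core, which compensates the pole of \<open>a\<^sup>2\<close>.\<close>

lemma reaction_bound:
  assumes t2: "t2 \<in> {0..<T}"
  obtains K where "K \<ge> 0"
    "\<And>r t. r \<in> {0<..<1} \<Longrightarrow> t \<in> {0..t2} \<Longrightarrow>
      2 * (b (r, t))\<^sup>2 * (al (r, t) - ga (r, t)) - 2 * al (r, t) * be (r, t) \<ge> - K"
    "\<And>r t. r \<in> {0<..<1} \<Longrightarrow> t \<in> {0..t2} \<Longrightarrow>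
      2 * (a (r, t))\<^sup>2 * (al (r, t) - be (r, t)) - 2 * al (r, t) * ga (r, t) \<ge> - K"
proof -
  define \<phi> where "\<phi> = (\<lambda>p. al p - be p)"
  \<comment> \<open>Off the core this is \<open>r a\<close>, the pole of \<open>a\<close>
    removed.\<close>
  define \<psi> where "\<psi> = (\<lambda>p. dr ff p / (F p * hh p))"
  have s\<phi>: "smooth_on V \<phi>" unfolding \<phi>_def by (intro smooth_on_diff smooth_curv)
  have s\<psi>: "smooth_on V \<psi>" unfolding \<psi>_def
    by (intro smooth_on_divide smooth_on_mult smooth_V smooth_dr_V) (simp add: V_nz)
  have "smooth_on V (\<lambda>p. 2 * (b p)\<^sup>2 * (al p - ga p) - 2 * al p * be p)"
    by (intro smooth_on_intros smooth_b smooth_curv)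
  from bounded_strip[OF this t2] obtain K1 where K1: "K1 \<ge> 0" "\<forall>r\<in>{0..1}. \<forall>t\<in>{0..t2}.
      \<bar>2 * (b (r, t))\<^sup>2 * (al (r, t) - ga (r, t)) - 2 * al (r, t) * be (r, t)\<bar> \<le> K1"
    by blast
  obtain M1 where M1: "M1 \<ge> 0" "\<forall>r\<in>{0..1}. \<forall>t\<in>{0..t2}. \<bar>dr (dr \<phi>) (r, t)\<bar> \<le> M1"
    using bounded_strip[OF smooth_dr_V[OF smooth_dr_V[OF s\<phi>]] t2] by blast
  obtain M2 where M2: "M2 \<ge> 0" "\<forall>r\<in>{0..1}. \<forall>t\<in>{0..t2}. \<bar>(\<psi> (r, t))\<^sup>2\<bar> \<le> M2"
    using bounded_strip[OF smooth_on_power[OF s\<psi>, of 2] t2] by blast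
  have "smooth_on V (\<lambda>p. 2 * al p * ga p)" by (intro smooth_on_intros smooth_curv)
  from bounded_strip[OF this t2] obtain M3 where M3: "M3 \<ge> 0" "\<forall>r\<in>{0..1}. \<forall>t\<in>{0..t2}. \<bar>2 * al (r, t) * ga (r, t)\<bar> \<le> M3"
    by blast
  \<comment> \<open>Second-order Taylor estimate by two mean value theorems: \<open>\<phi>\<close>
    vanishes at the core by \<open>core_al_be\<close>, and its first derivative vanishes by
    evenness.\<close>
  have taylor: "\<bar>\<phi> (r, t)\<bar> \<le> r\<^sup>2 * M1" if r: "r \<in> {0<..<1}" and t: "t \<in> {0..t2}" for r t
  proof -
    have tT: "t \<in> {0..<T}" using t t2 by auto
    have D: "\<And>x. 0 \<le> x \<Longrightarrow> x \<le> r \<Longrightarrow> ((\<lambda>x. \<phi> (x, t)) has_real_derivative dr \<phi> (x, t)) (at x)"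
      "\<And>x. 0 \<le> x \<Longrightarrow> x \<le> r \<Longrightarrow> ((\<lambda>x. dr \<phi> (x, t)) has_real_derivative dr (dr \<phi>) (x, t)) (at x)"
      using strip_in_V[OF _ tT] r s\<phi> smooth_dr_V by (auto intro!: smooth_on_DERIV_dr[OF V(1)])
    have "\<exists>y>0. y < r \<and> \<phi> (r, t) - \<phi> (0, t) = (r - 0) * dr \<phi> (y, t)"
      using r by (intro MVT2 D) auto
    then obtain y where y: "0 < y" "y < r" "\<phi> (r, t) - \<phi> (0, t) = r * dr \<phi> (y, t)" by auto
    have "\<exists>x>0. x < y \<and> dr \<phi> (y, t) - dr \<phi> (0, t) = (y - 0) * dr (dr \<phi>) (x, t)"
      using y r by (intro MVT2 D) auto
    then obtain x where x: "0 < x" "x < y" "dr \<phi> (y, t) - dr \<phi> (0, t) = y * dr (dr \<phi>) (x, t)" by auto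
    have "((\<lambda>x. \<phi> (x, t)) has_real_derivative dr al (0, t) - dr be (0, t)) (at 0)"
      unfolding \<phi>_def
      by (intro DERIV_diff smooth_on_DERIV_dr[OF V(1)] smooth_curv strip_in_V tT) auto
    then have "dr \<phi> (0, t) = 0" using dr_curv_core[OF tT] by (simp add: dr_def DERIV_imp_deriv)
    moreover have "\<phi> (0, t) = 0" using core_al_be[OF tT] by (simp add: \<phi>_def)
    ultimately have "\<phi> (r, t) = r * (y * dr (dr \<phi>) (x, t))" using x y by simp
    then have "\<bar>\<phi> (r, t)\<bar> = (r * y) * \<bar>dr (dr \<phi>) (x, t)\<bar>" using r y by (simp add: abs_mult)
    also have "\<dots> \<le> (r * r) * M1"
      using r y x t M1(1) M1(2)[rule_format, of x t] by (intro mult_mono) auto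
    finally show ?thesis by (simp add: power2_eq_square)
  qed
  show thesis
  proof (rule that[of "max K1 (2 * (M2 * M1) + M3)"])
    fix r t :: real assume r: "r \<in> {0<..<1}" and t: "t \<in> {0..t2}"
    show "2 * (b (r, t))\<^sup>2 * (al (r, t) - ga (r, t)) - 2 * al (r, t) * be (r, t) \<ge> - max K1 (2 * (M2 * M1) + M3)"
      using K1(2)[rule_format, of r t] r t by (auto simp: abs_le_iff)
    have tT: "t \<in> {0..<T}" using t t2 by auto
    have p: "(r, t) \<in> V" using strip_in_V[OF _ tT] r by auto
    have "a (r, t) = \<psi> (r, t) / r"
      using quotient_mult(1)[of r t] p V(2) tT by (auto simp: a_def \<psi>_def)
    then have "(a (r, t))\<^sup>2 * \<bar>\<phi> (r, t)\<bar> = (\<psi> (r, t))\<^sup>2 * (\<bar>\<phi> (r, t)\<bar> / r\<^sup>2)"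
      by (simp add: power_divide)
    also have "\<dots> \<le> M2 * M1"
      using taylor[OF r t] M2(2)[rule_format, of r t] M2(1) M1(1) r t
      by (intro mult_mono) (auto simp: divide_le_eq mult.commute)
    finally have "\<bar>2 * (a (r, t))\<^sup>2 * \<phi> (r, t)\<bar> \<le> 2 * (M2 * M1)" by (simp add: abs_mult)
    moreover have "\<bar>2 * al (r, t) * ga (r, t)\<bar> \<le> M3" using M3(2)[rule_format, of r t] r t by auto
    ultimately show "2 * (a (r, t))\<^sup>2 * (al (r, t) - be (r, t)) - 2 * al (r, t) * ga (r, t) \<ge> - max K1 (2 * (M2 * M1) + M3)"
      unfolding \<phi>_def by linarith
  qed (use K1 in auto)
qed

end

section \<open>Consequences of the flow, boundary and initial conditions\<close>

locale torus_flow = rotational_family +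
  fixes \<theta> :: real
  assumes flow: "cross_curvature_flow T (rot_metric f g h)"
    and bc: "boundary_conditions T f g h"
    and initial: "initial_conditions \<theta> f g h"
begin

lemma dt_metric:
  assumes r: "r \<in> {0<..1}" and t: "t \<in> {0..<T}"
  shows "dt ff (r, t) = al (r, t) * ga (r, t) * ff (r, t)"
    "dt gg (r, t) = al (r, t) * be (r, t) * gg (r, t)"
    "dt hh (r, t) = be (r, t) * ga (r, t) * hh (r, t)"
proof -
  define x :: "real^3" where "x = vector [0, 0, r]"
  have x: "x \<in> chart" "x$3 = r" using r by (auto simp: chart_def x_def)
  have p: "(r, t) \<in> V" using strip_in_V t r by auto
  have *: "dt \<phi> (r, t) = k * \<phi> (r, t)"
    if "smooth_on V \<phi>" "\<phi> (r, t) \<noteq> 0"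
      and m: "\<And>\<tau>. rot_metric f g h \<tau> x $ i $ i = (\<phi> (r, \<tau>))\<^sup>2"
      and X: "cross_curv (rot_metric f g h t) x $ i $ i = - k * (\<phi> (r, t))\<^sup>2" for \<phi> i k
  proof -
    have "((\<lambda>\<tau>. (\<phi> (r, \<tau>))\<^sup>2) has_real_derivative - 2 * (- k * (\<phi> (r, t))\<^sup>2)) (at t within {0..<T})"
      using flow[unfolded cross_curvature_flow_def, rule_format, OF t x(1), of i i] unfolding m X .
    moreover have "((\<lambda>\<tau>. (\<phi> (r, \<tau>))\<^sup>2) has_real_derivative 2 * \<phi> (r, t) * dt \<phi> (r, t)) (at t within {0..<T})"
      by (rule has_field_derivative_at_within)
         (auto intro!: derivative_eq_intros smooth_on_DERIV_dt[OF V(1) that(1) p])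
    ultimately have "2 * \<phi> (r, t) * dt \<phi> (r, t) = - 2 * (- k * (\<phi> (r, t))\<^sup>2)"
      using real_derivative_within_Ico_unique[OF t] by blast
    then have "2 * \<phi> (r, t) * dt \<phi> (r, t) = 2 * \<phi> (r, t) * (k * \<phi> (r, t))"
      by (simp add: power2_eq_square)
    then show ?thesis using that(2) by simp
  qed
  have nz: "ff (r, t) \<noteq> 0" "gg (r, t) \<noteq> 0" "hh (r, t) \<noteq> 0" using V_nz[OF p] ff_pos[OF p _ t] r by auto
  have m: "rot_metric f g h \<tau> x $ 1 $ 1 = (ff (r, \<tau>))\<^sup>2" "rot_metric f g h \<tau> x $ 2 $ 2 = (gg (r, \<tau>))\<^sup>2"
    "rot_metric f g h \<tau> x $ 3 $ 3 = (hh (r, \<tau>))\<^sup>2" for \<tau>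
    by (simp_all add: rot_metric_diag3 x ff_def gg_def hh_def)
  show "dt ff (r, t) = al (r, t) * ga (r, t) * ff (r, t)"
    "dt gg (r, t) = al (r, t) * be (r, t) * gg (r, t)"
    "dt hh (r, t) = be (r, t) * ga (r, t) * hh (r, t)"
    using *[OF smooth_V(1) nz(1) m(1) curvature(1)[OF r t x(2)]]
      *[OF smooth_V(2) nz(2) m(2) curvature(2)[OF r t x(2)]]
      *[OF smooth_V(3) nz(3) m(3) curvature(3)[OF r t x(2)]] by simp_all
qed

text \<open>On the boundary torus \<open>f\<close>, \<open>g\<close>, \<open>h\<close> all have
  logarithmic time derivative \<open>1 / (1 + 4 t)\<close>. By the flow these are the pairwise
  products of the curvatures, so the curvatures agree. Only the square of \<alpha> is determined;
  its sign is settled in \<open>boundary_pos\<close>.\<close>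

lemma boundary_curv:
  assumes t: "t \<in> {0..<T}"
  shows "(al (1, t))\<^sup>2 = 1 / (1 + 4 * t)" "be (1, t) = al (1, t)" "ga (1, t) = al (1, t)"
proof -
  have p: "(1, t) \<in> V" if "t \<in> {0..<T}" for t using strip_in_V that by auto
  have *: "dt \<phi> (1, t) = \<phi> (1, t) / (1 + 4 * t)"
    if "smooth_on V \<phi>" and \<phi>: "\<And>\<tau>. \<tau> \<in> {0..<T} \<Longrightarrow> \<phi> (1, \<tau>) = k * (1 + 4 * \<tau>) powr (1 / 4)" for \<phi> k
  proof -
    have t4: "1 + 4 * t > 0" using t by simp
    have "(1 + 4 * t) powr (- (3 / 4)) = (1 + 4 * t) powr (1 / 4) / (1 + 4 * t)"
      using powr_diff[of "1 + 4 * t" "1 / 4" 1] t4 by simp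
    then have "((\<lambda>\<tau>. k * (1 + 4 * \<tau>) powr (1 / 4)) has_real_derivative k * (1 + 4 * t) powr (1 / 4) / (1 + 4 * t)) (at t)"
      using t4 by (auto intro!: derivative_eq_intros simp: field_simps)
    then have "((\<lambda>\<tau>. \<phi> (1, \<tau>)) has_real_derivative \<phi> (1, t) / (1 + 4 * t)) (at t within {0..<T})"
      unfolding \<phi>[OF t]
      by (intro has_field_derivative_transform_within[OF has_field_derivative_at_within zero_less_one t])
         (simp_all add: \<phi>)
    then show ?thesis
      using real_derivative_within_Ico_unique[OF t] smooth_on_DERIV_dt[OF V(1) that(1) p[OF t]]
        has_field_derivative_at_within by blast
  qed
  have pos: "ff (1, \<tau>) > 0" "gg (1, \<tau>) > 0" "hh (1, \<tau>) > 0" if "\<tau> \<in> {0..<T}" for \<tau>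
    using V_pos[OF p[OF that]] ff_pos[OF p[OF that] _ that] by auto
  have eqs: "ff (1, \<tau>) = ff (1, 0) * (1 + 4 * \<tau>) powr (1 / 4)" "gg (1, \<tau>) = gg (1, 0) * (1 + 4 * \<tau>) powr (1 / 4)"
    "hh (1, \<tau>) = 1 * (1 + 4 * \<tau>) powr (1 / 4)" if \<tau>: "\<tau> \<in> {0..<T}" for \<tau>
  proof -
    have "ln (ff (1, \<tau>)) = ln (ff (1, 0) * (1 + 4 * \<tau>) powr (1 / 4))"
      "ln (gg (1, \<tau>)) = ln (gg (1, 0) * (1 + 4 * \<tau>) powr (1 / 4))"
      "ln (hh (1, \<tau>)) = ln ((1 + 4 * \<tau>) powr (1 / 4))"
      using bc \<tau> unfolding boundary_conditions_def by (auto simp: ff_def gg_def hh_def)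
    then show "ff (1, \<tau>) = ff (1, 0) * (1 + 4 * \<tau>) powr (1 / 4)" "gg (1, \<tau>) = gg (1, 0) * (1 + 4 * \<tau>) powr (1 / 4)"
      "hh (1, \<tau>) = 1 * (1 + 4 * \<tau>) powr (1 / 4)"
      using pos[OF \<tau>] pos[of 0] T \<tau> ln_inj_iff[of "hh (1, \<tau>)" "(1 + 4 * \<tau>) powr (1 / 4)"]
      by (auto simp: ln_inj_iff simp del: ln_powr)
  qed
  define k where "k = 1 / (1 + 4 * t)"
  have k: "k > 0" using t by (simp add: k_def)
  have prods: "al (1, t) * ga (1, t) = k" "al (1, t) * be (1, t) = k" "be (1, t) * ga (1, t) = k"
  proof -
    have cancel: "c = k" if "c * \<phi> = \<phi> / (1 + 4 * t)" "\<phi> > 0" for c \<phi> :: real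
    proof -
      have "c * \<phi> = k * \<phi>" using that(1) by (simp add: k_def)
      then show ?thesis using that(2) by simp
    qed
    show "al (1, t) * ga (1, t) = k" "al (1, t) * be (1, t) = k" "be (1, t) * ga (1, t) = k"
      using *[OF smooth_V(1) eqs(1)] *[OF smooth_V(2) eqs(2)] *[OF smooth_V(3) eqs(3)]
        dt_metric[of 1 t] t cancel[OF _ pos(1)[OF t]] cancel[OF _ pos(2)[OF t]] cancel[OF _ pos(3)[OF t]]
      by auto
  qed
  then have nz: "al (1, t) \<noteq> 0" "ga (1, t) \<noteq> 0" using k by auto
  have 1: "be (1, t) = ga (1, t)" using prods(1,2) nz(1) by (metis mult_left_cancel)
  have "al (1, t) * ga (1, t) = be (1, t) * ga (1, t)" using prods by simp
  then have 2: "al (1, t) = be (1, t)" using nz(2) by simp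
  show "(al (1, t))\<^sup>2 = 1 / (1 + 4 * t)" using prods(2) 2 by (simp add: power2_eq_square k_def)
  show "be (1, t) = al (1, t)" "ga (1, t) = al (1, t)" using 1 2 by auto
qed

lemma initial_pos:
  assumes r: "r \<in> {0..1}"
  shows "al (r, 0) > 0 \<and> be (r, 0) > 0 \<and> ga (r, 0) > 0"
proof -
  have T0: "0 \<in> {0..<T}" using T by simp
  have neg: "sec_curv (rot_metric f g h 0) x (axis i 1) (axis j 1) < 0"
    if "x \<in> chart" "i \<noteq> j" for x and i j :: 3
  proof -
    have "{axis i (1::real), axis j 1} \<subseteq> Basis" by (simp add: axis_in_Basis_iff)
    then have "independent {axis i (1::real), axis j 1}" using independent_Basis independent_mono by blast
    moreover have "axis i (1::real) \<noteq> axis j 1" using that(2) by (simp add: axis_eq_axis)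
    ultimately show ?thesis using initial that(1) unfolding initial_conditions_def by blast
  qed
  have pos: "al (r, 0) > 0 \<and> be (r, 0) > 0 \<and> ga (r, 0) > 0" if r: "r \<in> {0<..1}" for r
  proof -
    define x :: "real^3" where "x = vector [0, 0, r]"
    have x: "x \<in> chart" "x$3 = r" using r by (auto simp: chart_def x_def)
    show ?thesis
      using neg[OF x(1), of 1 2] neg[OF x(1), of 2 3] neg[OF x(1), of 1 3] curvature(6-8)[OF r T0 x(2)] by simp
  qed
  show ?thesis
  proof (cases "r = 0")
    case True
    \<comment> \<open>The chart omits the core, where the initial condition speaks of limits;
      continuity of the regularized curvatures turns these into values.\<close>
    obtain \<kappa> where \<kappa>: "\<kappa> > 0" "(sec_alpha (rot_metric f g h 0) \<longlongrightarrow> \<kappa>) (at_right 0)"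
      "(sec_beta (rot_metric f g h 0) \<longlongrightarrow> \<kappa>) (at_right 0)" "(sec_gamma (rot_metric f g h 0) \<longlongrightarrow> \<kappa>) (at_right 0)"
      using initial unfolding initial_conditions_def by blast
    have "\<forall>\<^sub>F \<rho> in at_right (0::real). \<rho> \<in> {0<..<1}"
      by (rule eventually_at_right_real) simp
    then have ev: "\<forall>\<^sub>F \<rho> in at_right (0::real). sec_alpha (rot_metric f g h 0) \<rho> = al (\<rho>, 0)"
      "\<forall>\<^sub>F \<rho> in at_right (0::real). sec_beta (rot_metric f g h 0) \<rho> = be (\<rho>, 0)"
      "\<forall>\<^sub>F \<rho> in at_right (0::real). sec_gamma (rot_metric f g h 0) \<rho> = ga (\<rho>, 0)"
      using curvature(6-8)[OF _ T0, of \<rho> "vector [0, 0, \<rho>]" for \<rho>]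
      by (auto elim!: eventually_mono simp: sec_alpha_def sec_beta_def sec_gamma_def)
    have lim: "\<phi> (0, 0) = \<kappa>" if "smooth_on V \<phi>" "(\<psi> \<longlongrightarrow> \<kappa>) (at_right 0)"
      "\<forall>\<^sub>F \<rho> in at_right (0::real). \<psi> \<rho> = \<phi> (\<rho>, 0)" for \<phi> \<psi>
    proof (rule tendsto_unique[OF _ tendsto_core[OF that(1) T0]])
      show "((\<lambda>\<rho>. \<phi> (\<rho>, 0)) \<longlongrightarrow> \<kappa>) (at_right 0)"
        using tendsto_cong[OF that(3)] that(2) by simp
    qed simp
    show ?thesis using lim[OF smooth_curv(1) \<kappa>(2) ev(1)] lim[OF smooth_curv(2) \<kappa>(3) ev(2)]
        lim[OF smooth_curv(3) \<kappa>(4) ev(3)] \<kappa>(1) True by simp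
  qed (use pos[of r] r in auto)
qed

text \<open>The square of \<alpha> never vanishes on the boundary torus, so \<alpha> cannot change
  sign there, and it is positive at \<open>t = 0\<close>.\<close>

lemma boundary_pos:
  assumes t: "t \<in> {0..<T}"
  shows "al (1, t) > 0"
proof (rule ccontr)
  assume "\<not> al (1, t) > 0"
  moreover have "continuous_on {0..t} (\<lambda>t. al (1, t))"
    using strip_in_V[of 1] t
    by (intro continuous_at_imp_continuous_on ballI DERIV_isCont[OF smooth_on_DERIV_dt[OF V(1) smooth_curv(1)]]) auto
  ultimately obtain \<tau> where "0 \<le> \<tau>" "\<tau> \<le> t" "al (1, \<tau>) = 0"
    using IVT2'[of "\<lambda>t. al (1, t)" t 0 0] initial_pos[of 1] t by force
  then show False using boundary_curv(1)[of \<tau>] t by auto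
qed

text \<open>Commuting mixed partials needs the flow equations on an open set, which excludes
  \<open>t = 0\<close> and the boundary torus; the core is excluded because of the pole of
  \<open>a\<close>.\<close>

definition W where "W = {0<..<1::real} \<times> {0<..<T}"

lemma W_V: "W \<subseteq> V" using V(3) by (force simp: W_def)

sublocale region: cross_flow_region W ff gg hh a b al be ga
proof
  note W_V[THEN subsetD]
  show "open W" unfolding W_def by (intro open_Times) auto
  have ffnz: "ff p > 0" if "p \<in> W" for p
    using ff_pos[of "fst p" "snd p"] that W_V by (auto simp: W_def)
  show s: "smooth_on W ff" "smooth_on W gg" "smooth_on W hh" "smooth_on W b" "smooth_on W al" "smooth_on W be" "smooth_on W ga"
    using smooth_V smooth_b smooth_curv smooth_on_subset[OF _ W_V] by blast+
  show "smooth_on W a"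
    unfolding a_def[abs_def]
    by (intro smooth_on_divide smooth_on_mult s smooth_on_subset[OF smooth_dr_V[OF smooth_V(1)] W_V])
       (use ffnz V_nz W_V in force)
  fix p assume p: "p \<in> W"
  obtain x t where xt: "p = (x, t)" by (cases p)
  have xt': "(x, t) \<in> V" "x > 0" "x \<in> {0<..1}" "t \<in> {0..<T}" using p W_V xt by (auto simp: W_def)
  show pos: "ff p > 0 \<and> gg p > 0 \<and> hh p > 0" using ffnz[OF p] V_pos xt' xt by simp
  show "dr ff p = a p * ff p * hh p" "dr gg p = b p * gg p * hh p"
    using pos by (simp_all add: a_def b_def)
  show "dr a p = hh p * (ga p - (a p)\<^sup>2)" "dr b p = hh p * (be p - (b p)\<^sup>2)"
    using DERIV_imp_deriv[OF DERIV_a[OF xt'(1,2,4)]] DERIV_imp_deriv[OF DERIV_b[OF xt'(1,2,4)]]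
    by (simp_all add: dr_def xt)
  show "al p = a p * b p" using al_eq[OF xt'(1,2,4)] xt by simp
  show "dt ff p = al p * ga p * ff p" "dt gg p = al p * be p * gg p" "dt hh p = be p * ga p * hh p"
    using dt_metric[OF xt'(3,4)] xt by auto
qed

end

section \<open>Positivity of the curvatures along the flow\<close>

context torus_flow
begin

lemma psi_smooth: "smooth_on V (\<lambda>p. dr ff p / (F p * hh p))"
  by (intro smooth_on_divide smooth_on_mult smooth_V smooth_dr_V) (simp add: V_nz)

lemma a_eq: "(\<rho>, t) \<in> W \<Longrightarrow> a (\<rho>, t) = dr ff (\<rho>, t) / (F (\<rho>, t) * hh (\<rho>, t)) / \<rho>"
  using quotient_mult(1)[OF subsetD[OF V(2) subsetD[OF W_V]], of \<rho> t] by (simp add: a_def W_def mult_ac)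

text \<open>The singular part of the drift is \<open>a \<beta>\<close>, so the residue
  \<open>c2\<close> is \<open>(r a) \<beta>\<close>; at the core \<open>r a\<close> becomes
  \<open>1 / h\<close>, and \<open>\<beta> \<ge> 0\<close> gives the required sign.\<close>

lemma dt_ga_at_min:
  assumes t: "t \<in> {0<..<T}" and r: "r \<in> {0..<1}"
    and K: "\<And>\<rho>. \<rho> \<in> {0<..<1} \<Longrightarrow>
      2 * (b (\<rho>, t))\<^sup>2 * (al (\<rho>, t) - ga (\<rho>, t)) - 2 * al (\<rho>, t) * be (\<rho>, t) \<ge> - K"
    and nonneg: "al (r, t) \<ge> 0" "be (0, t) \<ge> 0"
    and min: "ga (r, t) > 0" "\<And>\<rho>. \<rho> \<in> {0..1} \<Longrightarrow> ga (r, t) \<le> ga (\<rho>, t)"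
  shows "dt ga (r, t) \<ge> - K * ga (r, t)"
proof -
  have tT: "t \<in> {0..<T}" using t by simp
  have zq: "region.z = (\<lambda>p. dr ga p / hh p)" by (simp add: region.z_def fun_eq_iff)
  show ?thesis
  proof (rule dt_at_spatial_min[OF tT r smooth_curv(3) _ _ zq _ K nonneg(1) _ dr_curv_core(3)[OF tT] min])
    show "smooth_on V (\<lambda>p. 3 * b p * ga p - 2 * b p * al p)"
      by (intro smooth_on_intros smooth_b smooth_curv)
    show "smooth_on V (\<lambda>p. dr ff p / (F p * hh p) * be p)"
      by (intro smooth_on_mult psi_smooth smooth_curv)
    have p: "(0, t) \<in> V" using strip_in_V tT by simp
    show "0 \<le> dr ff (0, t) / (F (0, t) * hh (0, t)) * be (0, t)"
      using V_pos[OF p] nonneg(2) by (simp add: F_def radial_quotient_core)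
    fix \<rho> :: real assume \<rho>: "\<rho> \<in> {0<..<1}"
    then have W: "(\<rho>, t) \<in> W" using t by (simp add: W_def)
    show "dt ga (\<rho>, t) = al (\<rho>, t) * dr region.z (\<rho>, t) / hh (\<rho>, t)
        + (3 * b (\<rho>, t) * ga (\<rho>, t) - 2 * b (\<rho>, t) * al (\<rho>, t)
           + dr ff (\<rho>, t) / (F (\<rho>, t) * hh (\<rho>, t)) * be (\<rho>, t) / \<rho>) * region.z (\<rho>, t)
        + (2 * (b (\<rho>, t))\<^sup>2 * (al (\<rho>, t) - ga (\<rho>, t)) - 2 * al (\<rho>, t) * be (\<rho>, t)) * ga (\<rho>, t)"
      unfolding region.dt_C[OF W] a_eq[OF W] by (simp add: algebra_simps)
  qed assumption
qed

text \<open>Here the singular drift is \<open>a (3 \<beta> - 2 \<alpha>)\<close>, whose sign is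
  unclear in general. At the core \<alpha> equals \<beta>, which reduces the residue to
  \<open>\<beta> / h\<close>.\<close>

lemma dt_be_at_min:
  assumes t: "t \<in> {0<..<T}" and r: "r \<in> {0..<1}"
    and K: "\<And>\<rho>. \<rho> \<in> {0<..<1} \<Longrightarrow>
      2 * (a (\<rho>, t))\<^sup>2 * (al (\<rho>, t) - be (\<rho>, t)) - 2 * al (\<rho>, t) * ga (\<rho>, t) \<ge> - K"
    and nonneg: "al (r, t) \<ge> 0" "be (0, t) \<ge> 0"
    and min: "be (r, t) > 0" "\<And>\<rho>. \<rho> \<in> {0..1} \<Longrightarrow> be (r, t) \<le> be (\<rho>, t)"
  shows "dt be (r, t) \<ge> - K * be (r, t)"
proof -
  have tT: "t \<in> {0..<T}" using t by simp
  have yq: "region.y = (\<lambda>p. dr be p / hh p)" by (simp add: region.y_def fun_eq_iff)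
  show ?thesis
  proof (rule dt_at_spatial_min[OF tT r smooth_curv(2) _ _ yq _ K nonneg(1) _ dr_curv_core(2)[OF tT] min])
    show "smooth_on V (\<lambda>p. b p * ga p)"
      by (intro smooth_on_intros smooth_b smooth_curv)
    show "smooth_on V (\<lambda>p. dr ff p / (F p * hh p) * (3 * be p - 2 * al p))"
      by (intro smooth_on_mult psi_smooth smooth_curv smooth_on_diff smooth_on_const)
    have p: "(0, t) \<in> V" using strip_in_V tT by simp
    show "0 \<le> dr ff (0, t) / (F (0, t) * hh (0, t)) * (3 * be (0, t) - 2 * al (0, t))"
      using V_pos[OF p] nonneg(2) by (simp add: F_def radial_quotient_core core_al_be[OF tT])
    fix \<rho> :: real assume \<rho>: "\<rho> \<in> {0<..<1}"
    then have W: "(\<rho>, t) \<in> W" using t by (simp add: W_def)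
    have y: "cross_flow_region.z hh be = region.y"
      by (simp add: fun_eq_iff cross_flow_region.z_def[OF region.swap] region.y_def)
    show "dt be (\<rho>, t) = al (\<rho>, t) * dr region.y (\<rho>, t) / hh (\<rho>, t)
        + (b (\<rho>, t) * ga (\<rho>, t)
           + dr ff (\<rho>, t) / (F (\<rho>, t) * hh (\<rho>, t)) * (3 * be (\<rho>, t) - 2 * al (\<rho>, t)) / \<rho>) * region.y (\<rho>, t)
        + (2 * (a (\<rho>, t))\<^sup>2 * (al (\<rho>, t) - be (\<rho>, t)) - 2 * al (\<rho>, t) * ga (\<rho>, t)) * be (\<rho>, t)"
      unfolding cross_flow_region.dt_C[OF region.swap W] y a_eq[OF W] by (simp add: algebra_simps diff_divide_distrib)
  qed assumption
qed

text \<open>Consider the first time at which \<open>e\<^sup>L\<^sup>t min(\<alpha>, \<beta>, \<gamma>)\<close> reaches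
  half of its minimum over the parabolic boundary. By the formula for \<open>\<alpha>\<^sub>s\<close> the minimum is attained by \<open>\<beta>\<close> or \<open>\<gamma>\<close>.\<close>

lemma curv_pos:
  assumes "r \<in> {0..1}" "t \<in> {0..<T}"
  shows "al (r, t) > 0" "be (r, t) > 0" "ga (r, t) > 0"
proof -
  \<comment> \<open>The time is frozen as the end of a compact interval inside
    \<open>[0, T)\<close>, on which the reaction bound and the extrema are available.\<close>
  define t2 where "t2 = t"
  have t2: "t2 \<in> {0..<T}" using assms by (simp add: t2_def)
  obtain K where K: "K \<ge> 0"
    "\<And>r t. r \<in> {0<..<1} \<Longrightarrow> t \<in> {0..t2} \<Longrightarrow>
      2 * (b (r, t))\<^sup>2 * (al (r, t) - ga (r, t)) - 2 * al (r, t) * be (r, t) \<ge> - K"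
    "\<And>r t. r \<in> {0<..<1} \<Longrightarrow> t \<in> {0..t2} \<Longrightarrow>
      2 * (a (r, t))\<^sup>2 * (al (r, t) - be (r, t)) - 2 * al (r, t) * ga (r, t) \<ge> - K"
    using reaction_bound[OF t2] by metis
  \<comment> \<open>One more than the reaction bound, so that \<open>\<phi> e^(L t)\<close> has
    strictly positive time derivative at a positive minimum.\<close>
  define L where "L = K + 1"
  define mu where "mu p = min (al p) (min (be p) (ga p))" for p
  define N where "N p = mu p * exp (L * snd p)" for p
  define D where "D = {0..1::real} \<times> {0..t2}"
  have D: "compact D" "closed D" "D \<subseteq> V"
    using V(3) t2 by (auto simp: D_def intro!: compact_Times closed_Times)
  have cV: "continuous_on V mu"
    unfolding mu_def by (intro continuous_on_min smooth_on_continuous V(1) smooth_curv)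
  have cN: "continuous_on D N"
    unfolding N_def by (intro continuous_intros continuous_on_subset[OF cV D(3)])
  obtain \<delta> where \<delta>: "\<delta> > 0" "\<And>r. r \<in> {0..1} \<Longrightarrow> mu (r, 0) \<ge> \<delta>" "\<And>t. t \<in> {0..t2} \<Longrightarrow> mu (1, t) \<ge> \<delta>"
  proof -
    define B where "B = {0..1::real} \<times> {0::real} \<union> {1} \<times> {0..t2}"
    have "B \<subseteq> D" using t2 by (auto simp: B_def D_def)
    then have "continuous_on B mu" using continuous_on_subset[OF cV] D(3) by blast
    moreover have "compact B" "B \<noteq> {}" by (auto simp: B_def intro!: compact_Un compact_Times)
    ultimately obtain q where q: "q \<in> B" "\<And>p. p \<in> B \<Longrightarrow> mu q \<le> mu p"
      using continuous_attains_inf[of B mu] by blast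
    have "mu q > 0"
      using q(1) t2 initial_pos boundary_pos boundary_curv(2,3) by (auto simp: B_def mu_def)
    then show thesis using q(2) by (intro that[of "mu q"]) (auto simp: B_def)
  qed
  have "N p > \<delta> / 2" if "p \<in> D" for p
  proof (rule ccontr)
    assume "\<not> N p > \<delta> / 2"
    \<comment> \<open>A closed sublevel set in a compact strip, so the earliest time occurring in it
      is attained.\<close>
    define bad where "bad = D \<inter> (D \<inter> N -` {..\<delta>/2})"
    have "compact bad" unfolding bad_def
      by (intro compact_Int_closed D continuous_closed_preimage cN closed_atMost)
    then have "\<exists>q\<in>bad. \<forall>p\<in>bad. snd q \<le> snd p"
    proof (rule continuous_attains_inf)
      show "bad \<noteq> {}" using \<open>\<not> N p > \<delta> / 2\<close> that by (auto simp: bad_def)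
    qed (intro continuous_intros)
    then obtain q where q: "q \<in> bad" "\<And>p. p \<in> bad \<Longrightarrow> snd q \<le> snd p"
      by blast
    obtain r1 t1 where rt: "q = (r1, t1)" by (cases q)
    have r1: "r1 \<in> {0..1}" and t1: "t1 \<in> {0..t2}" and Nq: "N (r1, t1) \<le> \<delta> / 2"
      using q(1) rt by (auto simp: bad_def D_def)
    have before: "N (r, t) > \<delta> / 2" if "r \<in> {0..1}" "t \<in> {0..<t1}" for r t
    proof (rule ccontr)
      assume "\<not> N (r, t) > \<delta> / 2"
      then have "(r, t) \<in> bad" using that t1 by (auto simp: bad_def D_def)
      then show False using q(2)[of "(r, t)"] that rt by simp
    qed
    have L: "L \<ge> 1" using K(1) by (simp add: L_def)
    have "t1 \<noteq> 0" using Nq \<delta>(1) \<delta>(2)[OF r1] by (auto simp: N_def)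
    then have t1p: "t1 > 0" "t1 \<in> {0<..<T}" "t1 \<in> {0..<T}" using t1 t2 by auto
    have "\<delta> * 1 \<le> N (1, t1)"
      unfolding N_def snd_conv using \<delta>(1) \<delta>(3)[OF t1] L t1 by (intro mult_mono) auto
    then have "r1 \<noteq> 1" using Nq \<delta>(1) by auto
    then have r1': "r1 \<in> {0..<1}" using r1 by auto
    have isC: "isCont (\<lambda>t. \<phi> (r, t)) t1" if "smooth_on V \<phi>" "r \<in> {0..1}" for \<phi> r
      using DERIV_isCont[OF smooth_on_DERIV_dt[OF V(1) that(1) strip_in_V[OF that(2) t1p(3)]]] .
    \<comment> \<open>Limit of the strict inequality at earlier times. Hence \<open>r1\<close>
      minimizes \<open>mu\<close> over the whole slice \<open>t = t1\<close>, and equality holds in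
      \<open>Nq\<close>.\<close>
    have at_t1: "N (r, t1) \<ge> \<delta> / 2" if r: "r \<in> {0..1}" for r
    proof -
      have "((\<lambda>t. N (r, t)) \<longlongrightarrow> N (r, t1)) (at t1)"
        unfolding N_def mu_def snd_conv
        by (intro tendsto_intros isContD[OF isC] tendsto_min smooth_curv r)
      then have "((\<lambda>t. N (r, t)) \<longlongrightarrow> N (r, t1)) (at_left t1)"
        by (rule filterlim_at_split[THEN iffD1, THEN conjunct1])
      moreover have "\<forall>\<^sub>F t in at_left t1. \<delta> / 2 \<le> N (r, t)"
      proof (rule eventually_mono[OF eventually_at_left_real[OF t1p(1)]])
        fix t assume "t \<in> {0<..<t1}"
        then show "\<delta> / 2 \<le> N (r, t)" using before[OF r, of t] by simp
      qed
      ultimately show ?thesis by (rule tendsto_lowerbound) simp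
    qed
    define m where "m = mu (r1, t1)"
    have Nm: "m * exp (L * t1) = \<delta> / 2" using Nq at_t1[OF r1] by (simp add: N_def m_def)
    have m: "m > 0" using Nm \<delta>(1) by (smt (verit) exp_gt_zero half_gt_zero zero_less_mult_iff)
    have min: "m \<le> mu (r, t1)" if "r \<in> {0..1}" for r
    proof -
      have "m * exp (L * t1) \<le> mu (r, t1) * exp (L * t1)"
        unfolding Nm using at_t1[OF that] by (simp add: N_def)
      then show ?thesis by (rule mult_right_le_imp_le) simp
    qed
    have mins: "m \<le> al (r, t1)" "m \<le> be (r, t1)" "m \<le> ga (r, t1)" if "r \<in> {0..1}" for r
      using min[OF that] by (auto simp: mu_def)
    \<comment> \<open>A curvature attaining the minimum would have \<open>\<phi> e^(L t)\<close>
      strictly increasing at \<open>t1\<close>, hence below \<open>\<delta> / 2\<close> shortly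
      before, contrary to \<open>before\<close>.\<close>
    have absurd: False
      if \<phi>: "smooth_on V \<phi>" "\<phi> (r1, t1) = m" "\<And>p. mu p \<le> \<phi> p" "dt \<phi> (r1, t1) \<ge> - K * \<phi> (r1, t1)" for \<phi>
    proof -
      have p1: "(r1, t1) \<in> V" using strip_in_V r1 t1p by auto
      have "((\<lambda>t. \<phi> (r1, t) * exp (L * t)) has_real_derivative (dt \<phi> (r1, t1) + L * m) * exp (L * t1)) (at t1)"
        using \<phi>(2) by (auto intro!: derivative_eq_intros smooth_on_DERIV_dt[OF V(1) \<phi>(1) p1] simp: algebra_simps)
      moreover have "(dt \<phi> (r1, t1) + L * m) * exp (L * t1) > 0"
        using \<phi>(2,4) m by (intro mult_pos_pos) (auto simp: L_def algebra_simps)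
      ultimately obtain d where d: "d > 0" "\<And>k. k > 0 \<Longrightarrow> k < d \<Longrightarrow>
          \<phi> (r1, t1 - k) * exp (L * (t1 - k)) < \<phi> (r1, t1) * exp (L * t1)"
        using DERIV_pos_inc_left by blast
      define k where "k = min d t1 / 2"
      have k: "k > 0" "k < d" "k < t1" using d(1) t1p by (auto simp: k_def min_def)
      have "\<phi> (r1, t1 - k) * exp (L * (t1 - k)) < \<delta> / 2" using d(2)[OF k(1,2)] \<phi>(2) Nm by simp
      moreover have "N (r1, t1 - k) > \<delta> / 2" using before[OF r1, of "t1 - k"] k by simp
      moreover have "N (r1, t1 - k) \<le> \<phi> (r1, t1 - k) * exp (L * (t1 - k))"
        unfolding N_def snd_conv using \<phi>(3) by (intro mult_right_mono) auto
      ultimately show False by linarith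
    qed
    have "be (r1, t1) = m \<or> ga (r1, t1) = m"
    proof (rule ccontr)
      assume not: "\<not> (be (r1, t1) = m \<or> ga (r1, t1) = m)"
      then have gt: "be (r1, t1) > m" "ga (r1, t1) > m" using mins[OF r1] by auto
      then have alm: "al (r1, t1) = m" by (simp add: m_def mu_def min_def split: if_splits)
      \<comment> \<open>At the core \<alpha> and \<beta> coincide, so \<alpha> cannot be strictly
        smaller than \<beta> there.\<close>
      have r10: "r1 > 0" using core_al_be[OF t1p(3)] alm gt r1 by (cases "r1 = 0") auto
      have p1: "(r1, t1) \<in> V" using strip_in_V r1 t1p by auto
      have "dr al (r1, t1) = 0"
      proof (rule DERIV_local_min[OF smooth_on_DERIV_dr[OF V(1) smooth_curv(1) p1]])
        show "0 < min r1 (1 - r1)" using r10 r1' by simp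
        show "\<forall>y. \<bar>r1 - y\<bar> < min r1 (1 - r1) \<longrightarrow> al (r1, t1) \<le> al (y, t1)"
        proof (intro allI impI)
          fix y assume "\<bar>r1 - y\<bar> < min r1 (1 - r1)"
          then have "y \<in> {0..1}" unfolding abs_less_iff by auto
          then show "al (r1, t1) \<le> al (y, t1)" using mins(1) alm by simp
        qed
      qed
      then have 0: "b (r1, t1) * (ga (r1, t1) - m) + a (r1, t1) * (be (r1, t1) - m) = 0"
        using dr_al[OF p1 r10 t1p(3)] V_nz(3)[OF p1] by (simp add: alm)
      have ab: "a (r1, t1) * b (r1, t1) = m" using al_eq[OF p1 r10 t1p(3)] alm by simp
      \<comment> \<open>Multiplying by \<open>a\<close> turns the coefficient \<open>b\<close> into
        \<open>a b = m > 0\<close> and \<open>a\<close> into a square, so the individual signs of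
        \<open>a\<close> and \<open>b\<close> do not matter.\<close>
      have "m * (ga (r1, t1) - m) + (a (r1, t1))\<^sup>2 * (be (r1, t1) - m)
          = a (r1, t1) * (b (r1, t1) * (ga (r1, t1) - m) + a (r1, t1) * (be (r1, t1) - m))"
        unfolding ab[symmetric] by (simp add: algebra_simps power2_eq_square)
      also have "\<dots> = 0" using 0 by simp
      finally have "m * (ga (r1, t1) - m) + (a (r1, t1))\<^sup>2 * (be (r1, t1) - m) = 0" .
      moreover have "m * (ga (r1, t1) - m) > 0" using m gt by simp
      moreover have "(a (r1, t1))\<^sup>2 * (be (r1, t1) - m) \<ge> 0" using gt by simp
      ultimately show False by linarith
    qed
    moreover have nonneg: "al (r1, t1) \<ge> 0" "be (0, t1) \<ge> 0"
      using mins(1)[OF r1] mins(2)[of 0] m by auto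
    moreover have False if e: "be (r1, t1) = m"
    proof (rule absurd[OF smooth_curv(2) e])
      show "mu p \<le> be p" for p by (auto simp: mu_def min_le_iff_disj)
      show "- K * be (r1, t1) \<le> dt be (r1, t1)"
        by (rule dt_be_at_min[OF t1p(2) r1' K(3)[OF _ t1] nonneg]) (use e m mins(2) in auto)
    qed
    moreover have False if e: "ga (r1, t1) = m"
    proof (rule absurd[OF smooth_curv(3) e])
      show "mu p \<le> ga p" for p by (auto simp: mu_def min_le_iff_disj)
      show "- K * ga (r1, t1) \<le> dt ga (r1, t1)"
        by (rule dt_ga_at_min[OF t1p(2) r1' K(2)[OF _ t1] nonneg]) (use e m mins(3) in auto)
    qed
    ultimately show False by blast
  qed
  then have "N (r, t) > \<delta> / 2" using assms by (simp add: D_def t2_def)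
  then have "mu (r, t) > 0"
    using \<delta>(1) by (smt (verit) N_def exp_gt_zero half_gt_zero zero_less_mult_iff)
  then show "al (r, t) > 0" "be (r, t) > 0" "ga (r, t) > 0" by (auto simp: mu_def)
qed

end

section \<open>The derivative of the functional\<close>

lemma lborel_product_mult:
  fixes u :: "'a::euclidean_space \<Rightarrow> real" and v :: "'b::euclidean_space \<Rightarrow> real"
  assumes u: "integrable lborel u" and v: "integrable lborel v"
  shows "integrable lborel (\<lambda>(x, y). u x * v y)"
    "integral\<^sup>L lborel (\<lambda>(x, y). u x * v y) = integral\<^sup>L lborel u * integral\<^sup>L lborel v"
proof -
  have meas [measurable]: "u \<in> borel_measurable borel" "v \<in> borel_measurable borel"
    using u v by auto
  have int: "integrable (lborel \<Otimes>\<^sub>M lborel) (\<lambda>(x, y). u x * v y)"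
  proof (rule lborel_pair.Fubini_integrable)
    show "integrable lborel (\<lambda>x. \<integral>y. norm (case (x, y) of (x, y) \<Rightarrow> u x * v y) \<partial>lborel)"
      using u by (simp add: abs_mult)
    show "AE x in lborel. integrable lborel (\<lambda>y. case (x, y) of (x, y) \<Rightarrow> u x * v y)"
      using v by simp
  qed measurable
  then show "integrable lborel (\<lambda>(x, y). u x * v y)" by (simp add: lborel_prod)
  show "integral\<^sup>L lborel (\<lambda>(x, y). u x * v y) = integral\<^sup>L lborel u * integral\<^sup>L lborel v"
    using lborel_pair.integral_fst'[OF int] by (simp add: lborel_prod)
qed

lemma integral_unit_box:
  fixes j :: "real \<Rightarrow> real"
  assumes "continuous_on {0..1} j"
  shows "(LINT y:{0..<1::real} \<times> {0..<1::real} \<times> {0..1::real}|lborel. (case y of (m, l, r) \<Rightarrow> j r)) = integral {0..1} j"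
proof -
  let ?u = "indicator {0..<1} :: real \<Rightarrow> real" and ?v = "\<lambda>r. indicator {0..1} r * j r"
  have u: "integrable lborel ?u" "integral\<^sup>L lborel ?u = 1" by auto
  have v: "integrable lborel ?v" "integral\<^sup>L lborel ?v = integral {0..1} j"
    using borel_integrable_atLeastAtMost'[OF assms] set_borel_integral_eq_integral(2)[OF borel_integrable_atLeastAtMost'[OF assms]]
    by (simp_all add: set_integrable_def set_lebesgue_integral_def)
  have uv: "integrable lborel (\<lambda>(l, r). ?u l * ?v r)" "integral\<^sup>L lborel (\<lambda>(l, r). ?u l * ?v r) = integral {0..1} j"
    using lborel_product_mult[OF u(1) v(1)] u(2) v(2) by simp_all
  have "(LINT y:{0..<1::real} \<times> {0..<1::real} \<times> {0..1::real}|lborel. (case y of (m, l, r) \<Rightarrow> j r))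
      = integral\<^sup>L lborel (\<lambda>(m, y). ?u m * (case y of (l, r) \<Rightarrow> ?u l * ?v r))"
  proof -
    have "(\<lambda>y. indicator ({0..<1::real} \<times> {0..<1::real} \<times> {0..1}) y *\<^sub>R (case y of (m, l, r) \<Rightarrow> j r))
        = (\<lambda>(m, y). ?u m * (case y of (l, r) \<Rightarrow> ?u l * ?v r))"
      by (auto simp: fun_eq_iff indicator_def)
    then show ?thesis by (simp only: set_lebesgue_integral_def)
  qed
  also have "\<dots> = integral {0..1} j"
    unfolding lborel_product_mult(2)[OF u(1) uv(1)] u(2) uv(2) by simp
  finally show ?thesis .
qed

context torus_flow
begin

lemma strip_nonneg: "r \<in> {0..1} \<Longrightarrow> t \<in> {0..<T} \<Longrightarrow> ff (r, t) \<ge> 0"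
  using ff_pos[OF strip_in_V, of r t] core_values(1)[of t] by (cases "r = 0") auto

lemma cont_strip:
  assumes "smooth_on V \<phi>"
  shows "continuous_on ({0..1} \<times> {0..<T}) \<phi>"
  by (rule continuous_on_subset[OF smooth_on_continuous[OF V(1) assms]]) (auto intro: strip_in_V)

lemma cont_slice: "smooth_on V \<phi> \<Longrightarrow> t \<in> {0..<T} \<Longrightarrow> continuous_on {0..1} (\<lambda>r. \<phi> (r, t))"
  by (rule continuous_on_compose2[OF cont_strip]) (auto intro!: continuous_intros)

lemma cont_c_slice: "t \<in> {0..<T} \<Longrightarrow> continuous_on {0..1} (\<lambda>r. region.c (r, t))"
  unfolding region.c_def by (intro continuous_intros cont_slice smooth_curv)

lemma cont_J_slice: "t \<in> {0..<T} \<Longrightarrow> continuous_on {0..1} (\<lambda>r. region.J (r, t))"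
  unfolding region.J_def by (intro continuous_intros cont_slice cont_c_slice smooth_curv smooth_V) auto

lemma J_integral_eq:
  assumes t: "t \<in> {0..<T}"
  shows "J_integral (rot_metric f g h t) = integral {0..1} (\<lambda>r. region.J (r, t))"
proof -
  let ?G = "rot_metric f g h t"
  have *: "(einstein_trace ?G x / 3 - root 3 (einstein_det ?G x)) * sqrt (det (?G x)) = region.J (r, t)"
    if r: "r \<in> {0..1}" and x: "x $ 3 = r" for x r
  proof -
    have "det (?G x) = (ff (r, t) * gg (r, t) * hh (r, t))\<^sup>2"
      by (simp add: rot_metric_diag3 det_diag3 x ff_def gg_def hh_def power_mult_distrib)
    then have det: "sqrt (det (?G x)) = ff (r, t) * gg (r, t) * hh (r, t)"
      using strip_nonneg[OF r t] V_pos(2,3)[OF strip_in_V[OF r t]] by (simp add: real_sqrt_abs abs_mult)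
    show ?thesis
    proof (cases "r = 0")
      \<comment> \<open>On the core \<open>f = 0\<close> makes the volume density vanish, so the
        value of the curvature expression at the singular coordinate point is harmless.\<close>
      case True
      then show ?thesis using core_values(1)[OF t] by (simp add: det region.J_def)
    next
      case False
      then show ?thesis
        using curvature(4,5)[OF _ t x] r by (simp add: det region.J_def region.c_def)
    qed
  qed
  have "J_integral ?G = (LINT y:{0..<1::real} \<times> {0..<1::real} \<times> {0..1::real}|lborel. (case y of (m, l, r) \<Rightarrow> region.J (r, t)))"
    unfolding J_integral_def
    unfolding set_lebesgue_integral_def
  proof (rule arg_cong[where f="integral\<^sup>L lborel"], rule ext)
    fix y :: "real \<times> real \<times> real"
    obtain m l r where y: "y = (m, l, r)" by (cases y)
    show "indicator ({0..<1} \<times> {0..<1} \<times> {0..1}) y *\<^sub>R (case y of (m, l, r) \<Rightarrow>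
          let x = vector [m, l, r] in
          (einstein_trace ?G x / 3 - root 3 (einstein_det ?G x)) * sqrt (det (?G x)))
        = indicator ({0..<1} \<times> {0..<1} \<times> {0..1}) y *\<^sub>R (case y of (m, l, r) \<Rightarrow> region.J (r, t))"
      using *[of r "vector [m, l, r]"] by (simp add: y Let_def indicator_def)
  qed
  also have "\<dots> = integral {0..1} (\<lambda>r. region.J (r, t))"
    by (rule integral_unit_box[OF cont_J_slice[OF t]])
  finally show ?thesis .
qed

text \<open>An explicit formula instead of an abstract derivative: it is visibly continuous on the
  whole strip, including \<open>r = 0\<close>, \<open>r = 1\<close> and \<open>t = 0\<close>, as
  differentiation under the integral demands.\<close>

definition Jt where
  "Jt p = ((dt al p + dt be p + dt ga p) / 3
      - region.c p / 3 * (dt al p / al p + dt be p / be p + dt ga p / ga p)) * (ff p * gg p * hh p)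
    + ((al p + be p + ga p) / 3 - region.c p) * (dt ff p * gg p * hh p + ff p * dt gg p * hh p + ff p * gg p * dt hh p)"

lemma DERIV_J:
  assumes r: "r \<in> {0..1}" and t: "t \<in> {0..<T}"
  shows "((\<lambda>t. region.J (r, t)) has_real_derivative Jt (r, t)) (at t)"
proof -
  note D = smooth_on_DERIV_dt[OF V(1) _ strip_in_V[OF r t]]
  have c: "((\<lambda>t. region.c (r, t)) has_real_derivative region.c (r, t) / 3 * (dt al (r, t) / al (r, t)
      + dt be (r, t) / be (r, t) + dt ga (r, t) / ga (r, t))) (at t)"
    unfolding region.c_def by (intro DERIV_root3_prod curv_pos r t D smooth_curv)
  show ?thesis
    unfolding region.J_def Jt_def
    by (rule DERIV_cdivide derivative_eq_intros c D smooth_curv smooth_V refl)+ (simp add: algebra_simps)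
qed

lemma cont_Jt: "continuous_on ({0..1} \<times> {0..<T}) Jt"
proof -
  have nz: "\<forall>p\<in>{0..1} \<times> {0..<T}. al p \<noteq> 0" "\<forall>p\<in>{0..1} \<times> {0..<T}. be p \<noteq> 0" "\<forall>p\<in>{0..1} \<times> {0..<T}. ga p \<noteq> 0"
    using curv_pos by (auto simp: less_imp_neq[THEN not_sym])
  have c: "continuous_on ({0..1} \<times> {0..<T}) region.c"
    unfolding region.c_def[abs_def] by (intro continuous_intros cont_strip smooth_curv)
  show ?thesis
    unfolding Jt_def[abs_def]
    by (intro continuous_on_add continuous_on_diff continuous_on_mult continuous_on_divide continuous_on_const
        smooth_curv[THEN cont_strip] smooth_V[THEN cont_strip] smooth_curv[THEN smooth_on_dt[OF V(1)], THEN cont_strip]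
        smooth_V[THEN smooth_on_dt[OF V(1)], THEN cont_strip] nz c) simp_all
qed

text \<open>The flux \<open>region.Theta\<close>, written so that it is continuous up to the core.\<close>

definition flux where
  "flux p = ff p * gg p * (al p * (region.y p + region.z p) + b p * ga p * (ga p - al p))
    + gg p * (dr ff p / hh p) * be p * (be p - al p)
    - ff p * gg p * region.c p * (dr al p / hh p + al p * region.y p / be p + al p * region.z p / ga p)"

lemma flux_eq_Theta: "p \<in> W \<Longrightarrow> flux p = region.Theta p"
proof -
  assume p: "p \<in> W"
  obtain x t where xt: "p = (x, t)" by (cases p)
  have xt': "(x, t) \<in> V" "x > 0" "t \<in> {0..<T}" using p W_V by (auto simp: xt W_def)
  have 1: "dr al p / hh p = b p * (ga p - al p) + a p * (be p - al p)"
    using dr_al[OF xt'] V_nz(3)[OF xt'(1)] by (simp add: xt)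
  have 2: "dr ff p / hh p = a p * ff p" using region.dr(1)[OF p] region.h_nz[OF p] by simp
  show ?thesis unfolding flux_def region.Theta_def region.Q_def 1 2 by (simp add: algebra_simps)
qed

text \<open>All terms but one carry the factor \<open>f = 0\<close>. The remaining one, with
  \<open>f_r / h\<close> in place of \<open>a f\<close>, carries \<open>\<beta> - \<alpha>\<close>,
  which is 0 on the core.\<close>

lemma flux_core: "t \<in> {0..<T} \<Longrightarrow> flux (0, t) = 0"
  using core_values(1)[of t] core_al_be[of t] by (simp add: flux_def)

text \<open>The boundary conditions do not prescribe \<open>\<beta>_s\<close> and
  \<open>\<gamma>_s\<close>, but both cancel: with \<open>c = \<alpha> = \<beta> = \<gamma>\<close>
  they enter the trace part and the determinant part with the same coefficient, and
  \<open>\<alpha>_s = 0\<close>.\<close>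

lemma flux_boundary:
  assumes t: "t \<in> {0..<T}"
  shows "flux (1, t) = 0"
proof -
  have p: "(1, t) \<in> V" using strip_in_V t by simp
  note eq = boundary_curv(2,3)[OF t] and pos = boundary_pos[OF t]
  have "dr al (1, t) = 0" using dr_al[OF p _ t] eq by simp
  moreover have "region.c (1, t) = al (1, t)"
  proof -
    have "al (1, t) * be (1, t) * ga (1, t) = al (1, t) ^ 3" by (simp add: eq power3_eq_cube)
    then show ?thesis unfolding region.c_def by (simp add: odd_real_root_power_cancel)
  qed
  ultimately show ?thesis using pos by (simp add: flux_def eq algebra_simps)
qed

lemma cont_flux:
  assumes t: "t \<in> {0..<T}"
  shows "continuous_on {0..1} (\<lambda>r. flux (r, t))"
proof -
  have nz: "\<forall>r\<in>{0..1}. hh (r, t) \<noteq> 0" "\<forall>r\<in>{0..1}. be (r, t) \<noteq> 0" "\<forall>r\<in>{0..1}. ga (r, t) \<noteq> 0"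
    using curv_pos[OF _ t] V_nz(3)[OF strip_in_V[OF _ t]] by (auto simp: less_imp_neq[THEN not_sym])
  show ?thesis
    unfolding flux_def region.y_def region.z_def
    by (intro continuous_on_add continuous_on_diff continuous_on_mult continuous_on_divide
        cont_slice[OF _ t] cont_c_slice[OF t] smooth_curv smooth_V smooth_b smooth_dr_V nz)
qed

lemma J_derivative_nonpos:
  assumes t: "t \<in> {0<..<T}"
  shows "integral {0..1} (\<lambda>r. Jt (r, t)) \<le> 0"
proof -
  have tT: "t \<in> {0..<T}" using t by simp
  \<comment> \<open>The flux is differentiated in the interior only. The value \<open>3 * Jt\<close>
    at the endpoints makes \<open>3 * Jt \<le> k\<close> hold on the closed interval without
    affecting the integral.\<close>
  define k where "k r = (if r \<in> {0<..<1} then deriv (\<lambda>r. flux (r, t)) r else 3 * Jt (r, t))" for r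
  have *: "((\<lambda>r. flux (r, t)) has_real_derivative k r) (at r) \<and> Jt (r, t) \<le> k r / 3"
    if r: "r \<in> {0<..<1}" for r
  proof -
    have W: "(r, t) \<in> W" using r t by (simp add: W_def)
    obtain D E where D: "((\<lambda>t. region.J (r, t)) has_real_derivative D) (at t)"
      and E: "((\<lambda>x. region.Theta (x, t)) has_real_derivative E) (at r)" and le: "D \<le> E / 3"
      using region.J_dissipation[OF W] curv_pos[OF _ tT] r
      by (metis atLeastAtMost_iff greaterThanLessThan_iff less_imp_le)
    have "((\<lambda>r. flux (r, t)) has_real_derivative E) (at r)"
      using region.DERIV_W_eq(1)[OF W, of flux region.Theta] flux_eq_Theta E by simp
    moreover from this have "k r = E" using r by (simp add: k_def DERIV_imp_deriv)
    moreover have "Jt (r, t) = D" using DERIV_J[of r t] D DERIV_unique r tT by fastforce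
    ultimately show ?thesis using le by simp
  qed
  have "(k has_integral flux (1, t) - flux (0, t)) {0..1}"
  proof (rule fundamental_theorem_of_calculus_interior)
    show "continuous_on {0..1} (\<lambda>r. flux (r, t))" by (rule cont_flux[OF tT])
    show "((\<lambda>r. flux (r, t)) has_vector_derivative k r) (at r)" if "r \<in> {0<..<1}" for r
      using *[OF that] by (simp add: has_real_derivative_iff_has_vector_derivative)
  qed simp
  then have k: "(k has_integral 0) {0..1}" using flux_core[OF tT] flux_boundary[OF tT] by simp
  have "continuous_on {0..1} (\<lambda>r. Jt (r, t))"
    by (rule continuous_on_compose2[OF cont_Jt]) (use tT in \<open>auto intro!: continuous_intros\<close>)
  then have "(\<lambda>r. 3 * Jt (r, t)) integrable_on {0..1}"
    by (intro integrable_continuous_interval continuous_intros)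
  then have "integral {0..1} (\<lambda>r. 3 * Jt (r, t)) \<le> 0"
    by (rule has_integral_le[OF integrable_integral k]) (use * in \<open>force simp: k_def\<close>)
  then show ?thesis by simp
qed

lemma J_monotone:
  assumes t: "t \<in> {0..<T}"
  shows "\<exists>D. ((\<lambda>\<tau>. J_integral (rot_metric f g h \<tau>)) has_real_derivative D) (at t within {0..<T}) \<and> D \<le> 0"
proof -
  let ?D = "\<lambda>t. integral {0..1} (\<lambda>r. Jt (r, t))"
  have c: "continuous_on ({0..<T} \<times> cbox 0 1) (\<lambda>(t, r). Jt (r, t))"
    unfolding case_prod_beta'
  proof (rule continuous_on_compose2[OF cont_Jt])
    show "continuous_on ({0..<T} \<times> cbox 0 1) (\<lambda>p. (snd p, fst p) :: real \<times> real)"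
      by (intro continuous_intros)
  qed auto
  have "((\<lambda>\<tau>. integral (cbox 0 1) (\<lambda>r. region.J (r, \<tau>))) has_real_derivative integral (cbox 0 1) (\<lambda>r. Jt (r, t)))
      (at t within {0..<T})"
  proof (rule leibniz_rule_field_derivative[where fx="\<lambda>t r. Jt (r, t)", OF _ _ c t])
    show "((\<lambda>\<tau>. region.J (r, \<tau>)) has_real_derivative Jt (r, \<tau>)) (at \<tau> within {0..<T})"
      if "\<tau> \<in> {0..<T}" "r \<in> cbox 0 1" for \<tau> r
      using DERIV_J[of r \<tau>] that by (simp add: has_field_derivative_at_within)
    show "(\<lambda>r. region.J (r, \<tau>)) integrable_on cbox 0 1" if "\<tau> \<in> {0..<T}" for \<tau>
      using integrable_continuous_interval[OF cont_J_slice[OF that]] by simp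
  qed simp
  then have D: "((\<lambda>\<tau>. J_integral (rot_metric f g h \<tau>)) has_real_derivative ?D t) (at t within {0..<T})"
    unfolding cbox_interval
    by (rule has_field_derivative_transform_within[OF _ zero_less_one t]) (simp add: J_integral_eq)
  have "?D t \<le> 0"
  proof (cases "t = 0")
    case False
    then show ?thesis using J_derivative_nonpos t by simp
  next
    case True
    \<comment> \<open>The dissipation inequality was derived for \<open>t > 0\<close>; continuity of
      the derivative carries its sign to the initial time.\<close>
    have "continuous_on {0..<T} ?D" using integral_continuous_on_param[OF c] by simp
    then have "(?D \<longlongrightarrow> ?D 0) (at 0 within {0..<T})" using T by (simp add: continuous_on_def)
    moreover have "at 0 within {0..<T} = at_right 0"
      by (rule at_within_nhd[of 0 "{..<T}"]) (use T in auto)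
    ultimately have "(?D \<longlongrightarrow> ?D 0) (at_right 0)" by simp
    moreover have "\<forall>\<^sub>F t in at_right 0. ?D t \<le> 0"
      by (rule eventually_mono[OF eventually_at_right_real[OF T]]) (rule J_derivative_nonpos)
    ultimately show ?thesis using True by (auto intro: tendsto_upperbound)
  qed
  then show ?thesis using D by blast
qed

end

theorem theorem6:
  fixes f g h :: "real \<Rightarrow> real \<Rightarrow> real" and T \<theta> :: real
  assumes "0 < \<theta>" "\<theta> < 1" "0 < T"
    and "rot_metric_family T f g h"
    and "initial_conditions \<theta> f g h"
    and "boundary_conditions T f g h"
    and "cross_curvature_flow T (rot_metric f g h)"
  shows "\<forall>t\<in>{0..<T}. \<exists>D. ((\<lambda>\<tau>. J_integral (rot_metric f g h \<tau>)) has_real_derivative D)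
           (at t within {0..<T}) \<and> D \<le> 0"
proof -
  obtain U where U: "open U" "{-1..1} \<times> {0..<T} \<subseteq> U" "smooth_on U (\<lambda>(r, t). f r t)"
    "smooth_on U (\<lambda>(r, t). g r t)" "smooth_on U (\<lambda>(r, t). h r t)"
    using assms(4) unfolding rot_metric_family_def by blast
  have "\<forall>t\<in>{0..<T}. (\<forall>r\<in>{-1..1}. f (- r) t = - f r t \<and> g (- r) t = g r t \<and> h (- r) t = h r t)
      \<and> (\<forall>r\<in>{0<..1}. f r t > 0) \<and> (\<forall>r\<in>{0..1}. g r t > 0 \<and> h r t > 0)
      \<and> deriv (\<lambda>r. f r t) 0 = 2 * pi * h 0 t"
    using assms(4) unfolding rot_metric_family_def by (rule conjunct2)
  then interpret torus_flow U T f g h \<theta>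
    by unfold_locales (simp_all add: assms(3,5-7) U)
  show ?thesis using J_monotone by blast
qed

end
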